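(* Let $A$ be a finite set, $S=F(A)$ the free left regular band with identity on $A$, and $k$ a field. Then $kS\cong kQ$ as $k$-algebras, where $Q$ is the quiver of $kS$ and $kQ$ is its path algebra.
   Context: $F(A)$ is the set of all finite sequences of distinct elements of $A$ (including the empty sequence, which is the identity), with product given by concatenation followed by deleting every element that has already occurred earlier. The quiver of a finite-dimensional algebra whose simple modules are all one-dimensional has one vertex per isomorphism class of simple modules and $\dim_k\operatorname{Ext}^1(M_X,M_Y)$ arrows from $X$ to $Y$. The path algebra $kQ$ has basis the paths of $Q$ (including trivial paths at vertices), with product given by concatenation of composable paths and $0$ otherwise. *)

theory Defs
  imports
    "HOL-Algebra.QuotRing"
    "Jordan_Normal_Form.Missing_VectorSpace"
    "Graph_Theory.Arc_Walk"
begin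

section \<open>The free left regular band with identity\<close>

fun keep_first :: "'a list \<Rightarrow> 'a list" where
  "keep_first [] = []"
| "keep_first (x # xs) = x # filter (\<lambda>y. y \<noteq> x) (keep_first xs)"

definition free_lrb :: "'a set \<Rightarrow> 'a list monoid" where
  "free_lrb A =
    \<lparr>carrier = {xs. distinct xs \<and> set xs \<subseteq> A},
     monoid.mult = (\<lambda>xs ys. keep_first (xs @ ys)),
     one = []\<rparr>"


section \<open>Free modules and algebras given by a basis\<close>

text \<open>
  Elements are functions with finite support contained in \<open>X\<close>. The ring \<open>R\<close> need not be
  commutative, and scalars act from the left. Module records carry the unused ring fields
  \<open>mult\<close> and \<open>one\<close>.
\<close>

definition free_module :: "('r, 'c) ring_scheme \<Rightarrow> 'x set \<Rightarrow> ('r, 'x \<Rightarrow> 'r) module" where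
  "free_module R X =
    \<lparr>carrier = {f. range f \<subseteq> carrier R \<and> finite {x. f x \<noteq> \<zero>\<^bsub>R\<^esub>} \<and> {x. f x \<noteq> \<zero>\<^bsub>R\<^esub>} \<subseteq> X},
     monoid.mult = undefined,
     one = undefined,
     zero = (\<lambda>_. \<zero>\<^bsub>R\<^esub>),
     add = (\<lambda>f g x. f x \<oplus>\<^bsub>R\<^esub> g x),
     smult = (\<lambda>a f x. a \<otimes>\<^bsub>R\<^esub> f x)\<rparr>"

text \<open>
  The algebra with basis \<open>X\<close> in which the product of basis elements \<open>y\<close> and \<open>z\<close> is the basis
  element \<open>x\<close> if \<open>prd y z = Some x\<close>, and \<open>0\<close> if \<open>prd y z = None\<close>. Its identity is the
  sum of the basis elements in \<open>E\<close>.
\<close>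

definition basis_algebra ::
    "('k, 'c) ring_scheme \<Rightarrow> 'x set \<Rightarrow> ('x \<Rightarrow> 'x \<Rightarrow> 'x option) \<Rightarrow> 'x set \<Rightarrow> ('k, 'x \<Rightarrow> 'k) module" where
  "basis_algebra k X prd E = (free_module k X)
    \<lparr>monoid.mult := (\<lambda>f g x.
       \<Oplus>\<^bsub>k\<^esub>p \<in> {(y, z). f y \<noteq> \<zero>\<^bsub>k\<^esub> \<and> g z \<noteq> \<zero>\<^bsub>k\<^esub> \<and> prd y z = Some x}.
         f (fst p) \<otimes>\<^bsub>k\<^esub> g (snd p)),
     one := (\<lambda>x. if x \<in> E then \<one>\<^bsub>k\<^esub> else \<zero>\<^bsub>k\<^esub>)\<rparr>"

definition monoid_algebra ::
    "('k, 'c) ring_scheme \<Rightarrow> ('s, 'd) monoid_scheme \<Rightarrow> ('k, 's \<Rightarrow> 'k) module" where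
  "monoid_algebra k S = basis_algebra k (carrier S) (\<lambda>s t. Some (s \<otimes>\<^bsub>S\<^esub> t)) {\<one>\<^bsub>S\<^esub>}"

text \<open>
  A quiver is a directed multigraph. A path is a triple \<open>(u, p, v)\<close> of its source, the list of
  its arrows in the order of traversal, and its target.
\<close>

definition quiver_paths :: "('v, 'e) pre_digraph \<Rightarrow> ('v \<times> 'e list \<times> 'v) set" where
  "quiver_paths Q = {(u, p, v). pre_digraph.awalk Q u p v}"

fun path_concat :: "'v \<times> 'e list \<times> 'v \<Rightarrow> 'v \<times> 'e list \<times> 'v \<Rightarrow> ('v \<times> 'e list \<times> 'v) option" where
  "path_concat (u, p, v) (v', q, w) = (if v = v' then Some (u, p @ q, w) else None)"

definition path_algebra ::
    "('k, 'c) ring_scheme \<Rightarrow> ('v, 'e) pre_digraph \<Rightarrow> ('k, 'v \<times> 'e list \<times> 'v \<Rightarrow> 'k) module" where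
  "path_algebra k Q =
    basis_algebra k (quiver_paths Q) path_concat {(v, [], v) | v. v \<in> verts Q}"

definition algebra_isomorphic ::
    "('k, 'c) ring_scheme \<Rightarrow> ('k, 'a, 'd) module_scheme \<Rightarrow> ('k, 'b, 'e) module_scheme \<Rightarrow> bool" where
  "algebra_isomorphic k A B \<longleftrightarrow>
    (\<exists>h \<in> ring_iso A B. \<forall>c \<in> carrier k. \<forall>x \<in> carrier A. h (c \<odot>\<^bsub>A\<^esub> x) = c \<odot>\<^bsub>B\<^esub> h x)"


section \<open>Modules over noncommutative rings\<close>

text \<open>The locale \<^locale>\<open>Module.module\<close> is restricted to commutative rings.\<close>

locale left_module = R?: ring R + M?: abelian_group M
  for R :: "('r, 'c) ring_scheme" (structure) and M :: "('r, 'm, 'd) module_scheme" (structure) +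
  assumes smult_closed:
      "\<lbrakk>a \<in> carrier R; x \<in> carrier M\<rbrakk> \<Longrightarrow> a \<odot>\<^bsub>M\<^esub> x \<in> carrier M"
    and smult_l_distr:
      "\<lbrakk>a \<in> carrier R; b \<in> carrier R; x \<in> carrier M\<rbrakk> \<Longrightarrow>
        (a \<oplus> b) \<odot>\<^bsub>M\<^esub> x = a \<odot>\<^bsub>M\<^esub> x \<oplus>\<^bsub>M\<^esub> b \<odot>\<^bsub>M\<^esub> x"
    and smult_r_distr:
      "\<lbrakk>a \<in> carrier R; x \<in> carrier M; y \<in> carrier M\<rbrakk> \<Longrightarrow>
        a \<odot>\<^bsub>M\<^esub> (x \<oplus>\<^bsub>M\<^esub> y) = a \<odot>\<^bsub>M\<^esub> x \<oplus>\<^bsub>M\<^esub> a \<odot>\<^bsub>M\<^esub> y"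
    and smult_assoc:
      "\<lbrakk>a \<in> carrier R; b \<in> carrier R; x \<in> carrier M\<rbrakk> \<Longrightarrow>
        (a \<otimes> b) \<odot>\<^bsub>M\<^esub> x = a \<odot>\<^bsub>M\<^esub> (b \<odot>\<^bsub>M\<^esub> x)"
    and smult_one: "x \<in> carrier M \<Longrightarrow> \<one> \<odot>\<^bsub>M\<^esub> x = x"

definition simple_module :: "('r, 'c) ring_scheme \<Rightarrow> ('r, 'm, 'd) module_scheme \<Rightarrow> bool" where
  "simple_module R M \<longleftrightarrow> left_module R M \<and> carrier M \<noteq> {\<zero>\<^bsub>M\<^esub>} \<and>
    (\<forall>U. Module.submodule U R M \<longrightarrow> U = {\<zero>\<^bsub>M\<^esub>} \<or> U = carrier M)"

definition module_isomorphic ::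
    "('r, 'c) ring_scheme \<Rightarrow> ('r, 'm, 'd) module_scheme \<Rightarrow> ('r, 'n, 'e) module_scheme \<Rightarrow> bool" where
  "module_isomorphic R M N \<longleftrightarrow>
    (\<exists>h \<in> LinearCombinations.module_hom R M N. bij_betw h (carrier M) (carrier N))"

definition quotient_module :: "('r, 'm, 'd) module_scheme \<Rightarrow> 'm set \<Rightarrow> ('r, 'm set) module" where
  "quotient_module M W =
    \<lparr>carrier = a_rcosets\<^bsub>M\<^esub> W,
     monoid.mult = undefined,
     one = undefined,
     zero = W,
     add = (\<lambda>U V. U <+>\<^bsub>M\<^esub> V),
     smult = (\<lambda>c U. \<Union>x\<in>U. W +>\<^bsub>M\<^esub> (c \<odot>\<^bsub>M\<^esub> x))\<rparr>"


section \<open>The space \<open>Ext\<^sup>1\<close>\<close>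

text \<open>
  For modules over a \<open>k\<close>-algebra \<open>A\<close>, the set \<open>Hom\<^sub>A(M, N)\<close> is a \<open>k\<close>-vector space, where
  \<open>c \<in> k\<close> acts on \<open>N\<close> through \<open>c \<cdot> 1 \<in> A\<close>.
\<close>

definition hom_space ::
    "('k, 'b, 'c) module_scheme \<Rightarrow> ('b, 'm, 'd) module_scheme \<Rightarrow> ('b, 'n, 'e) module_scheme
      \<Rightarrow> ('k, 'm \<Rightarrow> 'n) module" where
  "hom_space A M N =
    \<lparr>carrier = LinearCombinations.module_hom A M N \<inter> extensional (carrier M),
     monoid.mult = undefined,
     one = undefined,
     zero = (\<lambda>x\<in>carrier M. \<zero>\<^bsub>N\<^esub>),
     add = (\<lambda>f g. \<lambda>x\<in>carrier M. f x \<oplus>\<^bsub>N\<^esub> g x),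
     smult = (\<lambda>c f. \<lambda>x\<in>carrier M. (c \<odot>\<^bsub>A\<^esub> \<one>\<^bsub>A\<^esub>) \<odot>\<^bsub>N\<^esub> f x)\<rparr>"

text \<open>
  The free module on the underlying set of \<open>M\<close>, its canonical surjection onto \<open>M\<close>, and the
  kernel of the latter. Iterating yields the free resolution
  \<open>\<dots> \<rightarrow> P\<^sub>2 \<rightarrow> P\<^sub>1 \<rightarrow> P\<^sub>0 \<rightarrow> M \<rightarrow> 0\<close> with \<open>P\<^sub>i = free_cover A (syzygy\<^sup>i M)\<close>, whose
  differential \<open>P\<^sub>i\<^sub>+\<^sub>1 \<rightarrow> P\<^sub>i\<close> is \<open>cover_map A (syzygy\<^sup>i\<^sup>+\<^sup>1 M)\<close>
  followed by the inclusion of \<open>syzygy\<^sup>i\<^sup>+\<^sup>1 M\<close> in \<open>P\<^sub>i\<close>.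
\<close>

definition free_cover ::
    "('b, 'c) ring_scheme \<Rightarrow> ('b, 'm, 'd) module_scheme \<Rightarrow> ('b, 'm \<Rightarrow> 'b) module" where
  "free_cover A M = free_module A (carrier M)"

definition cover_map ::
    "('b, 'c) ring_scheme \<Rightarrow> ('b, 'm, 'd) module_scheme \<Rightarrow> ('m \<Rightarrow> 'b) \<Rightarrow> 'm" where
  "cover_map A M f = (\<Oplus>\<^bsub>M\<^esub>m \<in> {m. f m \<noteq> \<zero>\<^bsub>A\<^esub>}. f m \<odot>\<^bsub>M\<^esub> m)"

definition syzygy ::
    "('b, 'c) ring_scheme \<Rightarrow> ('b, 'm, 'd) module_scheme \<Rightarrow> ('b, 'm \<Rightarrow> 'b) module" where
  "syzygy A M = (free_cover A M)
    \<lparr>carrier := {f \<in> carrier (free_cover A M). cover_map A M f = \<zero>\<^bsub>M\<^esub>}\<rparr>"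

text \<open>
  \<open>Ext\<^sup>1\<^sub>A(M, N)\<close> is the first cohomology of the complex
  \<open>Hom\<^sub>A(P\<^sub>0, N) \<rightarrow> Hom\<^sub>A(P\<^sub>1, N) \<rightarrow> Hom\<^sub>A(P\<^sub>2, N)\<close>.
\<close>

definition ext1_cocycles ::
    "('k, 'b, 'c) module_scheme \<Rightarrow> ('b, 'm, 'd) module_scheme \<Rightarrow> ('b, 'n, 'e) module_scheme
      \<Rightarrow> ('k, (('m \<Rightarrow> 'b) \<Rightarrow> 'b) \<Rightarrow> 'n) module" where
  "ext1_cocycles A M N = (hom_space A (free_cover A (syzygy A M)) N)
    \<lparr>carrier := {f \<in> carrier (hom_space A (free_cover A (syzygy A M)) N).
       \<forall>x \<in> carrier (free_cover A (syzygy A (syzygy A M))).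
         f (cover_map A (syzygy A (syzygy A M)) x) = \<zero>\<^bsub>N\<^esub>}\<rparr>"

definition ext1_coboundaries ::
    "('k, 'b, 'c) module_scheme \<Rightarrow> ('b, 'm, 'd) module_scheme \<Rightarrow> ('b, 'n, 'e) module_scheme
      \<Rightarrow> ((('m \<Rightarrow> 'b) \<Rightarrow> 'b) \<Rightarrow> 'n) set" where
  "ext1_coboundaries A M N =
    {\<lambda>x \<in> carrier (free_cover A (syzygy A M)). g (cover_map A (syzygy A M) x) | g.
      g \<in> carrier (hom_space A (free_cover A M) N)}"

definition ext1 ::
    "('k, 'b, 'c) module_scheme \<Rightarrow> ('b, 'm, 'd) module_scheme \<Rightarrow> ('b, 'n, 'e) module_scheme
      \<Rightarrow> ('k, ((('m \<Rightarrow> 'b) \<Rightarrow> 'b) \<Rightarrow> 'n) set) module" where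
  "ext1 A M N = quotient_module (ext1_cocycles A M N) (ext1_coboundaries A M N)"


section \<open>The quiver of an algebra\<close>

text \<open>
  A simple \<open>A\<close>-module is a quotient of \<open>A\<close>, so it has an isomorphic copy whose elements are
  elements of the type underlying \<open>A\<close>. Hence every isomorphism class of simple modules is
  represented in the following quotient.
\<close>

definition simple_classes :: "('b, 'c) ring_scheme \<Rightarrow> ('b, 'b) module set set" where
  "simple_classes A = {M. simple_module A M} //
    {(M, N). simple_module A M \<and> simple_module A N \<and> module_isomorphic A M N}"

definition algebra_quiver ::
    "('k, 'c) ring_scheme \<Rightarrow> ('k, 'b, 'd) module_scheme \<Rightarrow>
      (('b, 'b) module set, ('b, 'b) module set \<times> ('b, 'b) module set \<times> nat) pre_digraph" where
  "algebra_quiver k A =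
    \<lparr>verts = simple_classes A,
     arcs = {(X, Y, i). X \<in> simple_classes A \<and> Y \<in> simple_classes A \<and>
       i < vectorspace.dim k (ext1 A (SOME M. M \<in> X) (SOME N. N \<in> Y))},
     tail = (\<lambda>(X, Y, i). X),
     head = (\<lambda>(X, Y, i). Y)\<rparr>"

end

theory Submission
  imports Defs
begin

text \<open>
  Order the letters, and call the first element of a set of letters its leader. Call a family of
  elements \<open>x\<^sub>a\<close> of a ring left regular if \<open>x\<^sub>a z x\<^sub>a = x\<^sub>a z\<close> for all \<open>z\<close>. For such a family,
  let \<open>F\<^sub>X\<close> be the product of the \<open>x\<^sub>a\<close> with \<open>a \<in> X\<close> in the given order, followed by the product of
  the \<open>1 - x\<^sub>a\<close> with \<open>a \<notin> X\<close> in the reverse order. The \<open>F\<^sub>X\<close> are orthogonal idempotents with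
  sum \<open>1\<close>, and \<open>F\<^sub>Y x\<^sub>a F\<^sub>X\<close> with \<open>Y \<noteq> X\<close> vanishes unless \<open>Y \<subset> X\<close> and \<open>a \<in> X - Y\<close> is not the
  leader of \<open>X - Y\<close>. The letters form such a family in \<open>kS\<close>. Let \<open>Q'\<close> be the quiver on the
  subsets of \<open>A\<close> with one arrow \<open>Y \<rightarrow> X\<close> for each such \<open>a\<close>; in \<open>kQ'\<close> the sums of the vertices
  containing \<open>a\<close> and the arrows labelled \<open>a\<close> form such a family, whose \<open>F\<^sub>X\<close> is the vertex \<open>X\<close>. So
  \<open>a \<mapsto> x\<^sub>a\<close> defines a homomorphism \<open>kS \<rightarrow> kQ'\<close>, with inverse \<open>X \<mapsto> F\<^sub>X\<close> on vertices
  and \<open>F\<^sub>Y a F\<^sub>X\<close> on arrows.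

  On a simple module every word acts as \<open>0\<close> or \<open>1\<close>, and the simple modules are the one-dimensional
  \<open>M\<^sub>X\<close> on which \<open>w\<close> acts as \<open>1\<close> if and only if its letters lie in \<open>X\<close>. The space
  \<open>Ext\<^sup>1(M\<^sub>X, M\<^sub>Y)\<close> consists of the derivations \<open>d(vw) = v d(w) + d(v) w\<close> modulo the inner ones. If
  \<open>Y \<subseteq> X\<close>, the values on the letters in \<open>X - Y\<close> are arbitrary and the inner derivations are constant on
  them; otherwise every derivation is inner. Hence the dimension is \<open>|X - Y| - 1\<close> if
  \<open>Y \<subset> X\<close>, and \<open>0\<close> otherwise. Taking complements identifies this quiver with \<open>Q'\<close>.
\<close>

section \<open>Free modules\<close>

text \<open>The idempotent F_X acts as the identity on M_X and as zero on the other simple modules.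
  For left modules, a nonzero class of F_Y a F_X belongs to Ext^1(M_X, M_Y), so it is an arrow from
  X to Y of the quiver; but paths are composed from left to right, where an element between F_Y and
  F_X runs from Y to X. Matching M_X with F_X would therefore give the path algebra of the opposite
  quiver. Complementation reverses inclusions and keeps the size of X - Y, so it identifies the
  quiver with its opposite; this is what the complement is for.

  Both sides lose one letter of X - Y, for different reasons. In Ext^1 the common value of an inner
  derivation is divided out and no letter is distinguished. In the algebra the order singles out the
  leader d, whose two factors meet as (1 - \<open>x\<^sub>d\<close>) \<open>x\<^sub>d\<close> = 0.
  Hence only the number of arrows is carried over from Ext^1, and the labels are then assigned by
  enumeration.

  The inverse homomorphism is written down explicitly, so no dimension count is needed: both
  composites are compared with the identity on letters and on paths.\<close>

abbreviation "mhom \<equiv> LinearCombinations.module_hom"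

lemmas mhom_def = LinearCombinations.module_hom_def
  and mhom_closed = LinearCombinations.module_hom_closed
  and mhom_add = LinearCombinations.module_hom_add
  and mhom_smult = LinearCombinations.module_hom_smult

text \<open>Only additivity of \<open>h\<close> is assumed, because the rule also serves for the map
  that sends a ring element \<open>a\<close> to \<open>a x\<close> with \<open>x\<close> fixed in a
  module.\<close>

lemma additive_zero:
  assumes "abelian_group M" "abelian_group N" "h \<in> carrier M \<rightarrow> carrier N"
    and "\<And>x y. \<lbrakk>x \<in> carrier M; y \<in> carrier M\<rbrakk> \<Longrightarrow> h (x \<oplus>\<^bsub>M\<^esub> y) = h x \<oplus>\<^bsub>N\<^esub> h y"
  shows "h \<zero>\<^bsub>M\<^esub> = \<zero>\<^bsub>N\<^esub>"
proof -
  interpret M: abelian_group M by fact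
  interpret N: abelian_group N by fact
  have c: "h \<zero>\<^bsub>M\<^esub> \<in> carrier N" using assms(3) by auto
  have "h \<zero>\<^bsub>M\<^esub> \<oplus>\<^bsub>N\<^esub> h \<zero>\<^bsub>M\<^esub> = h \<zero>\<^bsub>M\<^esub>"
    using assms(4)[of "\<zero>\<^bsub>M\<^esub>" "\<zero>\<^bsub>M\<^esub>"] by simp
  then show ?thesis using c by (metis N.add.r_cancel_one')
qed

lemma additive_finsum:
  assumes "abelian_group M" "abelian_group N" "h \<in> carrier M \<rightarrow> carrier N"
    and add: "\<And>x y. \<lbrakk>x \<in> carrier M; y \<in> carrier M\<rbrakk> \<Longrightarrow> h (x \<oplus>\<^bsub>M\<^esub> y) = h x \<oplus>\<^bsub>N\<^esub> h y"
    and "f \<in> I \<rightarrow> carrier M"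
  shows "h (finsum M f I) = (\<Oplus>\<^bsub>N\<^esub>i\<in>I. h (f i))"
proof -
  interpret M: abelian_group M by fact
  interpret N: abelian_group N by fact
  note z = additive_zero[OF assms(1-4)]
  show ?thesis
  proof (cases "finite I")
    case True
    then show ?thesis using assms(5)
    proof (induction I)
      case empty
      then show ?case using z by simp
    next
      case (insert i I)
      then have "f \<in> I \<rightarrow> carrier M" "f i \<in> carrier M" by auto
      moreover have "(\<lambda>i. h (f i)) \<in> I \<rightarrow> carrier N" "h (f i) \<in> carrier N"
        using insert.prems assms(3) by (auto simp: Pi_iff)
      ultimately show ?case using insert by (simp add: add)
    qed
  qed (simp add: z)
qed

lemma additive_minus:
  assumes "abelian_group M" "abelian_group N" "h \<in> carrier M \<rightarrow> carrier N"
    and add: "\<And>x y. \<lbrakk>x \<in> carrier M; y \<in> carrier M\<rbrakk> \<Longrightarrow> h (x \<oplus>\<^bsub>M\<^esub> y) = h x \<oplus>\<^bsub>N\<^esub> h y"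
    and "x \<in> carrier M"
  shows "h (\<ominus>\<^bsub>M\<^esub> x) = \<ominus>\<^bsub>N\<^esub> h x"
proof -
  interpret M: abelian_group M by fact
  interpret N: abelian_group N by fact
  have "h (\<ominus>\<^bsub>M\<^esub> x) \<oplus>\<^bsub>N\<^esub> h x = \<zero>\<^bsub>N\<^esub>"
    using add[of "\<ominus>\<^bsub>M\<^esub> x" x] additive_zero[OF assms(1-4)] assms(5) by (simp add: M.l_neg)
  moreover have "h x \<in> carrier N" "h (\<ominus>\<^bsub>M\<^esub> x) \<in> carrier N" using assms(3,5) by auto
  ultimately show ?thesis by (rule N.minus_equality[symmetric])
qed

lemma module_hom_zero:
  assumes "abelian_group M" "abelian_group N" "h \<in> mhom R M N"
  shows "h \<zero>\<^bsub>M\<^esub> = \<zero>\<^bsub>N\<^esub>"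
  by (rule additive_zero[OF assms(1,2)])
    (use assms(3) in \<open>auto simp: mhom_def\<close>)

lemma module_hom_finsum:
  assumes "abelian_group M" "abelian_group N" "h \<in> mhom R M N"
    and "f \<in> I \<rightarrow> carrier M"
  shows "h (finsum M f I) = (\<Oplus>\<^bsub>N\<^esub>i\<in>I. h (f i))"
  by (rule additive_finsum[OF assms(1,2) _ _ assms(4)])
    (use assms(3) in \<open>auto simp: mhom_def\<close>)

context left_module
begin

lemma smult_zero_left: "x \<in> carrier M \<Longrightarrow> \<zero> \<odot>\<^bsub>M\<^esub> x = \<zero>\<^bsub>M\<^esub>"
  using additive_zero[of R M "\<lambda>a. a \<odot>\<^bsub>M\<^esub> x"] smult_closed smult_l_distr
  by (simp add: R.abelian_group_axioms M.abelian_group_axioms)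

lemma smult_zero_right: "a \<in> carrier R \<Longrightarrow> a \<odot>\<^bsub>M\<^esub> \<zero>\<^bsub>M\<^esub> = \<zero>\<^bsub>M\<^esub>"
  using additive_zero[of M M "\<lambda>x. a \<odot>\<^bsub>M\<^esub> x"] smult_closed smult_r_distr
  by (simp add: M.abelian_group_axioms)

lemma smult_finsum:
  "\<lbrakk>a \<in> carrier R; f \<in> I \<rightarrow> carrier M\<rbrakk> \<Longrightarrow>
    a \<odot>\<^bsub>M\<^esub> finsum M f I = (\<Oplus>\<^bsub>M\<^esub>i\<in>I. a \<odot>\<^bsub>M\<^esub> f i)"
  using additive_finsum[of M M "\<lambda>x. a \<odot>\<^bsub>M\<^esub> x"] smult_closed smult_r_distr
  by (simp add: M.abelian_group_axioms)

lemma smult_minus_right: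
  "\<lbrakk>a \<in> carrier R; x \<in> carrier M\<rbrakk> \<Longrightarrow> a \<odot>\<^bsub>M\<^esub> (\<ominus>\<^bsub>M\<^esub> x) = \<ominus>\<^bsub>M\<^esub> (a \<odot>\<^bsub>M\<^esub> x)"
  using additive_minus[of M M "\<lambda>x. a \<odot>\<^bsub>M\<^esub> x"] smult_closed smult_r_distr
  by (simp add: M.abelian_group_axioms)

lemma smult_minus_left:
  "\<lbrakk>a \<in> carrier R; x \<in> carrier M\<rbrakk> \<Longrightarrow> (\<ominus> a) \<odot>\<^bsub>M\<^esub> x = \<ominus>\<^bsub>M\<^esub> (a \<odot>\<^bsub>M\<^esub> x)"
  using additive_minus[of R M "\<lambda>a. a \<odot>\<^bsub>M\<^esub> x"] smult_closed smult_l_distr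
  by (simp add: R.abelian_group_axioms M.abelian_group_axioms)

end

text \<open>Carries the module structure of the free module over to an algebra on the same
  functions, which differs from it only in its product and its identity.\<close>

lemma left_module_cong:
  assumes "left_module R M" "carrier N = carrier M" "add N = add M" "zero N = zero M"
    "smult N = smult M"
  shows "left_module R N"
proof -
  interpret left_module R M by fact
  have "abelian_group N"
    by (rule abelian_groupI) (auto simp: assms M.a_ac intro: M.l_neg)
  then show ?thesis
    by (intro left_module.intro left_module_axioms.intro R.ring_axioms)
      (simp_all add: assms smult_closed smult_l_distr smult_r_distr smult_assoc smult_one)
qed

section \<open>Linear extension from a basis\<close>

definition basis_vec :: "('r, 'c) ring_scheme \<Rightarrow> 'x \<Rightarrow> 'x \<Rightarrow> 'r" where
  "basis_vec R x = (\<lambda>y. if y = x then \<one>\<^bsub>R\<^esub> else \<zero>\<^bsub>R\<^esub>)"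

text \<open>Summing over the support of \<open>f\<close> keeps the basis out of the definition; it
  enters only when \<open>f\<close> is required to lie in the free module on
  \<open>X\<close>.\<close>

definition lin_ext ::
    "('r, 'c) ring_scheme \<Rightarrow> ('r, 'm, 'd) module_scheme \<Rightarrow> ('x \<Rightarrow> 'm) \<Rightarrow> ('x \<Rightarrow> 'r) \<Rightarrow> 'm" where
  "lin_ext R M \<theta> f = (\<Oplus>\<^bsub>M\<^esub>x \<in> {x. f x \<noteq> \<zero>\<^bsub>R\<^esub>}. f x \<odot>\<^bsub>M\<^esub> \<theta> x)"

lemma free_module_carrier_iff:
  "f \<in> carrier (free_module R X) \<longleftrightarrow>
    (\<forall>x. f x \<in> carrier R) \<and> finite {x. f x \<noteq> \<zero>\<^bsub>R\<^esub>} \<and> (\<forall>x. f x \<noteq> \<zero>\<^bsub>R\<^esub> \<longrightarrow> x \<in> X)"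
  unfolding free_module_def by auto

lemma free_module_ops [simp]:
  "zero (free_module R X) = (\<lambda>_. \<zero>\<^bsub>R\<^esub>)"
  "add (free_module R X) = (\<lambda>f g x. f x \<oplus>\<^bsub>R\<^esub> g x)"
  "smult (free_module R X) = (\<lambda>a f x. a \<otimes>\<^bsub>R\<^esub> f x)"
  unfolding free_module_def by auto

lemma free_module_left_module:
  assumes "ring R"
  shows "left_module R (free_module R X)"
proof -
  interpret R: ring R by fact
  have grp: "abelian_group (free_module R X)"
  proof (rule abelian_groupI, goal_cases)
    case (1 x y)
    then have "{z. x z \<oplus>\<^bsub>R\<^esub> y z \<noteq> \<zero>\<^bsub>R\<^esub>} \<subseteq> {z. x z \<noteq> \<zero>\<^bsub>R\<^esub>} \<union> {z. y z \<noteq> \<zero>\<^bsub>R\<^esub>}" by auto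
    with 1 show ?case
      by (auto simp: free_module_carrier_iff intro: finite_subset)
  next
    case (6 x)
    then have "{z. \<ominus>\<^bsub>R\<^esub> x z \<noteq> \<zero>\<^bsub>R\<^esub>} \<subseteq> {z. x z \<noteq> \<zero>\<^bsub>R\<^esub>}" by auto
    with 6 have "(\<lambda>z. \<ominus>\<^bsub>R\<^esub> x z) \<in> carrier (free_module R X)"
      by (auto simp: free_module_carrier_iff intro: finite_subset)
    then show ?case using 6
      by (intro bexI[of _ "\<lambda>z. \<ominus>\<^bsub>R\<^esub> x z"]) (auto simp: free_module_carrier_iff R.l_neg)
  qed (auto simp: free_module_carrier_iff R.a_ac)
  have cl: "(\<lambda>x. a \<otimes>\<^bsub>R\<^esub> f x) \<in> carrier (free_module R X)"
    if "a \<in> carrier R" "f \<in> carrier (free_module R X)" for a f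
  proof -
    have "{z. a \<otimes>\<^bsub>R\<^esub> f z \<noteq> \<zero>\<^bsub>R\<^esub>} \<subseteq> {z. f z \<noteq> \<zero>\<^bsub>R\<^esub>}" using that by auto
    then show ?thesis using that by (auto simp: free_module_carrier_iff intro: finite_subset)
  qed
  show ?thesis
  proof (intro left_module.intro left_module_axioms.intro assms grp, goal_cases)
    case (1 a f)
    then show ?case using cl by simp
  next
    case (2 a b f)
    then have "f x \<in> carrier R" for x by (simp add: free_module_carrier_iff)
    with 2 show ?case by (simp add: R.l_distr)
  next
    case (3 a f g)
    then have "f x \<in> carrier R" "g x \<in> carrier R" for x by (simp_all add: free_module_carrier_iff)
    with 3 show ?case by (simp add: R.r_distr)
  next
    case (4 a b f)
    then have "f x \<in> carrier R" for x by (simp add: free_module_carrier_iff)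
    with 4 show ?case by (simp add: R.m_assoc)
  next
    case (5 f)
    then have "f x \<in> carrier R" for x by (simp add: free_module_carrier_iff)
    with 5 show ?case by simp
  qed
qed

lemma basis_vec_closed:
  "\<lbrakk>ring R; x \<in> X\<rbrakk> \<Longrightarrow> basis_vec R x \<in> carrier (free_module R X)"
  by (auto simp: free_module_carrier_iff basis_vec_def ring.ring_simprules)

text \<open>Induction on the support: setting one coordinate of \<open>f\<close> to zero splits off
  a multiple of one basis vector and leaves a smaller support.\<close>

lemma free_module_induct [consumes 2, case_names zero add basis]:
  assumes "ring R" "f \<in> carrier (free_module R X)"
    and zero: "P (\<lambda>_. \<zero>\<^bsub>R\<^esub>)"
    and add: "\<And>f g. \<lbrakk>f \<in> carrier (free_module R X); g \<in> carrier (free_module R X); P f; P g\<rbrakk> \<Longrightarrow>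
      P (\<lambda>x. f x \<oplus>\<^bsub>R\<^esub> g x)"
    and basis: "\<And>a x. \<lbrakk>a \<in> carrier R; x \<in> X\<rbrakk> \<Longrightarrow> P (\<lambda>y. a \<otimes>\<^bsub>R\<^esub> basis_vec R x y)"
  shows "P f"
proof -
  interpret R: ring R by fact
  interpret left_module R "free_module R X" by (rule free_module_left_module) fact
  have "\<forall>f. {x. f x \<noteq> \<zero>\<^bsub>R\<^esub>} = F \<longrightarrow> f \<in> carrier (free_module R X) \<longrightarrow> P f" if "finite F" for F
    using that
  proof (induction F)
    case empty
    have "f = (\<lambda>_. \<zero>\<^bsub>R\<^esub>)" if "{x. f x \<noteq> \<zero>\<^bsub>R\<^esub>} = {}" for f :: "'b \<Rightarrow> 'a"
      using that by auto
    then show ?case using zero by auto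
  next
    case (insert x F)
    show ?case
    proof (intro allI impI)
      fix f assume f: "{x. f x \<noteq> \<zero>\<^bsub>R\<^esub>} = insert x F" "f \<in> carrier (free_module R X)"
      define g where "g = f(x := \<zero>\<^bsub>R\<^esub>)"
      have g: "{x. g x \<noteq> \<zero>\<^bsub>R\<^esub>} = F" "g \<in> carrier (free_module R X)"
        using f insert.hyps by (auto simp: g_def free_module_carrier_iff elim: rev_finite_subset)
      have x: "x \<in> X" "f x \<in> carrier R" using f by (auto simp: free_module_carrier_iff)
      have "f = (\<lambda>y. g y \<oplus>\<^bsub>R\<^esub> f x \<otimes>\<^bsub>R\<^esub> basis_vec R x y)"
        using f x by (auto simp: g_def basis_vec_def free_module_carrier_iff fun_eq_iff)
      moreover have "P (\<lambda>y. g y \<oplus>\<^bsub>R\<^esub> f x \<otimes>\<^bsub>R\<^esub> basis_vec R x y)"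
        using add[OF g(2) _ _ basis[OF x(2,1)]] insert.IH g basis_vec_closed[OF assms(1) x(1)]
          smult_closed[OF x(2), of "basis_vec R x"] by auto
      ultimately show "P f" by simp
    qed
  qed
  then show ?thesis using assms(2) by (auto simp: free_module_carrier_iff)
qed

context left_module
begin

text \<open>Different functions have different supports, so their sums can be compared only over a
  common finite set. The additional terms have coefficient zero.\<close>

lemma lin_ext_superset:
  assumes f: "f \<in> carrier (free_module R X)" and \<theta>: "\<theta> \<in> X \<rightarrow> carrier M"
    and F: "finite F" "F \<subseteq> X" "{x. f x \<noteq> \<zero>} \<subseteq> F"
  shows "lin_ext R M \<theta> f = (\<Oplus>\<^bsub>M\<^esub>x \<in> F. f x \<odot>\<^bsub>M\<^esub> \<theta> x)"
  unfolding lin_ext_def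
proof (rule M.add.finprod_mono_neutral_cong_left)
  have "f x \<odot>\<^bsub>M\<^esub> \<theta> x \<in> carrier M" if "x \<in> F" for x
    using that F \<theta> f by (intro smult_closed) (auto simp: free_module_carrier_iff)
  then show "(\<lambda>x. f x \<odot>\<^bsub>M\<^esub> \<theta> x) \<in> F \<rightarrow> carrier M" by auto
  show "f i \<odot>\<^bsub>M\<^esub> \<theta> i = \<zero>\<^bsub>M\<^esub>" if "i \<in> F - {x. f x \<noteq> \<zero>}" for i
    using that F \<theta> by (auto intro!: smult_zero_left)
qed (use F in auto)

lemma lin_ext_hom:
  assumes \<theta>: "\<theta> \<in> X \<rightarrow> carrier M"
  shows "lin_ext R M \<theta> \<in> mhom R (free_module R X) M"
proof -
  interpret F: left_module R "free_module R X" by (rule free_module_left_module) (rule R.ring_axioms)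
  have cl: "f x \<odot>\<^bsub>M\<^esub> \<theta> x \<in> carrier M" if "x \<in> X" "f \<in> carrier (free_module R X)" for f x
    using that \<theta> by (intro smult_closed) (auto simp: free_module_carrier_iff)
  have 1: "lin_ext R M \<theta> f \<in> carrier M" if "f \<in> carrier (free_module R X)" for f
    unfolding lin_ext_def using cl[OF _ that] that
    by (intro M.finsum_closed) (auto simp: free_module_carrier_iff)
  have 2: "lin_ext R M \<theta> (f \<oplus>\<^bsub>free_module R X\<^esub> g) = lin_ext R M \<theta> f \<oplus>\<^bsub>M\<^esub> lin_ext R M \<theta> g"
    if f: "f \<in> carrier (free_module R X)" and g: "g \<in> carrier (free_module R X)" for f g
  proof -
    \<comment> \<open>Cancellation can make the support of the sum smaller than this union, which is
      why all three sums are taken over the union.\<close>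
    define F where "F = {x. f x \<noteq> \<zero>} \<union> {x. g x \<noteq> \<zero>}"
    have F: "finite F" "F \<subseteq> X" using f g by (auto simp: free_module_carrier_iff F_def)
    have fg: "f \<oplus>\<^bsub>free_module R X\<^esub> g \<in> carrier (free_module R X)"
      using f g by (rule F.M.a_closed)
    have s: "{x. (f \<oplus>\<^bsub>free_module R X\<^esub> g) x \<noteq> \<zero>} \<subseteq> F" by (auto simp: F_def)
    show ?thesis
      apply (simp only: lin_ext_superset[OF fg \<theta> F s])
      apply (subst lin_ext_superset[OF f \<theta> F], simp add: F_def)
      apply (subst lin_ext_superset[OF g \<theta> F], simp add: F_def)
      apply (subst M.finsum_addf[symmetric])
      subgoal using F cl[OF _ f] by auto
      subgoal using F cl[OF _ g] by auto
      apply (rule M.finsum_cong')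
      subgoal by simp
      subgoal using F cl[OF _ f] cl[OF _ g] by auto
      subgoal for x using F f g \<theta> by (auto simp: free_module_carrier_iff Pi_iff intro!: smult_l_distr)
      done
  qed
  have 3: "lin_ext R M \<theta> (a \<odot>\<^bsub>free_module R X\<^esub> f) = a \<odot>\<^bsub>M\<^esub> lin_ext R M \<theta> f"
    if a: "a \<in> carrier R" and f: "f \<in> carrier (free_module R X)" for a f
  proof -
    define F where "F = {x. f x \<noteq> \<zero>}"
    have F: "finite F" "F \<subseteq> X" using f by (auto simp: free_module_carrier_iff F_def)
    have af: "a \<odot>\<^bsub>free_module R X\<^esub> f \<in> carrier (free_module R X)"
      using a f by (rule F.smult_closed)
    have s: "{x. (a \<odot>\<^bsub>free_module R X\<^esub> f) x \<noteq> \<zero>} \<subseteq> F" using a by (auto simp: F_def)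
    show ?thesis
      apply (simp only: lin_ext_superset[OF af \<theta> F s])
      apply (subst lin_ext_superset[OF f \<theta> F], simp add: F_def)
      apply (subst smult_finsum[OF a])
      subgoal using F cl[OF _ f] by auto
      apply (rule M.finsum_cong')
      subgoal by simp
      subgoal using F cl[OF _ f] a by (auto intro: smult_closed)
      subgoal for x using F f \<theta> a by (auto simp: free_module_carrier_iff Pi_iff intro!: smult_assoc)
      done
  qed
  show ?thesis
    unfolding mhom_def
  proof (intro CollectI conjI allI impI funcsetI)
    fix f assume "f \<in> carrier (free_module R X)"
    then show "lin_ext R M \<theta> f \<in> carrier M" by (rule 1)
  next
    fix f g assume "f \<in> carrier (free_module R X) \<and> g \<in> carrier (free_module R X)"
    then show "lin_ext R M \<theta> (f \<oplus>\<^bsub>free_module R X\<^esub> g) = lin_ext R M \<theta> f \<oplus>\<^bsub>M\<^esub> lin_ext R M \<theta> g"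
      using 2 by blast
  next
    fix a f assume "a \<in> carrier R \<and> f \<in> carrier (free_module R X)"
    then show "lin_ext R M \<theta> (a \<odot>\<^bsub>free_module R X\<^esub> f) = a \<odot>\<^bsub>M\<^esub> lin_ext R M \<theta> f"
      using 3 by blast
  qed
qed

lemma lin_ext_basis_vec:
  assumes "\<theta> x \<in> carrier M"
  shows "lin_ext R M \<theta> (basis_vec R x) = \<theta> x"
proof -
  have b: "basis_vec R x \<in> carrier (free_module R {x})"
    by (rule basis_vec_closed[OF R.ring_axioms]) simp
  have "lin_ext R M \<theta> (basis_vec R x) = (\<Oplus>\<^bsub>M\<^esub>y \<in> {x}. basis_vec R x y \<odot>\<^bsub>M\<^esub> \<theta> y)"
    using assms by (intro lin_ext_superset[OF b]) (auto simp: basis_vec_def)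
  also have "\<dots> = \<theta> x" using assms by (simp add: basis_vec_def smult_one)
  finally show ?thesis .
qed

text \<open>By this rule the later identities that are linear in one argument are checked on basis
  elements only.\<close>

lemma module_hom_free_eqI:
  assumes g: "g \<in> mhom R (free_module R X) M"
    and h: "h \<in> mhom R (free_module R X) M"
    and eq: "\<And>x. x \<in> X \<Longrightarrow> g (basis_vec R x) = h (basis_vec R x)"
    and f: "f \<in> carrier (free_module R X)"
  shows "g f = h f"
proof -
  interpret F: left_module R "free_module R X" by (rule free_module_left_module) (rule R.ring_axioms)
  show ?thesis using R.ring_axioms f
  proof (induction rule: free_module_induct)
    case zero
    show ?case
      using module_hom_zero[OF F.M.abelian_group_axioms M.abelian_group_axioms g]
        module_hom_zero[OF F.M.abelian_group_axioms M.abelian_group_axioms h] by simp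
  next
    case (add f f')
    then show ?case
      using mhom_add[OF g, of f f'] mhom_add[OF h, of f f'] by simp
  next
    case (basis a x)
    then show ?case
      using mhom_smult[OF g basis(1) basis_vec_closed[OF R.ring_axioms basis(2)]]
        mhom_smult[OF h basis(1) basis_vec_closed[OF R.ring_axioms basis(2)]] eq by simp
  qed
qed

end

section \<open>Algebras given by a basis\<close>

locale k_algebra =
  fixes k :: "('k, 'c) ring_scheme" and B :: "('k, 'b, 'd) module_scheme"
  assumes field_k: "field k" and ring_B: "ring B" and module_B: "left_module k B"
    and smult_mult_left: "\<lbrakk>c \<in> carrier k; x \<in> carrier B; y \<in> carrier B\<rbrakk> \<Longrightarrow>
      (c \<odot>\<^bsub>B\<^esub> x) \<otimes>\<^bsub>B\<^esub> y = c \<odot>\<^bsub>B\<^esub> (x \<otimes>\<^bsub>B\<^esub> y)"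
    and smult_mult_right: "\<lbrakk>c \<in> carrier k; x \<in> carrier B; y \<in> carrier B\<rbrakk> \<Longrightarrow>
      x \<otimes>\<^bsub>B\<^esub> (c \<odot>\<^bsub>B\<^esub> y) = c \<odot>\<^bsub>B\<^esub> (x \<otimes>\<^bsub>B\<^esub> y)"
begin

sublocale K: field k by (rule field_k)
sublocale B: ring B by (rule ring_B)
sublocale L: left_module k B by (rule module_B)

lemma mult_left_hom:
  "y \<in> carrier B \<Longrightarrow> (\<lambda>x. x \<otimes>\<^bsub>B\<^esub> y) \<in> mhom k B B"
  unfolding mhom_def by (auto simp: B.l_distr smult_mult_left)

lemma mult_right_hom:
  "x \<in> carrier B \<Longrightarrow> (\<lambda>y. x \<otimes>\<^bsub>B\<^esub> y) \<in> mhom k B B"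
  unfolding mhom_def by (auto simp: B.r_distr smult_mult_right)

end

lemma module_hom_comp:
  assumes "f \<in> mhom R M N" "g \<in> mhom R N P"
  shows "(\<lambda>x. g (f x)) \<in> mhom R M P"
  using assms unfolding mhom_def by (auto simp: Pi_iff)

lemma basis_algebra_ops [simp]:
  "carrier (basis_algebra k X prd E) = carrier (free_module k X)"
  "zero (basis_algebra k X prd E) = zero (free_module k X)"
  "add (basis_algebra k X prd E) = add (free_module k X)"
  "smult (basis_algebra k X prd E) = smult (free_module k X)"
  "one (basis_algebra k X prd E) = (\<lambda>x. if x \<in> E then \<one>\<^bsub>k\<^esub> else \<zero>\<^bsub>k\<^esub>)"
  unfolding basis_algebra_def free_module_def by auto

lemma basis_algebra_mult:
  "(f \<otimes>\<^bsub>basis_algebra k X prd E\<^esub> g) x =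
    (\<Oplus>\<^bsub>k\<^esub>p \<in> {(y, z). f y \<noteq> \<zero>\<^bsub>k\<^esub> \<and> g z \<noteq> \<zero>\<^bsub>k\<^esub> \<and> prd y z = Some x}.
         f (fst p) \<otimes>\<^bsub>k\<^esub> g (snd p))"
  unfolding basis_algebra_def free_module_def by simp

lemma module_hom_basis_algebra [simp]:
  "mhom k (basis_algebra k X prd E) M =
    mhom k (free_module k X) M"
  "mhom k M (basis_algebra k X prd E) =
    mhom k M (free_module k X)"
  unfolding mhom_def by simp_all

text \<open>Covers both the words with their product and the paths with partial concatenation.
  \<open>Option.bind\<close> propagates undefined products, so \<open>prd_assoc\<close> makes the
  two bracketings undefined together. The unit laws are local: each basis element has exactly one
  left and one right unit in \<open>E\<close> and is annihilated by the other elements of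
  \<open>E\<close>, as with trivial paths.\<close>

locale basis_mult = K: field k for k :: "('k, 'c) ring_scheme" +
  fixes X :: "'x set" and prd :: "'x \<Rightarrow> 'x \<Rightarrow> 'x option" and E :: "'x set"
  assumes prd_closed: "\<lbrakk>x \<in> X; y \<in> X; prd x y = Some z\<rbrakk> \<Longrightarrow> z \<in> X"
    and prd_assoc: "\<lbrakk>x \<in> X; y \<in> X; z \<in> X\<rbrakk> \<Longrightarrow>
      Option.bind (prd x y) (\<lambda>u. prd u z) = Option.bind (prd y z) (prd x)"
    and E_subset: "E \<subseteq> X" and finite_E: "finite E"
    and unit_left: "x \<in> X \<Longrightarrow> \<exists>e\<in>E. prd e x = Some x \<and> (\<forall>e'\<in>E - {e}. prd e' x = None)"
    and unit_right: "x \<in> X \<Longrightarrow> \<exists>e\<in>E. prd x e = Some x \<and> (\<forall>e'\<in>E - {e}. prd x e' = None)"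
begin

abbreviation "B \<equiv> basis_algebra k X prd E"

sublocale F: left_module k "free_module k X"
  by (rule free_module_left_module) (rule K.ring_axioms)

sublocale L: left_module k B
  by (rule left_module_cong[OF F.left_module_axioms]) simp_all

text \<open>The index set of the defining sum depends on \<open>x\<close> and on both supports.
  Padding with zeros replaces it by one fixed rectangle, over which bilinearity holds term by
  term.\<close>

lemma mult_superset:
  assumes "f \<in> carrier B" "g \<in> carrier B" "finite F" "finite G"
    "{x. f x \<noteq> \<zero>\<^bsub>k\<^esub>} \<subseteq> F" "{x. g x \<noteq> \<zero>\<^bsub>k\<^esub>} \<subseteq> G"
  shows "(f \<otimes>\<^bsub>B\<^esub> g) x = (\<Oplus>\<^bsub>k\<^esub>p \<in> F \<times> G.
    if prd (fst p) (snd p) = Some x then f (fst p) \<otimes>\<^bsub>k\<^esub> g (snd p) else \<zero>\<^bsub>k\<^esub>)"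
  unfolding basis_algebra_mult
proof (rule K.add.finprod_mono_neutral_cong_left, goal_cases)
  case (3 i)
  moreover have "f y \<in> carrier k" "g y \<in> carrier k" for y
    using assms by (auto simp: free_module_carrier_iff)
  ultimately show ?case by (auto split: prod.splits)
qed (use assms in \<open>auto simp: free_module_carrier_iff\<close>)

lemma mult_closed:
  assumes f: "f \<in> carrier B" and g: "g \<in> carrier B"
  shows "f \<otimes>\<^bsub>B\<^esub> g \<in> carrier B"
proof -
  define F where "F = {x. f x \<noteq> \<zero>\<^bsub>k\<^esub>}"
  define G where "G = {x. g x \<noteq> \<zero>\<^bsub>k\<^esub>}"
  have fin: "finite F" "finite G" using f g by (auto simp: free_module_carrier_iff F_def G_def)
  have sub: "F \<subseteq> X" "G \<subseteq> X" using f g by (auto simp: free_module_carrier_iff F_def G_def)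
  have c: "f y \<in> carrier k" "g y \<in> carrier k" for y
    using f g by (auto simp: free_module_carrier_iff)
  have supp: "\<exists>y\<in>F. \<exists>z\<in>G. prd y z = Some x" if "(f \<otimes>\<^bsub>B\<^esub> g) x \<noteq> \<zero>\<^bsub>k\<^esub>" for x
  proof (rule ccontr)
    assume "\<not> ?thesis"
    then have "{(y, z). f y \<noteq> \<zero>\<^bsub>k\<^esub> \<and> g z \<noteq> \<zero>\<^bsub>k\<^esub> \<and> prd y z = Some x} = {}"
      by (auto simp: F_def G_def)
    then have "(f \<otimes>\<^bsub>B\<^esub> g) x = \<zero>\<^bsub>k\<^esub>" by (simp only: basis_algebra_mult K.finsum_empty)
    with that show False by simp
  qed
  \<comment> \<open>The support lies in the image of a finite rectangle; pairs with an undefined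
    product only enlarge that image.\<close>
  have "{x. (f \<otimes>\<^bsub>B\<^esub> g) x \<noteq> \<zero>\<^bsub>k\<^esub>} \<subseteq> (\<lambda>(y, z). the (prd y z)) ` (F \<times> G)"
    using supp by force
  then have "finite {x. (f \<otimes>\<^bsub>B\<^esub> g) x \<noteq> \<zero>\<^bsub>k\<^esub>}" using fin by (auto elim: finite_subset)
  moreover have "x \<in> X" if "(f \<otimes>\<^bsub>B\<^esub> g) x \<noteq> \<zero>\<^bsub>k\<^esub>" for x
    using supp[OF that] sub prd_closed by blast
  moreover have "(f \<otimes>\<^bsub>B\<^esub> g) x \<in> carrier k" for x
    unfolding basis_algebra_mult using c by (intro K.finsum_closed) auto
  ultimately show ?thesis by (simp add: free_module_carrier_iff)
qed

lemma mult_add_left: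
  assumes f: "f \<in> carrier B" and g: "g \<in> carrier B" and h: "h \<in> carrier B"
  shows "(f \<oplus>\<^bsub>B\<^esub> g) \<otimes>\<^bsub>B\<^esub> h = f \<otimes>\<^bsub>B\<^esub> h \<oplus>\<^bsub>B\<^esub> g \<otimes>\<^bsub>B\<^esub> h"
proof
  fix x
  define F where "F = {x. f x \<noteq> \<zero>\<^bsub>k\<^esub>} \<union> {x. g x \<noteq> \<zero>\<^bsub>k\<^esub>}"
  define H where "H = {x. h x \<noteq> \<zero>\<^bsub>k\<^esub>}"
  have fin: "finite F" "finite H" using f g h by (auto simp: free_module_carrier_iff F_def H_def)
  have c: "f y \<in> carrier k" "g y \<in> carrier k" "h y \<in> carrier k" for y
    using f g h by (auto simp: free_module_carrier_iff)
  have fg: "f \<oplus>\<^bsub>B\<^esub> g \<in> carrier B" using f g by (rule L.M.a_closed)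
  have "((f \<oplus>\<^bsub>B\<^esub> g) \<otimes>\<^bsub>B\<^esub> h) x = (f \<otimes>\<^bsub>B\<^esub> h) x \<oplus>\<^bsub>k\<^esub> (g \<otimes>\<^bsub>B\<^esub> h) x"
    apply (subst mult_superset[OF fg h fin], (auto simp: F_def H_def)[2])
    apply (subst mult_superset[OF f h fin], (auto simp: F_def H_def)[2])
    apply (subst mult_superset[OF g h fin], (auto simp: F_def H_def)[2])
    apply (subst K.finsum_addf[symmetric], (use c in auto)[2])
    apply (rule K.finsum_cong')
    using c by (auto simp: K.l_distr)
  then show "((f \<oplus>\<^bsub>B\<^esub> g) \<otimes>\<^bsub>B\<^esub> h) x = (f \<otimes>\<^bsub>B\<^esub> h \<oplus>\<^bsub>B\<^esub> g \<otimes>\<^bsub>B\<^esub> h) x" by simp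
qed

lemma mult_add_right:
  assumes f: "f \<in> carrier B" and g: "g \<in> carrier B" and h: "h \<in> carrier B"
  shows "h \<otimes>\<^bsub>B\<^esub> (f \<oplus>\<^bsub>B\<^esub> g) = h \<otimes>\<^bsub>B\<^esub> f \<oplus>\<^bsub>B\<^esub> h \<otimes>\<^bsub>B\<^esub> g"
proof
  fix x
  define F where "F = {x. f x \<noteq> \<zero>\<^bsub>k\<^esub>} \<union> {x. g x \<noteq> \<zero>\<^bsub>k\<^esub>}"
  define H where "H = {x. h x \<noteq> \<zero>\<^bsub>k\<^esub>}"
  have fin: "finite H" "finite F" using f g h by (auto simp: free_module_carrier_iff F_def H_def)
  have c: "f y \<in> carrier k" "g y \<in> carrier k" "h y \<in> carrier k" for y
    using f g h by (auto simp: free_module_carrier_iff)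
  have fg: "f \<oplus>\<^bsub>B\<^esub> g \<in> carrier B" using f g by (rule L.M.a_closed)
  have "(h \<otimes>\<^bsub>B\<^esub> (f \<oplus>\<^bsub>B\<^esub> g)) x = (h \<otimes>\<^bsub>B\<^esub> f) x \<oplus>\<^bsub>k\<^esub> (h \<otimes>\<^bsub>B\<^esub> g) x"
    apply (subst mult_superset[OF h fg fin], (auto simp: F_def H_def)[2])
    apply (subst mult_superset[OF h f fin], (auto simp: F_def H_def)[2])
    apply (subst mult_superset[OF h g fin], (auto simp: F_def H_def)[2])
    apply (subst K.finsum_addf[symmetric], (use c in auto)[2])
    apply (rule K.finsum_cong')
    using c by (auto simp: K.r_distr)
  then show "(h \<otimes>\<^bsub>B\<^esub> (f \<oplus>\<^bsub>B\<^esub> g)) x = (h \<otimes>\<^bsub>B\<^esub> f \<oplus>\<^bsub>B\<^esub> h \<otimes>\<^bsub>B\<^esub> g) x" by simp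
qed

lemma mult_smult:
  assumes a: "a \<in> carrier k" and f: "f \<in> carrier B" and g: "g \<in> carrier B"
  shows "(a \<odot>\<^bsub>B\<^esub> f) \<otimes>\<^bsub>B\<^esub> g = a \<odot>\<^bsub>B\<^esub> (f \<otimes>\<^bsub>B\<^esub> g)"
    and "f \<otimes>\<^bsub>B\<^esub> (a \<odot>\<^bsub>B\<^esub> g) = a \<odot>\<^bsub>B\<^esub> (f \<otimes>\<^bsub>B\<^esub> g)"
proof -
  define F where "F = {x. f x \<noteq> \<zero>\<^bsub>k\<^esub>}"
  define G where "G = {x. g x \<noteq> \<zero>\<^bsub>k\<^esub>}"
  have fin: "finite F" "finite G" using f g by (auto simp: free_module_carrier_iff F_def G_def)
  have c: "f y \<in> carrier k" "g y \<in> carrier k" for y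
    using f g by (auto simp: free_module_carrier_iff)
  have af: "a \<odot>\<^bsub>B\<^esub> f \<in> carrier B" "a \<odot>\<^bsub>B\<^esub> g \<in> carrier B"
    using L.smult_closed[OF a f] L.smult_closed[OF a g] by simp_all
  have "((a \<odot>\<^bsub>B\<^esub> f) \<otimes>\<^bsub>B\<^esub> g) x = a \<otimes>\<^bsub>k\<^esub> (f \<otimes>\<^bsub>B\<^esub> g) x" for x
    apply (subst mult_superset[OF af(1) g fin], (use a in \<open>auto simp: F_def G_def\<close>)[2])
    apply (subst mult_superset[OF f g fin], (auto simp: F_def G_def)[2])
    apply (subst K.finsum_rdistr, (use fin c a in auto)[3])
    apply (rule K.finsum_cong')
    using c a by (auto simp: K.m_assoc)
  then show "(a \<odot>\<^bsub>B\<^esub> f) \<otimes>\<^bsub>B\<^esub> g = a \<odot>\<^bsub>B\<^esub> (f \<otimes>\<^bsub>B\<^esub> g)" by (simp add: fun_eq_iff)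
  \<comment> \<open>Here the scalar has to pass the coefficient of \<open>f\<close>, so
    commutativity of the field enters.\<close>
  have "(f \<otimes>\<^bsub>B\<^esub> (a \<odot>\<^bsub>B\<^esub> g)) x = a \<otimes>\<^bsub>k\<^esub> (f \<otimes>\<^bsub>B\<^esub> g) x" for x
    apply (subst mult_superset[OF f af(2) fin], (use a in \<open>auto simp: F_def G_def\<close>)[2])
    apply (subst mult_superset[OF f g fin], (auto simp: F_def G_def)[2])
    apply (subst K.finsum_rdistr, (use fin c a in auto)[3])
    apply (rule K.finsum_cong')
    using c a by (auto simp: K.m_ac)
  then show "f \<otimes>\<^bsub>B\<^esub> (a \<odot>\<^bsub>B\<^esub> g) = a \<odot>\<^bsub>B\<^esub> (f \<otimes>\<^bsub>B\<^esub> g)" by (simp add: fun_eq_iff)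
qed

lemma basis_vec_in_carrier: "x \<in> X \<Longrightarrow> basis_vec k x \<in> carrier B"
  by (simp add: basis_vec_closed K.ring_axioms)

lemma basis_vec_mult:
  assumes "x \<in> X" "y \<in> X"
  shows "basis_vec k x \<otimes>\<^bsub>B\<^esub> basis_vec k y =
    (case prd x y of None \<Rightarrow> \<zero>\<^bsub>B\<^esub> | Some z \<Rightarrow> basis_vec k z)"
proof
  fix z
  have c: "basis_vec k x \<in> carrier B" "basis_vec k y \<in> carrier B"
    using assms basis_vec_in_carrier by blast+
  show "(basis_vec k x \<otimes>\<^bsub>B\<^esub> basis_vec k y) z =
    (case prd x y of None \<Rightarrow> \<zero>\<^bsub>B\<^esub> | Some z \<Rightarrow> basis_vec k z) z"
    apply (subst mult_superset[OF c, of "{x}" "{y}"])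
    by (auto simp: basis_vec_def split: option.splits)
qed

lemma hom_mult_left: "g \<in> carrier B \<Longrightarrow> (\<lambda>f. f \<otimes>\<^bsub>B\<^esub> g) \<in> mhom k B B"
  unfolding mhom_def
  by (intro CollectI conjI allI impI funcsetI) (simp_all only: mult_closed mult_add_left mult_smult)

lemma hom_mult_right: "f \<in> carrier B \<Longrightarrow> (\<lambda>g. f \<otimes>\<^bsub>B\<^esub> g) \<in> mhom k B B"
  unfolding mhom_def
  by (intro CollectI conjI allI impI funcsetI) (simp_all only: mult_closed mult_add_right mult_smult)

lemma B_hom_eqI:
  assumes "g \<in> mhom k B B" "h \<in> mhom k B B"
    "\<And>x. x \<in> X \<Longrightarrow> g (basis_vec k x) = h (basis_vec k x)" "f \<in> carrier B"
  shows "g f = h f"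
  using F.module_hom_free_eqI[of g X h f] assms by simp

lemma mult_basis_assoc:
  assumes "x \<in> X" "y \<in> X" "z \<in> X"
  shows "(basis_vec k x \<otimes>\<^bsub>B\<^esub> basis_vec k y) \<otimes>\<^bsub>B\<^esub> basis_vec k z =
    basis_vec k x \<otimes>\<^bsub>B\<^esub> (basis_vec k y \<otimes>\<^bsub>B\<^esub> basis_vec k z)"
proof -
  have z: "\<zero>\<^bsub>B\<^esub> \<otimes>\<^bsub>B\<^esub> f = \<zero>\<^bsub>B\<^esub>" "f \<otimes>\<^bsub>B\<^esub> \<zero>\<^bsub>B\<^esub> = \<zero>\<^bsub>B\<^esub>" if "f \<in> carrier B" for f
    using module_hom_zero[OF L.M.abelian_group_axioms L.M.abelian_group_axioms hom_mult_left[OF that]]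
      module_hom_zero[OF L.M.abelian_group_axioms L.M.abelian_group_axioms hom_mult_right[OF that]]
    by simp_all
  note c = basis_vec_in_carrier
  show ?thesis
  proof (cases "prd x y")
    case None
    note xy = this
    show ?thesis
    proof (cases "prd y z")
      case None
      show ?thesis
        by (simp only: basis_vec_mult assms xy None option.case z c)
    next
      case (Some v)
      have v: "v \<in> X" "prd x v = None" using prd_closed[OF _ _ Some] prd_assoc[OF assms] xy Some assms by auto
      show ?thesis
        by (simp only: basis_vec_mult assms xy Some option.case z c v)
    qed
  next
    case (Some u)
    note xy = this
    have u: "u \<in> X" using prd_closed[OF _ _ xy] assms by simp
    show ?thesis
    proof (cases "prd y z")
      case None
      have "prd u z = None" using prd_assoc[OF assms] xy None by simp
      then show ?thesis
        by (simp only: basis_vec_mult assms xy None option.case z c u)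
    next
      case (Some v)
      have v: "v \<in> X" "prd u z = prd x v" using prd_closed[OF _ _ Some] prd_assoc[OF assms] xy Some assms by auto
      show ?thesis
        by (simp only: basis_vec_mult assms xy Some option.case z c u v)
    qed
  qed
qed

text \<open>Both sides are linear in each factor. The factors are replaced by basis elements one at
  a time: first \<open>h\<close> is generalised, then \<open>g\<close>, then
  \<open>f\<close>.\<close>

lemma mult_assoc:
  assumes f: "f \<in> carrier B" and g: "g \<in> carrier B" and h: "h \<in> carrier B"
  shows "(f \<otimes>\<^bsub>B\<^esub> g) \<otimes>\<^bsub>B\<^esub> h = f \<otimes>\<^bsub>B\<^esub> (g \<otimes>\<^bsub>B\<^esub> h)"
proof -
  note c = basis_vec_in_carrier mult_closed
  have 1: "(basis_vec k x \<otimes>\<^bsub>B\<^esub> basis_vec k y) \<otimes>\<^bsub>B\<^esub> h = basis_vec k x \<otimes>\<^bsub>B\<^esub> (basis_vec k y \<otimes>\<^bsub>B\<^esub> h)"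
    if "x \<in> X" "y \<in> X" for x y
    by (rule B_hom_eqI[OF hom_mult_right module_hom_comp[OF hom_mult_right hom_mult_right] _ h])
      (use that in \<open>simp_all only: c mult_basis_assoc\<close>)
  have 2: "(basis_vec k x \<otimes>\<^bsub>B\<^esub> g) \<otimes>\<^bsub>B\<^esub> h = basis_vec k x \<otimes>\<^bsub>B\<^esub> (g \<otimes>\<^bsub>B\<^esub> h)"
    if "x \<in> X" for x
  proof (rule B_hom_eqI[OF _ _ _ g])
    show "(\<lambda>g. (basis_vec k x \<otimes>\<^bsub>B\<^esub> g) \<otimes>\<^bsub>B\<^esub> h) \<in> mhom k B B"
      by (rule module_hom_comp[OF hom_mult_right hom_mult_left]) (use that h c in auto)
    show "(\<lambda>g. basis_vec k x \<otimes>\<^bsub>B\<^esub> (g \<otimes>\<^bsub>B\<^esub> h)) \<in> mhom k B B"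
      by (rule module_hom_comp[OF hom_mult_left hom_mult_right]) (use that h c in auto)
  qed (use 1 that in blast)
  show ?thesis
  proof (rule B_hom_eqI[OF _ _ _ f])
    show "(\<lambda>f. (f \<otimes>\<^bsub>B\<^esub> g) \<otimes>\<^bsub>B\<^esub> h) \<in> mhom k B B"
      by (rule module_hom_comp[OF hom_mult_left hom_mult_left]) (use g h in auto)
    show "(\<lambda>f. f \<otimes>\<^bsub>B\<^esub> (g \<otimes>\<^bsub>B\<^esub> h)) \<in> mhom k B B"
      by (rule hom_mult_left) (use g h mult_closed in auto)
  qed (use 2 in blast)
qed

lemma one_in_carrier: "\<one>\<^bsub>B\<^esub> \<in> carrier B"
  using E_subset finite_E by (auto simp: free_module_carrier_iff)

text \<open>In this form a linear map can be distributed over the identity.\<close>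

lemma one_eq_finsum: "\<one>\<^bsub>B\<^esub> = (\<Oplus>\<^bsub>B\<^esub>e\<in>E. basis_vec k e)"
proof -
  have "(\<Oplus>\<^bsub>B\<^esub>e\<in>F. basis_vec k e) = (\<lambda>x. if x \<in> F then \<one>\<^bsub>k\<^esub> else \<zero>\<^bsub>k\<^esub>)"
    if "finite F" "F \<subseteq> X" for F
    using that
  proof (induction F)
    case (insert e F)
    then have "basis_vec k \<in> F \<rightarrow> carrier B" "basis_vec k e \<in> carrier B"
      using basis_vec_in_carrier by auto
    then have "(\<Oplus>\<^bsub>B\<^esub>e\<in>insert e F. basis_vec k e) =
        basis_vec k e \<oplus>\<^bsub>B\<^esub> (\<lambda>x. if x \<in> F then \<one>\<^bsub>k\<^esub> else \<zero>\<^bsub>k\<^esub>)"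
      using insert L.M.finsum_insert[of F e "basis_vec k"] by auto
    then show ?case using insert.hyps by (auto simp: basis_vec_def fun_eq_iff)
  qed simp
  then show ?thesis using finite_E E_subset by simp
qed

text \<open>On a basis element exactly one summand of the identity survives, namely its local
  unit.\<close>

lemma mult_one:
  assumes f: "f \<in> carrier B"
  shows "\<one>\<^bsub>B\<^esub> \<otimes>\<^bsub>B\<^esub> f = f" "f \<otimes>\<^bsub>B\<^esub> \<one>\<^bsub>B\<^esub> = f"
proof -
  have id: "(\<lambda>f. f) \<in> mhom k B B"
    unfolding mhom_def by auto
  have eE: "basis_vec k \<in> E \<rightarrow> carrier B" using E_subset basis_vec_in_carrier by auto
  show "\<one>\<^bsub>B\<^esub> \<otimes>\<^bsub>B\<^esub> f = f"
  proof (rule B_hom_eqI[OF hom_mult_right[OF one_in_carrier] id _ f])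
    fix x assume x: "x \<in> X"
    obtain e where e: "e \<in> E" "prd e x = Some x" "\<forall>e'\<in>E - {e}. prd e' x = None"
      using unit_left[OF x] by auto
    have "\<one>\<^bsub>B\<^esub> \<otimes>\<^bsub>B\<^esub> basis_vec k x = (\<Oplus>\<^bsub>B\<^esub>e\<in>E. basis_vec k e \<otimes>\<^bsub>B\<^esub> basis_vec k x)"
      using module_hom_finsum[OF L.M.abelian_group_axioms L.M.abelian_group_axioms
          hom_mult_left[OF basis_vec_in_carrier[OF x]] eE]
      by (simp only: one_eq_finsum)
    also have "\<dots> = (\<Oplus>\<^bsub>B\<^esub>e'\<in>E. if e = e' then basis_vec k x else \<zero>\<^bsub>B\<^esub>)"
    proof (rule L.M.finsum_cong')
      fix e' assume e': "e' \<in> E"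
      show "basis_vec k e' \<otimes>\<^bsub>B\<^esub> basis_vec k x = (if e = e' then basis_vec k x else \<zero>\<^bsub>B\<^esub>)"
        using e e' E_subset x by (auto simp: basis_vec_mult subset_iff)
    qed (use x basis_vec_in_carrier L.M.zero_closed in auto)
    also have "\<dots> = basis_vec k x"
      by (rule L.M.finsum_singleton) (use e finite_E x basis_vec_in_carrier in auto)
    finally show "\<one>\<^bsub>B\<^esub> \<otimes>\<^bsub>B\<^esub> basis_vec k x = basis_vec k x" .
  qed
  show "f \<otimes>\<^bsub>B\<^esub> \<one>\<^bsub>B\<^esub> = f"
  proof (rule B_hom_eqI[OF hom_mult_left[OF one_in_carrier] id _ f])
    fix x assume x: "x \<in> X"
    obtain e where e: "e \<in> E" "prd x e = Some x" "\<forall>e'\<in>E - {e}. prd x e' = None"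
      using unit_right[OF x] by auto
    have "basis_vec k x \<otimes>\<^bsub>B\<^esub> \<one>\<^bsub>B\<^esub> = (\<Oplus>\<^bsub>B\<^esub>e\<in>E. basis_vec k x \<otimes>\<^bsub>B\<^esub> basis_vec k e)"
      using module_hom_finsum[OF L.M.abelian_group_axioms L.M.abelian_group_axioms
          hom_mult_right[OF basis_vec_in_carrier[OF x]] eE]
      by (simp only: one_eq_finsum)
    also have "\<dots> = (\<Oplus>\<^bsub>B\<^esub>e'\<in>E. if e = e' then basis_vec k x else \<zero>\<^bsub>B\<^esub>)"
    proof (rule L.M.finsum_cong')
      fix e' assume e': "e' \<in> E"
      show "basis_vec k x \<otimes>\<^bsub>B\<^esub> basis_vec k e' = (if e = e' then basis_vec k x else \<zero>\<^bsub>B\<^esub>)"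
        using e e' E_subset x by (auto simp: basis_vec_mult subset_iff)
    qed (use x basis_vec_in_carrier L.M.zero_closed in auto)
    also have "\<dots> = basis_vec k x"
      by (rule L.M.finsum_singleton) (use e finite_E x basis_vec_in_carrier in auto)
    finally show "basis_vec k x \<otimes>\<^bsub>B\<^esub> \<one>\<^bsub>B\<^esub> = basis_vec k x" .
  qed
qed

lemma basis_algebra_k_algebra: "k_algebra k B"
proof (rule k_algebra.intro)
  show "left_module k B" by (rule L.left_module_axioms)
  show "field k" by (rule K.field_axioms)
  show "ring B"
    by (intro ringI L.M.abelian_group_axioms monoidI)
      (fact mult_closed one_in_carrier mult_assoc mult_one mult_add_left mult_add_right)+
qed (fact mult_smult)+

sublocale k_algebra k B by (rule basis_algebra_k_algebra)

text \<open>The universal property of an algebra with a multiplication table; undefined products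
  have to be sent to zero. Both directions of the isomorphism are instances of it.\<close>

lemma lin_ext_ring_hom:
  assumes "k_algebra k C" and \<theta>: "\<theta> \<in> X \<rightarrow> carrier C"
    and mult: "\<And>x y. \<lbrakk>x \<in> X; y \<in> X\<rbrakk> \<Longrightarrow>
      \<theta> x \<otimes>\<^bsub>C\<^esub> \<theta> y = (case prd x y of None \<Rightarrow> \<zero>\<^bsub>C\<^esub> | Some z \<Rightarrow> \<theta> z)"
    and one: "(\<Oplus>\<^bsub>C\<^esub>e\<in>E. \<theta> e) = \<one>\<^bsub>C\<^esub>"
  shows "lin_ext k C \<theta> \<in> ring_hom B C"
proof -
  interpret C: k_algebra k C by fact
  note hom = C.L.lin_ext_hom[OF \<theta>]
  have cl: "lin_ext k C \<theta> f \<in> carrier C" if "f \<in> carrier B" for f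
    using mhom_closed[OF hom] that by auto
  have b: "lin_ext k C \<theta> (basis_vec k x) = \<theta> x" if "x \<in> X" for x
    using \<theta> that by (intro C.L.lin_ext_basis_vec) auto
  have z: "lin_ext k C \<theta> \<zero>\<^bsub>B\<^esub> = \<zero>\<^bsub>C\<^esub>"
    using module_hom_zero[OF F.M.abelian_group_axioms C.B.abelian_group_axioms hom] by simp
  have hB: "lin_ext k C \<theta> \<in> mhom k B C" using hom by simp
  have bb: "lin_ext k C \<theta> (basis_vec k x \<otimes>\<^bsub>B\<^esub> basis_vec k y) =
      lin_ext k C \<theta> (basis_vec k x) \<otimes>\<^bsub>C\<^esub> lin_ext k C \<theta> (basis_vec k y)"
    if "x \<in> X" "y \<in> X" for x y
    using that mult[OF that] prd_closed[OF that] b z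
    by (auto simp: basis_vec_mult simp del: basis_algebra_ops split: option.splits)
  have eqI: "g f = h f" if "g \<in> mhom k B C"
    "h \<in> mhom k B C" "f \<in> carrier B"
    "\<And>x. x \<in> X \<Longrightarrow> g (basis_vec k x) = h (basis_vec k x)" for g h f
    using C.L.module_hom_free_eqI[of g X h f] that by simp
  have bm: "lin_ext k C \<theta> (basis_vec k x \<otimes>\<^bsub>B\<^esub> g) =
      lin_ext k C \<theta> (basis_vec k x) \<otimes>\<^bsub>C\<^esub> lin_ext k C \<theta> g"
    if x: "x \<in> X" and g: "g \<in> carrier B" for x g
    by (rule eqI[OF module_hom_comp[OF hom_mult_right hB] module_hom_comp[OF hB C.mult_right_hom] g])
      (use x cl bb basis_vec_in_carrier in auto)
  have "lin_ext k C \<theta> (f \<otimes>\<^bsub>B\<^esub> g) = lin_ext k C \<theta> f \<otimes>\<^bsub>C\<^esub> lin_ext k C \<theta> g"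
    if f: "f \<in> carrier B" and g: "g \<in> carrier B" for f g
    by (rule eqI[OF module_hom_comp[OF hom_mult_left hB] module_hom_comp[OF hB C.mult_left_hom] f])
      (use g cl bm in auto)
  moreover have "lin_ext k C \<theta> \<one>\<^bsub>B\<^esub> = \<one>\<^bsub>C\<^esub>"
  proof -
    have e: "basis_vec k \<in> E \<rightarrow> carrier B" using E_subset basis_vec_in_carrier by auto
    have "lin_ext k C \<theta> \<one>\<^bsub>B\<^esub> = (\<Oplus>\<^bsub>C\<^esub>e\<in>E. lin_ext k C \<theta> (basis_vec k e))"
      unfolding one_eq_finsum
      by (rule module_hom_finsum[OF L.M.abelian_group_axioms C.B.abelian_group_axioms hB e])
    also have "\<dots> = (\<Oplus>\<^bsub>C\<^esub>e\<in>E. \<theta> e)"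
      using E_subset \<theta> b by (intro C.B.finsum_cong') auto
    finally show ?thesis using one by simp
  qed
  moreover have "lin_ext k C \<theta> (f \<oplus>\<^bsub>B\<^esub> g) = lin_ext k C \<theta> f \<oplus>\<^bsub>C\<^esub> lin_ext k C \<theta> g"
    if "f \<in> carrier B" "g \<in> carrier B" for f g
    using mhom_add[OF hB that] .
  ultimately show ?thesis using cl by (intro ring_hom_memI)
qed

end

section \<open>Orthogonal idempotents from a left regular family\<close>

text \<open>Each letter wraps one factor around the idempotent of the remaining letters. An
  induction over the list therefore has to treat only the outermost factor.\<close>

primrec lrb_idem :: "('r, 'c) ring_scheme \<Rightarrow> ('a \<Rightarrow> 'r) \<Rightarrow> 'a set \<Rightarrow> 'a list \<Rightarrow> 'r" where
  "lrb_idem R x X [] = \<one>\<^bsub>R\<^esub>"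
| "lrb_idem R x X (m # L) =
    (if m \<in> X then x m \<otimes>\<^bsub>R\<^esub> lrb_idem R x X L else lrb_idem R x X L \<otimes>\<^bsub>R\<^esub> (\<one>\<^bsub>R\<^esub> \<ominus>\<^bsub>R\<^esub> x m))"

definition first_in :: "'a list \<Rightarrow> 'a set \<Rightarrow> 'a" where
  "first_in L D = hd (filter (\<lambda>m. m \<in> D) L)"

lemma first_in_Cons: "first_in (m # L) D = (if m \<in> D then m else first_in L D)"
  by (simp add: first_in_def)

lemma first_in_mem: "D \<inter> set L \<noteq> {} \<Longrightarrow> first_in L D \<in> D \<inter> set L"
  by (induction L) (auto simp: first_in_Cons)

text \<open>Serves to send the idempotents built from the letters to those built from their images
  in the path algebra.\<close>

lemma ring_hom_lrb_idem:
  assumes "ring R" "ring S" "h \<in> ring_hom R S" "\<And>a. a \<in> set L \<Longrightarrow> x a \<in> carrier R"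
  shows "lrb_idem R x X L \<in> carrier R \<and> h (lrb_idem R x X L) = lrb_idem S (\<lambda>a. h (x a)) X L"
proof -
  interpret ring_hom_ring R S h
    using assms by (intro ring_hom_ringI2)
  show ?thesis using assms(4)
    by (induction L) (simp_all add: R.minus_eq S.minus_eq)
qed

locale lrb_family = ring R for R :: "('r, 'c) ring_scheme" (structure) +
  fixes x :: "'a \<Rightarrow> 'r" and A :: "'a set"
  assumes x_closed: "a \<in> A \<Longrightarrow> x a \<in> carrier R"
    and x_absorb: "\<lbrakk>a \<in> A; z \<in> carrier R\<rbrakk> \<Longrightarrow> x a \<otimes> z \<otimes> x a = x a \<otimes> z"
begin

abbreviation "co a \<equiv> \<one> \<ominus> x a"

lemma co_closed: "a \<in> A \<Longrightarrow> co a \<in> carrier R"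
  by (simp add: x_closed)

lemma mult_co: "\<lbrakk>a \<in> A; z \<in> carrier R\<rbrakk> \<Longrightarrow> z \<otimes> co a = z \<ominus> z \<otimes> x a"
  by (simp add: x_closed minus_eq r_distr r_minus)

lemma x_co: "\<lbrakk>a \<in> A; z \<in> carrier R\<rbrakk> \<Longrightarrow> x a \<otimes> z \<otimes> co a = \<zero>"
  using mult_co[of a "x a \<otimes> z"] x_absorb[of a z]
  by (simp only: x_closed m_closed) (simp add: x_closed minus_eq r_neg)

lemma co_x: "a \<in> A \<Longrightarrow> co a \<otimes> x a = \<zero>"
  using x_absorb[of a \<one>] by (simp add: minus_eq l_distr l_minus x_closed r_neg)

text \<open>The complements obey the mirror image of the left regular law, because x z (1 - x) = 0.
  This is why they stand on the right of the product F_X.\<close>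

lemma co_absorb: "\<lbrakk>a \<in> A; z \<in> carrier R\<rbrakk> \<Longrightarrow> co a \<otimes> z \<otimes> co a = z \<otimes> co a"
proof -
  assume a: "a \<in> A" "z \<in> carrier R"
  have "co a \<otimes> z \<otimes> co a = (z \<ominus> x a \<otimes> z) \<otimes> co a"
    using a by (simp add: x_closed minus_eq l_distr l_minus)
  also have "\<dots> = z \<otimes> co a \<ominus> x a \<otimes> z \<otimes> co a"
    using a x_closed co_closed by (simp add: minus_eq l_distr l_minus)
  also have "\<dots> = z \<otimes> co a"
    using a co_closed by (simp only: x_co) (simp add: minus_eq)
  finally show ?thesis .
qed

abbreviation "F \<equiv> lrb_idem R x"

lemma F_closed: "set L \<subseteq> A \<Longrightarrow> F X L \<in> carrier R"
  by (induction L) (simp_all add: x_closed)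

text \<open>The left regular law acts across arbitrary elements, so it is enough to know that a
  factor occurs somewhere in F_X; its neighbours are left unspecified as \<open>p\<close> and
  \<open>q\<close>.\<close>

lemma F_split_in:
  assumes "set L \<subseteq> A" "a \<in> set L" "a \<in> X"
  shows "\<exists>p\<in>carrier R. \<exists>q\<in>carrier R. F X L = p \<otimes> x a \<otimes> q"
  using assms
proof (induction L)
  case (Cons m L)
  show ?case
  proof (cases "m = a")
    case True
    then show ?thesis using Cons.prems
      by (intro bexI[of _ \<one>] bexI[of _ "F X L"]) (auto simp: x_closed F_closed)
  next
    case False
    then obtain p q where pq: "p \<in> carrier R" "q \<in> carrier R" "F X L = p \<otimes> x a \<otimes> q"
      using Cons by auto
    have c: "x m \<in> carrier R" "x a \<in> carrier R" "co m \<in> carrier R"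
      using Cons.prems x_closed co_closed by auto
    show ?thesis
    proof (cases "m \<in> X")
      case True
      then show ?thesis using pq c
        by (intro bexI[of _ "x m \<otimes> p"] bexI[of _ q]) (auto simp: m_assoc)
    next
      case False
      then show ?thesis using pq c
        by (intro bexI[of _ p] bexI[of _ "q \<otimes> co m"]) (auto simp: m_assoc)
    qed
  qed
qed simp

lemma F_split_notin:
  assumes "set L \<subseteq> A" "a \<in> set L" "a \<notin> X"
  shows "\<exists>p\<in>carrier R. \<exists>q\<in>carrier R. F X L = p \<otimes> co a \<otimes> q"
  using assms
proof (induction L)
  case (Cons m L)
  show ?case
  proof (cases "m = a")
    case True
    then show ?thesis using Cons.prems
      by (intro bexI[of _ "F X L"] bexI[of _ \<one>]) (auto simp: x_closed F_closed)
  next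
    case False
    then obtain p q where pq: "p \<in> carrier R" "q \<in> carrier R" "F X L = p \<otimes> co a \<otimes> q"
      using Cons by auto
    have c: "x m \<in> carrier R" "co a \<in> carrier R" "co m \<in> carrier R"
      using Cons.prems x_closed co_closed by auto
    show ?thesis
    proof (cases "m \<in> X")
      case True
      then show ?thesis using pq c
        by (intro bexI[of _ "x m \<otimes> p"] bexI[of _ q]) (auto simp: m_assoc)
    next
      case False
      then show ?thesis using pq c
        by (intro bexI[of _ p] bexI[of _ "q \<otimes> co m"]) (auto simp: m_assoc)
    qed
  qed
qed simp

lemma F_mult_x:
  assumes "set L \<subseteq> A" "a \<in> set L" "a \<in> X" "z \<in> carrier R"
  shows "F X L \<otimes> z \<otimes> x a = F X L \<otimes> z"
proof -
  obtain p q where pq: "p \<in> carrier R" "q \<in> carrier R" "F X L = p \<otimes> x a \<otimes> q"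
    using F_split_in[OF assms(1-3)] by auto
  have a: "a \<in> A" "x a \<in> carrier R" using assms x_closed by auto
  have "F X L \<otimes> z \<otimes> x a = p \<otimes> (x a \<otimes> (q \<otimes> z) \<otimes> x a)"
    using pq a assms(4) by (simp add: m_assoc)
  also have "\<dots> = F X L \<otimes> z" using pq a assms(4) by (subst x_absorb) (simp_all add: m_assoc)
  finally show ?thesis .
qed

lemma x_mult_F:
  assumes "set L \<subseteq> A" "a \<in> set L" "a \<notin> X" "z \<in> carrier R"
  shows "x a \<otimes> z \<otimes> F X L = \<zero>"
proof -
  obtain p q where pq: "p \<in> carrier R" "q \<in> carrier R" "F X L = p \<otimes> co a \<otimes> q"
    using F_split_notin[OF assms(1-3)] by auto
  have a: "a \<in> A" "x a \<in> carrier R" "co a \<in> carrier R" using assms x_closed co_closed by auto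
  have "x a \<otimes> z \<otimes> F X L = (x a \<otimes> (z \<otimes> p) \<otimes> co a) \<otimes> q"
    using pq a assms(4) by (simp add: m_assoc)
  also have "\<dots> = \<zero>" using pq a assms(4) by (subst x_co) simp_all
  finally show ?thesis .
qed

text \<open>The factor \<open>x b\<close> of F_Y meets the factor 1 - \<open>x b\<close> of F_X
  further right, and such a product vanishes whatever stands between them.\<close>

lemma F_F_not_subset:
  assumes "set L \<subseteq> A" "b \<in> set L" "b \<in> Y" "b \<notin> X" "z \<in> carrier R"
  shows "F Y L \<otimes> z \<otimes> F X L = \<zero>"
proof -
  obtain p q where pq: "p \<in> carrier R" "q \<in> carrier R" "F Y L = p \<otimes> x b \<otimes> q"
    using F_split_in[OF assms(1-3)] by auto
  have a: "b \<in> A" "x b \<in> carrier R" "F X L \<in> carrier R" using assms x_closed F_closed by auto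
  have "F Y L \<otimes> z \<otimes> F X L = p \<otimes> (x b \<otimes> (q \<otimes> z) \<otimes> F X L)"
    using pq a assms(5) by (simp add: m_assoc)
  also have "\<dots> = \<zero>" using pq a assms by (subst x_mult_F) simp_all
  finally show ?thesis .
qed

text \<open>The choice z = 1 gives orthogonality, and the leader gives the label that has no arrow.
  At the leader d the factor 1 - \<open>x d\<close> is the last one of F_Y and \<open>x d\<close>
  the first one of F_X, so they enclose \<open>z\<close> and the product is zero. A letter before d
  lies in both sets or in neither, and one of its two outer factors is absorbed by the
  other.\<close>

lemma F_F_subset:
  assumes "set L \<subseteq> A" "Y \<subseteq> X" "(X - Y) \<inter> set L \<noteq> {}" "z = \<one> \<or> z = x (first_in L (X - Y))"
  shows "F Y L \<otimes> z \<otimes> F X L = \<zero>"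
  using assms
proof (induction L)
  case (Cons m L)
  define d where "d = first_in (m # L) (X - Y)"
  have d: "d \<in> A" using first_in_mem[OF Cons.prems(3)] Cons.prems(1) by (auto simp: d_def)
  have z: "z \<in> carrier R" using Cons.prems(4) d x_closed by (auto simp: d_def)
  have m: "m \<in> A" and L: "set L \<subseteq> A" using Cons.prems(1) by auto
  have c: "x m \<in> carrier R" "co m \<in> carrier R" "F X L \<in> carrier R" "F Y L \<in> carrier R"
    using m L x_closed co_closed F_closed by auto
  show ?case
  proof (cases "m \<in> X - Y")
    case True
    then have "d = m" by (simp add: d_def first_in_Cons)
    then have "co m \<otimes> z \<otimes> x m = \<zero>"
      using Cons.prems(4) c m co_x x_absorb[of m \<one>]
      by (auto simp: d_def)
    moreover have "F Y (m # L) \<otimes> z \<otimes> F X (m # L) = F Y L \<otimes> (co m \<otimes> z \<otimes> x m) \<otimes> F X L"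
      using True c z by (simp add: m_assoc)
    ultimately show ?thesis using c by simp
  next
    case False
    \<comment> \<open>The letter \<open>m\<close> is outside X - Y, so the leader is the same for
      the shorter list and the same \<open>z\<close> may be kept.\<close>
    then have IH: "F Y L \<otimes> z \<otimes> F X L = \<zero>"
      using Cons.IH[OF L Cons.prems(2)] Cons.prems(3,4) by (auto simp: first_in_Cons)
    show ?thesis
    proof (cases "m \<in> Y")
      case True
      then have "m \<in> X" using Cons.prems(2) by auto
      with True have "F Y (m # L) \<otimes> z \<otimes> F X (m # L) = x m \<otimes> (F Y L \<otimes> z) \<otimes> x m \<otimes> F X L"
        using c z by (simp add: m_assoc)
      also have "\<dots> = x m \<otimes> (F Y L \<otimes> z \<otimes> F X L)"
        using c z m by (simp add: x_absorb) (simp add: m_assoc)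
      finally show ?thesis using IH c by simp
    next
      case mY: False
      then have "m \<notin> X" using False by auto
      with mY have "F Y (m # L) \<otimes> z \<otimes> F X (m # L) = F Y L \<otimes> (co m \<otimes> (z \<otimes> F X L) \<otimes> co m)"
        using c z by (simp add: m_assoc)
      also have "\<dots> = (F Y L \<otimes> z \<otimes> F X L) \<otimes> co m"
        using c z m by (subst co_absorb) (simp_all add: m_assoc)
      finally show ?thesis using IH c by simp
    qed
  qed
qed simp

lemma F_orthogonal:
  assumes "set L \<subseteq> A" "X \<subseteq> set L" "Y \<subseteq> set L" "X \<noteq> Y"
  shows "F Y L \<otimes> F X L = \<zero>"
proof (cases "Y \<subseteq> X")
  case True
  then show ?thesis using F_F_subset[OF assms(1) True, of \<one>] assms F_closed by auto
next
  case False
  then obtain b where "b \<in> Y" "b \<notin> X" by auto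
  then show ?thesis using F_F_not_subset[OF assms(1), of b Y X \<one>] assms F_closed by auto
qed

text \<open>Subsets without the first letter m contribute (sum) (1 - x_m), those with m contribute
  x_m (sum); by induction both sums are 1.\<close>

lemma F_sum:
  assumes "set L \<subseteq> A" "distinct L"
  shows "(\<Oplus>X\<in>Pow (set L). F X L) = \<one>"
  using assms
proof (induction L)
  case (Cons m L)
  have c: "x m \<in> carrier R" "co m \<in> carrier R" "\<And>X. F X L \<in> carrier R"
    using Cons.prems x_closed co_closed F_closed by auto
  \<comment> \<open>The idempotent depends on \<open>X\<close> only through the letters of the
    list.\<close>
  have F_cong: "F (insert m X) L = F X L" if "m \<notin> set L" for X
    using that by (induction L) auto
  have inj: "inj_on (insert m) (Pow (set L))"
    using Cons.prems by (auto simp: inj_on_def)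
  have "Pow (set (m # L)) = Pow (set L) \<union> insert m ` Pow (set L)" by (simp add: Pow_insert)
  then have "(\<Oplus>X\<in>Pow (set (m # L)). F X (m # L)) =
      (\<Oplus>X\<in>Pow (set L). F X (m # L)) \<oplus> (\<Oplus>X\<in>insert m ` Pow (set L). F X (m # L))"
    using Cons.prems c by (simp only:, intro finsum_Un_disjoint) auto
  also have "(\<Oplus>X\<in>Pow (set L). F X (m # L)) = (\<Oplus>X\<in>Pow (set L). F X L \<otimes> co m)"
    using Cons.prems c by (intro finsum_cong') auto
  also have "\<dots> = co m"
    using finsum_ldistr[of "Pow (set L)" "co m" "\<lambda>X. F X L"] Cons c by simp
  also have "(\<Oplus>X\<in>insert m ` Pow (set L). F X (m # L)) = (\<Oplus>X\<in>Pow (set L). F (insert m X) (m # L))"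
    using inj c by (intro finsum_reindex) auto
  also have "\<dots> = (\<Oplus>X\<in>Pow (set L). x m \<otimes> F X L)"
    using Cons.prems c F_cong by (intro finsum_cong') auto
  also have "\<dots> = x m"
    using finsum_rdistr[of "Pow (set L)" "x m" "\<lambda>X. F X L"] Cons c by simp
  finally show ?case using c by (simp add: minus_eq a_assoc l_neg)
qed simp

text \<open>Multiplying the sum of all idempotents by F_X leaves only F_X F_X, by
  orthogonality.\<close>

lemma F_idem:
  assumes "set L \<subseteq> A" "distinct L" "X \<subseteq> set L"
  shows "F X L \<otimes> F X L = F X L"
proof -
  have c: "F Y L \<in> carrier R" for Y using assms F_closed by auto
  have "F X L = F X L \<otimes> (\<Oplus>Y\<in>Pow (set L). F Y L)"
    using F_sum[OF assms(1,2)] c by simp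
  also have "\<dots> = (\<Oplus>Y\<in>Pow (set L). F X L \<otimes> F Y L)"
    using c by (intro finsum_rdistr) auto
  also have "\<dots> = (\<Oplus>Y\<in>Pow (set L). if X = Y then F X L \<otimes> F X L else \<zero>)"
    using c assms F_orthogonal by (intro finsum_cong') auto
  also have "\<dots> = F X L \<otimes> F X L"
    using assms c by (intro finsum_singleton) auto
  finally show ?thesis by simp
qed

end

section \<open>The monoid algebra of the free left regular band\<close>

lemma set_keep_first [simp]: "set (keep_first xs) = set xs"
  by (induction xs) auto

lemma distinct_keep_first [simp]: "distinct (keep_first xs)"
  by (induction xs) auto

lemma keep_first_distinct: "distinct xs \<Longrightarrow> keep_first xs = xs"
proof (induction xs)
  case (Cons x xs)
  then have "filter (\<lambda>y. y \<noteq> x) xs = xs" by (intro filter_True) auto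
  with Cons show ?case by simp
qed simp

text \<open>The normal form to which both bracketings of a triple product are reduced, after merging
  filters.\<close>

lemma keep_first_append:
  "keep_first (xs @ ys) = keep_first xs @ filter (\<lambda>y. y \<notin> set xs) (keep_first ys)"
  by (induction xs) (auto intro: filter_cong)

lemma keep_first_idem: "keep_first (keep_first xs) = keep_first xs"
  by (simp add: keep_first_distinct)

lemma keep_first_filter: "keep_first (filter P xs) = filter P (keep_first xs)"
proof (induction xs)
  case (Cons x xs)
  have "filter P (filter (\<lambda>y. y \<noteq> x) (keep_first xs)) = filter P (keep_first xs)" if "\<not> P x"
    using that by (auto intro!: filter_cong)
  with Cons show ?case by (simp add: filter_filter conj_commute)
qed simp

lemma keep_first_append_assoc:
  "keep_first (keep_first (xs @ ys) @ zs) = keep_first (xs @ keep_first (ys @ zs))"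
  by (simp add: keep_first_append keep_first_idem keep_first_filter filter_filter conj_commute)
    (auto intro: filter_cong)

lemma free_lrb_simps [simp]:
  "carrier (free_lrb A) = {xs. distinct xs \<and> set xs \<subseteq> A}"
  "xs \<otimes>\<^bsub>free_lrb A\<^esub> ys = keep_first (xs @ ys)"
  "\<one>\<^bsub>free_lrb A\<^esub> = []"
  by (simp_all add: free_lrb_def)

lemma monoid_algebra_free_lrb_basis_mult:
  assumes "field k"
  shows "basis_mult k (carrier (free_lrb A)) (\<lambda>s t. Some (s \<otimes>\<^bsub>free_lrb A\<^esub> t)) {\<one>\<^bsub>free_lrb A\<^esub>}"
  by (intro basis_mult.intro assms basis_mult_axioms.intro)
    (auto simp: keep_first_append_assoc keep_first_distinct)

section \<open>Products of letters in a ring\<close>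

definition list_prod :: "('r, 'c) ring_scheme \<Rightarrow> ('a \<Rightarrow> 'r) \<Rightarrow> 'a list \<Rightarrow> 'r" where
  "list_prod R x w = foldr (\<lambda>a z. x a \<otimes>\<^bsub>R\<^esub> z) w \<one>\<^bsub>R\<^esub>"

lemma list_prod_simps [simp]:
  "list_prod R x [] = \<one>\<^bsub>R\<^esub>"
  "list_prod R x (a # w) = x a \<otimes>\<^bsub>R\<^esub> list_prod R x w"
  by (simp_all add: list_prod_def)

lemma (in ring) list_prod_closed:
  "(\<And>a. a \<in> set w \<Longrightarrow> x a \<in> carrier R) \<Longrightarrow> list_prod R x w \<in> carrier R"
  by (induction w) auto

lemma (in ring) list_prod_append:
  "(\<And>a. a \<in> set v \<union> set w \<Longrightarrow> x a \<in> carrier R) \<Longrightarrow>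
    list_prod R x (v @ w) = list_prod R x v \<otimes> list_prod R x w"
  by (induction v) (auto simp: list_prod_closed m_assoc)

lemma ring_hom_list_prod:
  assumes "ring R" "ring S" "h \<in> ring_hom R S" "\<And>a. a \<in> set w \<Longrightarrow> x a \<in> carrier R"
  shows "h (list_prod R x w) = list_prod S (\<lambda>a. h (x a)) w"
proof -
  interpret ring_hom_ring R S h using assms by (intro ring_hom_ringI2)
  show ?thesis using assms(4) by (induction w) (auto simp: R.list_prod_closed)
qed

text \<open>The left regular law deletes each letter that has already occurred. Hence the product
  over a word is multiplicative for the product of the band.\<close>

lemma (in lrb_family) list_prod_keep_first:
  assumes "set w \<subseteq> A"
  shows "list_prod R x (keep_first w) = list_prod R x w"
  using assms
proof (induction w)
  case (Cons a w)
  have c: "set u \<subseteq> A \<Longrightarrow> list_prod R x u \<in> carrier R" for u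
    by (intro list_prod_closed x_closed) auto
  \<comment> \<open>The element \<open>z\<close> collects the letters between the first occurrence
    of \<open>a\<close> and the one to be deleted; the induction lets it grow.\<close>
  have del: "x a \<otimes> z \<otimes> list_prod R x (filter (\<lambda>y. y \<noteq> a) u) = x a \<otimes> z \<otimes> list_prod R x u"
    if "set u \<subseteq> A" "z \<in> carrier R" for u z
    using that
  proof (induction u arbitrary: z)
    case (Cons b u)
    have a: "a \<in> A" "x a \<in> carrier R" "b \<in> A" "x b \<in> carrier R"
      using \<open>set (a # w) \<subseteq> A\<close> Cons.prems x_closed by auto
    have u: "list_prod R x u \<in> carrier R" "list_prod R x (filter (\<lambda>y. y \<noteq> a) u) \<in> carrier R"
      using Cons.prems by (auto intro!: c)
    show ?case
    proof (cases "b = a")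
      case True
      have "x a \<otimes> z \<otimes> list_prod R x (b # u) = (x a \<otimes> z \<otimes> x a) \<otimes> list_prod R x u"
        using True a u Cons.prems by (simp add: m_assoc)
      also have "\<dots> = x a \<otimes> z \<otimes> list_prod R x u"
        using a Cons.prems by (simp only: x_absorb)
      finally show ?thesis using True Cons by simp
    next
      case False
      then show ?thesis
        using Cons.IH[of "z \<otimes> x b"] a u Cons.prems by (simp add: m_assoc)
    qed
  qed simp
  have f: "set (filter (\<lambda>y. y \<noteq> a) (keep_first w)) \<subseteq> A" using Cons.prems by auto
  have "list_prod R x (keep_first (a # w)) = x a \<otimes> \<one> \<otimes> list_prod R x (filter (\<lambda>y. y \<noteq> a) (keep_first w))"
    using Cons.prems x_closed by simp
  also have "\<dots> = x a \<otimes> \<one> \<otimes> list_prod R x (keep_first w)"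
    using Cons.prems by (intro del) auto
  also have "\<dots> = list_prod R x (a # w)"
    using Cons x_closed by simp
  finally show ?case .
qed simp

locale free_lrb_algebra = K: field k for k :: "('k, 'c) ring_scheme" +
  fixes A :: "'a set"
begin

abbreviation "S \<equiv> free_lrb A"
abbreviation "kS \<equiv> monoid_algebra k S"

sublocale SB: basis_mult k "carrier S" "\<lambda>s t. Some (s \<otimes>\<^bsub>S\<^esub> t)" "{\<one>\<^bsub>S\<^esub>}"
  rewrites "basis_algebra k (carrier S) (\<lambda>s t. Some (s \<otimes>\<^bsub>S\<^esub> t)) {\<one>\<^bsub>S\<^esub>} = kS"
  by (rule monoid_algebra_free_lrb_basis_mult[OF K.field_axioms]) (simp only: monoid_algebra_def)

lemma kS_carrier: "carrier kS = carrier (free_module k (carrier S))"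
  by (simp add: monoid_algebra_def)

abbreviation "lt w \<equiv> basis_vec k w"

lemma word_closed: "w \<in> carrier S \<Longrightarrow> lt w \<in> carrier kS"
  by (rule SB.basis_vec_in_carrier)

lemma word_mult: "\<lbrakk>v \<in> carrier S; w \<in> carrier S\<rbrakk> \<Longrightarrow> lt v \<otimes>\<^bsub>kS\<^esub> lt w = lt (keep_first (v @ w))"
  using SB.basis_vec_mult[of v w] by simp

lemma word_one: "\<one>\<^bsub>kS\<^esub> = lt []"
  by (auto simp: monoid_algebra_def basis_vec_def)

text \<open>By linearity \<open>z\<close> may be taken to be a word; then the second
  \<open>a\<close> is a repetition and is deleted.\<close>

sublocale fam: lrb_family kS "\<lambda>a. lt [a]" A
proof (intro lrb_family.intro lrb_family_axioms.intro SB.B.ring_axioms)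
  fix a assume a: "a \<in> A"
  show c: "lt [a] \<in> carrier kS" using a by (intro word_closed) simp
  fix z assume z: "z \<in> carrier kS"
  show "lt [a] \<otimes>\<^bsub>kS\<^esub> z \<otimes>\<^bsub>kS\<^esub> lt [a] = lt [a] \<otimes>\<^bsub>kS\<^esub> z"
  proof (rule SB.B_hom_eqI[OF _ _ _ z])
    show "(\<lambda>z. lt [a] \<otimes>\<^bsub>kS\<^esub> z \<otimes>\<^bsub>kS\<^esub> lt [a]) \<in> mhom k kS kS"
      by (rule module_hom_comp[OF SB.hom_mult_right[OF c] SB.hom_mult_left[OF c]])
    show "(\<lambda>z. lt [a] \<otimes>\<^bsub>kS\<^esub> z) \<in> mhom k kS kS"
      by (rule SB.hom_mult_right[OF c])
    fix w assume w: "w \<in> carrier S"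
    have 1: "keep_first ([a] @ w) \<in> carrier S" using w a by auto
    have 2: "keep_first (keep_first ([a] @ w) @ [a]) = keep_first ([a] @ w)"
      by (subst keep_first_append) (simp add: keep_first_idem keep_first_distinct)
    show "lt [a] \<otimes>\<^bsub>kS\<^esub> lt w \<otimes>\<^bsub>kS\<^esub> lt [a] = lt [a] \<otimes>\<^bsub>kS\<^esub> lt w"
      using w a 1 2 by (simp add: word_mult del: append.simps keep_first.simps)
  qed
qed

lemma word_eq_list_prod: "w \<in> carrier S \<Longrightarrow> list_prod kS (\<lambda>a. lt [a]) w = lt w"
proof (induction w)
  case (Cons a w)
  then have "lt [a] \<otimes>\<^bsub>kS\<^esub> lt w = lt (keep_first ([a] @ w))" by (intro word_mult) auto
  also have "keep_first ([a] @ w) = a # w" using Cons.prems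
    by (subst keep_first_distinct) auto
  finally show ?case using Cons by simp
qed (simp add: word_one)

end

section \<open>The isomorphism with the path algebra of the subset quiver\<close>

text \<open>The quiver is kept abstract, known only through the subset attached to each vertex and
  the label attached to each arrow. This separates the isomorphism from the computation of Ext^1,
  whose outcome is needed only to instantiate the locale.\<close>

locale lrb_quiver = free_lrb_algebra k "set L" for k :: "('k, 'c) ring_scheme" and L :: "'a list" +
  fixes Q :: "('v, 'e) pre_digraph" and \<sigma> :: "'v \<Rightarrow> 'a set" and lab :: "'e \<Rightarrow> 'a"
  assumes distinct_L: "distinct L"
    and \<sigma>_bij: "bij_betw \<sigma> (verts Q) (Pow (set L))"
    and wf: "wf_digraph Q"
    and arcs_bij: "bij_betw (\<lambda>e. (\<sigma> (tail Q e), \<sigma> (head Q e), lab e)) (arcs Q)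
      {(Y, X, a). Y \<subseteq> X \<and> X \<subseteq> set L \<and> a \<in> X - Y \<and> a \<noteq> first_in L (X - Y)}"
begin

sublocale wf_digraph Q by (rule wf)

abbreviation "kQ \<equiv> path_algebra k Q"

lemma \<sigma>_subset: "v \<in> verts Q \<Longrightarrow> \<sigma> v \<subseteq> set L"
  using \<sigma>_bij by (auto simp: bij_betw_def)

lemma \<sigma>_eq_iff: "\<lbrakk>u \<in> verts Q; v \<in> verts Q\<rbrakk> \<Longrightarrow> \<sigma> u = \<sigma> v \<longleftrightarrow> u = v"
  using \<sigma>_bij by (auto simp: bij_betw_def inj_on_def)

lemma \<sigma>_surj: "X \<subseteq> set L \<Longrightarrow> \<exists>v\<in>verts Q. \<sigma> v = X"
  using \<sigma>_bij unfolding bij_betw_def by (metis PowI image_iff)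

lemma finite_verts: "finite (verts Q)"
  using \<sigma>_bij bij_betw_finite by fastforce

lemma finite_arcs: "finite (arcs Q)"
proof -
  have "{(Y, X, a). Y \<subseteq> X \<and> X \<subseteq> set L \<and> a \<in> X - Y \<and> a \<noteq> first_in L (X - Y)} \<subseteq>
      Pow (set L) \<times> Pow (set L) \<times> set L" by auto
  then show ?thesis
    using bij_betw_finite[OF arcs_bij] by (auto elim: finite_subset)
qed

lemma arc_props:
  assumes "e \<in> arcs Q"
  shows "\<sigma> (tail Q e) \<subseteq> \<sigma> (head Q e)" "lab e \<in> \<sigma> (head Q e)" "lab e \<notin> \<sigma> (tail Q e)"
    "lab e \<noteq> first_in L (\<sigma> (head Q e) - \<sigma> (tail Q e))"
  using assms arcs_bij unfolding bij_betw_def by (blast dest: equalityD1)+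

lemma arc_eqI:
  assumes "e \<in> arcs Q" "e' \<in> arcs Q" "tail Q e = tail Q e'" "head Q e = head Q e'" "lab e = lab e'"
  shows "e = e'"
  using assms arcs_bij unfolding bij_betw_def inj_on_def by auto

lemma arc_exists:
  assumes "Y \<subseteq> X" "X \<subseteq> set L" "a \<in> X - Y" "a \<noteq> first_in L (X - Y)"
  shows "\<exists>e\<in>arcs Q. \<sigma> (tail Q e) = Y \<and> \<sigma> (head Q e) = X \<and> lab e = a"
proof -
  have "(Y, X, a) \<in> (\<lambda>e. (\<sigma> (tail Q e), \<sigma> (head Q e), lab e)) ` arcs Q"
    using arcs_bij assms by (simp add: bij_betw_def)
  then show ?thesis by auto
qed

lemma awalk_\<sigma>_mono: "awalk u p v \<Longrightarrow> \<sigma> u \<subseteq> \<sigma> v"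
  by (induction p arbitrary: u) (auto simp: awalk_simps dest: arc_props(1))

lemma quiver_paths_basis_mult:
  "basis_mult k (quiver_paths Q) path_concat {(v, [], v) | v. v \<in> verts Q}"
proof (intro basis_mult.intro basis_mult_axioms.intro K.field_axioms)
  show "{(v, [], v) | v. v \<in> verts Q} \<subseteq> quiver_paths Q"
    by (auto simp: quiver_paths_def awalk_simps)
  show "finite {(v, [], v) | v. v \<in> verts Q}" using finite_verts by simp
next
  fix x y z assume "x \<in> quiver_paths Q" "y \<in> quiver_paths Q" "path_concat x y = Some z"
  then show "z \<in> quiver_paths Q"
    by (cases x; cases y) (auto simp: quiver_paths_def split: if_splits)
next
  fix x y z assume "x \<in> quiver_paths Q" "y \<in> quiver_paths Q" "z \<in> quiver_paths Q"
  then show "Option.bind (path_concat x y) (\<lambda>u. path_concat u z) =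
      Option.bind (path_concat y z) (path_concat x)"
    by (cases x; cases y; cases z) auto
next
  fix x assume x: "x \<in> quiver_paths Q"
  obtain u p v where xp: "x = (u, p, v)" by (cases x)
  with x have "u \<in> verts Q" "v \<in> verts Q"
    by (auto simp: quiver_paths_def dest: awalk_hd_in_verts awalk_last_in_verts)
  then show "\<exists>e\<in>{(v, [], v) | v. v \<in> verts Q}. path_concat e x = Some x \<and>
      (\<forall>e'\<in>{(v, [], v) | v. v \<in> verts Q} - {e}. path_concat e' x = None)"
    and "\<exists>e\<in>{(v, [], v) | v. v \<in> verts Q}. path_concat x e = Some x \<and>
      (\<forall>e'\<in>{(v, [], v) | v. v \<in> verts Q} - {e}. path_concat x e' = None)"
    using xp by (auto split: if_splits)
qed

sublocale PB: basis_mult k "quiver_paths Q" path_concat "{(v, [], v) | v. v \<in> verts Q}"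
  rewrites "basis_algebra k (quiver_paths Q) path_concat {(v, [], v) | v. v \<in> verts Q} = kQ"
  by (rule quiver_paths_basis_mult) (simp only: path_algebra_def)

section \<open>The images of the letters in the path algebra\<close>

abbreviation "pv p \<equiv> basis_vec k p"
abbreviation "vtx v \<equiv> pv (v, [], v)"
abbreviation "arr e \<equiv> pv (tail Q e, [e], head Q e)"

lemma vtx_path: "v \<in> verts Q \<Longrightarrow> (v, [], v) \<in> quiver_paths Q"
  by (simp add: quiver_paths_def awalk_simps)

lemma arc_path: "e \<in> arcs Q \<Longrightarrow> (tail Q e, [e], head Q e) \<in> quiver_paths Q"
  by (simp add: quiver_paths_def arc_implies_awalk)

lemmas pv_closed = PB.basis_vec_in_carrier
lemmas vtx_closed = pv_closed[OF vtx_path]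
lemmas arr_closed = pv_closed[OF arc_path]

lemma pv_mult:
  assumes "(u, p, v) \<in> quiver_paths Q" "(v', q, w) \<in> quiver_paths Q"
  shows "pv (u, p, v) \<otimes>\<^bsub>kQ\<^esub> pv (v', q, w) = (if v = v' then pv (u, p @ q, w) else \<zero>\<^bsub>kQ\<^esub>)"
  using PB.basis_vec_mult[OF assms] by simp

definition label_paths :: "'a \<Rightarrow> ('v \<times> 'e list \<times> 'v) set" where
  "label_paths a = {(v, [], v) | v. v \<in> verts Q \<and> a \<in> \<sigma> v} \<union>
    {(tail Q e, [e], head Q e) | e. e \<in> arcs Q \<and> lab e = a}"

definition eps :: "'a \<Rightarrow> 'v \<times> 'e list \<times> 'v \<Rightarrow> 'k" where
  "eps a = (\<Oplus>\<^bsub>kQ\<^esub>q\<in>label_paths a. pv q)"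

lemma finite_label_paths: "finite (label_paths a)"
  using finite_verts finite_arcs by (simp add: label_paths_def)

lemma label_paths_subset: "label_paths a \<subseteq> quiver_paths Q"
  using vtx_path arc_path by (auto simp: label_paths_def)

lemma label_paths_target: "(u, p, v) \<in> label_paths a \<Longrightarrow> v \<in> verts Q \<and> a \<in> \<sigma> v"
  by (auto simp: label_paths_def dest: arc_props(2))

lemma pv_label_closed: "pv \<in> label_paths a \<rightarrow> carrier kQ"
  using label_paths_subset pv_closed by blast

lemma eps_closed: "eps a \<in> carrier kQ"
  unfolding eps_def by (rule PB.L.M.finsum_closed[OF pv_label_closed])

lemma hom_eps:
  assumes "h \<in> mhom k kQ kQ"
  shows "h (eps a) = (\<Oplus>\<^bsub>kQ\<^esub>q\<in>label_paths a. h (pv q))"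
  unfolding eps_def
  by (rule module_hom_finsum[OF PB.L.M.abelian_group_axioms PB.L.M.abelian_group_axioms assms pv_label_closed])

lemma sandwich_hom:
  assumes "y \<in> carrier kQ" "z \<in> carrier kQ"
  shows "(\<lambda>x. y \<otimes>\<^bsub>kQ\<^esub> x \<otimes>\<^bsub>kQ\<^esub> z) \<in> mhom k kQ kQ"
  by (rule module_hom_comp[OF PB.mult_right_hom[OF assms(1)] PB.mult_left_hom[OF assms(2)]])

lemma sum_one_term:
  assumes "q0 \<in> P" "finite P" "r \<in> carrier kQ" "g q0 = r" "\<And>q. \<lbrakk>q \<in> P; q \<noteq> q0\<rbrakk> \<Longrightarrow> g q = \<zero>\<^bsub>kQ\<^esub>"
  shows "(\<Oplus>\<^bsub>kQ\<^esub>q\<in>P. g q) = r"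
proof -
  have "(\<Oplus>\<^bsub>kQ\<^esub>q\<in>P. g q) = (\<Oplus>\<^bsub>kQ\<^esub>q\<in>P. if q0 = q then r else \<zero>\<^bsub>kQ\<^esub>)"
    using assms by (intro PB.L.M.finsum_cong') auto
  also have "\<dots> = r" using assms by (intro PB.L.M.finsum_singleton) auto
  finally show ?thesis .
qed

text \<open>Subsets grow along paths, so \<open>a\<close> also lies in the subset of the target
  \<open>v\<close>. Hence the vertex \<open>v\<close> is a summand of \<open>eps a\<close>, while no
  arrow labelled \<open>a\<close> starts at \<open>v\<close>, as a label is never in the subset of
  its tail.\<close>

lemma pv_eps:
  assumes p: "(u, p, v) \<in> quiver_paths Q" and a: "a \<in> \<sigma> u"
  shows "pv (u, p, v) \<otimes>\<^bsub>kQ\<^esub> eps a = pv (u, p, v)"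
proof -
  have v: "v \<in> verts Q" "a \<in> \<sigma> v"
    using p a awalk_\<sigma>_mono[of u p v] by (auto simp: quiver_paths_def dest: awalk_last_in_verts)
  have "pv (u, p, v) \<otimes>\<^bsub>kQ\<^esub> eps a = (\<Oplus>\<^bsub>kQ\<^esub>q\<in>label_paths a. pv (u, p, v) \<otimes>\<^bsub>kQ\<^esub> pv q)"
    by (rule hom_eps[OF PB.mult_right_hom[OF pv_closed[OF p]]])
  also have "\<dots> = pv (u, p, v)"
  proof (rule sum_one_term[of "(v, [], v)"])
    show "(v, [], v) \<in> label_paths a" using v by (simp add: label_paths_def)
    show "pv (u, p, v) \<otimes>\<^bsub>kQ\<^esub> vtx v = pv (u, p, v)"
      using pv_mult[OF p vtx_path[OF v(1)]] by simp
    fix q assume q: "q \<in> label_paths a" "q \<noteq> (v, [], v)"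
    obtain u' p' v' where q': "q = (u', p', v')" by (cases q)
    have "v \<noteq> u'" using q q' v arc_props(3) by (auto simp: label_paths_def)
    then show "pv (u, p, v) \<otimes>\<^bsub>kQ\<^esub> pv q = \<zero>\<^bsub>kQ\<^esub>"
      using pv_mult[OF p, of u' p' v'] q q' label_paths_subset by auto
  qed (use p pv_closed finite_label_paths in auto)
  finally show ?thesis .
qed

text \<open>Stronger than the left regular law: a single vertex containing \<open>a\<close>, not the
  whole of \<open>eps a\<close>, already absorbs \<open>eps a\<close> across any element.\<close>

lemma vtx_absorb:
  assumes u: "u \<in> verts Q" and a: "a \<in> \<sigma> u" and z: "z \<in> carrier kQ"
  shows "vtx u \<otimes>\<^bsub>kQ\<^esub> z \<otimes>\<^bsub>kQ\<^esub> eps a = vtx u \<otimes>\<^bsub>kQ\<^esub> z"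
proof (rule PB.B_hom_eqI[OF sandwich_hom[OF vtx_closed[OF u] eps_closed]
      PB.mult_right_hom[OF vtx_closed[OF u]] _ z])
  fix p assume p: "p \<in> quiver_paths Q"
  obtain u' p' v' where p': "p = (u', p', v')" by (cases p)
  show "vtx u \<otimes>\<^bsub>kQ\<^esub> pv p \<otimes>\<^bsub>kQ\<^esub> eps a = vtx u \<otimes>\<^bsub>kQ\<^esub> pv p"
    using pv_mult[OF vtx_path[OF u], of u' p' v'] p p' pv_eps[of u p' v' a] a eps_closed
    by (cases "u = u'") auto
qed

text \<open>Every summand of \<open>eps a\<close> ends at a vertex containing \<open>a\<close>,
  since a label lies in the subset of the head. Inserting that vertex makes
  \<open>vtx_absorb\<close> applicable.\<close>

sublocale Qfam: lrb_family kQ eps "set L"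
proof (intro lrb_family.intro lrb_family_axioms.intro PB.B.ring_axioms)
  fix a z assume a: "a \<in> set L" and z: "z \<in> carrier kQ"
  have "eps a \<otimes>\<^bsub>kQ\<^esub> z \<otimes>\<^bsub>kQ\<^esub> eps a = (\<Oplus>\<^bsub>kQ\<^esub>q\<in>label_paths a. pv q \<otimes>\<^bsub>kQ\<^esub> z \<otimes>\<^bsub>kQ\<^esub> eps a)"
    by (rule hom_eps[OF module_hom_comp[OF PB.mult_left_hom[OF z] PB.mult_left_hom[OF eps_closed]]])
  also have "\<dots> = (\<Oplus>\<^bsub>kQ\<^esub>q\<in>label_paths a. pv q \<otimes>\<^bsub>kQ\<^esub> z)"
  proof (rule PB.L.M.finsum_cong')
    fix q assume q: "q \<in> label_paths a"
    obtain u p v where q': "q = (u, p, v)" by (cases q)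
    have v: "v \<in> verts Q" "a \<in> \<sigma> v" using q q' label_paths_target by auto
    have qp: "(u, p, v) \<in> quiver_paths Q" using q q' label_paths_subset by auto
    note c = pv_closed[OF qp] vtx_closed[OF v(1)] z eps_closed
    have e: "pv q = pv q \<otimes>\<^bsub>kQ\<^esub> vtx v" using pv_mult[OF qp vtx_path[OF v(1)]] q' by simp
    have "pv q \<otimes>\<^bsub>kQ\<^esub> z \<otimes>\<^bsub>kQ\<^esub> eps a = pv q \<otimes>\<^bsub>kQ\<^esub> (vtx v \<otimes>\<^bsub>kQ\<^esub> z \<otimes>\<^bsub>kQ\<^esub> eps a)"
      by (subst e) (use c q' in \<open>simp add: PB.B.m_assoc\<close>)
    also have "\<dots> = (pv q \<otimes>\<^bsub>kQ\<^esub> vtx v) \<otimes>\<^bsub>kQ\<^esub> z"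
      using c q' by (simp add: vtx_absorb[OF v z] PB.B.m_assoc)
    finally show "pv q \<otimes>\<^bsub>kQ\<^esub> z \<otimes>\<^bsub>kQ\<^esub> eps a = pv q \<otimes>\<^bsub>kQ\<^esub> z" using e by simp
  qed (use pv_label_closed z in auto)
  also have "\<dots> = eps a \<otimes>\<^bsub>kQ\<^esub> z"
    by (rule hom_eps[OF PB.mult_left_hom[OF z], symmetric])
  finally show "eps a \<otimes>\<^bsub>kQ\<^esub> z \<otimes>\<^bsub>kQ\<^esub> eps a = eps a \<otimes>\<^bsub>kQ\<^esub> z" .
qed (rule eps_closed)

section \<open>Vertices as the idempotents of the family \<open>eps\<close>\<close>

lemma vtx_mult:
  assumes "u \<in> verts Q" "(u', p, v) \<in> quiver_paths Q"
  shows "vtx u \<otimes>\<^bsub>kQ\<^esub> pv (u', p, v) = (if u = u' then pv (u', p, v) else \<zero>\<^bsub>kQ\<^esub>)"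
  using pv_mult[OF vtx_path[OF assms(1)] assms(2)] by simp

lemma mult_vtx:
  assumes "v \<in> verts Q" "(u, p, v') \<in> quiver_paths Q"
  shows "pv (u, p, v') \<otimes>\<^bsub>kQ\<^esub> vtx v = (if v = v' then pv (u, p, v') else \<zero>\<^bsub>kQ\<^esub>)"
  using pv_mult[OF assms(2) vtx_path[OF assms(1)]] by auto

text \<open>The idempotent contains the factor 1 - \<open>eps b\<close>, and the vertex absorbs
  \<open>eps b\<close> across everything before it, so the difference cancels.\<close>

lemma vtx_mult_idem_zero:
  assumes u: "u \<in> verts Q" and X: "X \<subseteq> set L" and b: "b \<in> \<sigma> u" "b \<notin> X"
  shows "vtx u \<otimes>\<^bsub>kQ\<^esub> lrb_idem kQ eps X L = \<zero>\<^bsub>kQ\<^esub>"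
proof -
  have bA: "b \<in> set L" using u b \<sigma>_subset by auto
  obtain p q where pq: "p \<in> carrier kQ" "q \<in> carrier kQ"
    "lrb_idem kQ eps X L = p \<otimes>\<^bsub>kQ\<^esub> Qfam.co b \<otimes>\<^bsub>kQ\<^esub> q"
    using Qfam.F_split_notin[OF subset_refl bA b(2)] by auto
  note c = pq(1,2) vtx_closed[OF u] Qfam.co_closed[OF bA]
  have "vtx u \<otimes>\<^bsub>kQ\<^esub> p \<otimes>\<^bsub>kQ\<^esub> Qfam.co b = vtx u \<otimes>\<^bsub>kQ\<^esub> p \<ominus>\<^bsub>kQ\<^esub> vtx u \<otimes>\<^bsub>kQ\<^esub> p \<otimes>\<^bsub>kQ\<^esub> eps b"
    using c by (intro Qfam.mult_co bA) simp
  also have "\<dots> = \<zero>\<^bsub>kQ\<^esub>"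
    using c by (simp only: vtx_absorb[OF u b(1) pq(1)]) (simp add: PB.L.M.minus_eq PB.L.M.r_neg)
  finally have z: "vtx u \<otimes>\<^bsub>kQ\<^esub> p \<otimes>\<^bsub>kQ\<^esub> Qfam.co b = \<zero>\<^bsub>kQ\<^esub>" .
  have "vtx u \<otimes>\<^bsub>kQ\<^esub> lrb_idem kQ eps X L = (vtx u \<otimes>\<^bsub>kQ\<^esub> p \<otimes>\<^bsub>kQ\<^esub> Qfam.co b) \<otimes>\<^bsub>kQ\<^esub> q"
    unfolding pq(3) using c by (simp only: PB.B.m_assoc PB.B.m_closed)
  then show ?thesis using z c by simp
qed

text \<open>The factors \<open>eps m\<close> before that of the leader have \<open>m\<close> in the
  subset of \<open>u\<close>; the vertex absorbs them, even across the inserted leader. At the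
  leader itself idempotency supplies the additional copy. Factors of letters outside
  \<open>X\<close> stand at the right end and are carried along.\<close>

lemma vtx_mult_idem_first:
  assumes u: "u \<in> verts Q" and X: "\<sigma> u \<subseteq> X" and "set L' \<subseteq> set L" "(X - \<sigma> u) \<inter> set L' \<noteq> {}"
  shows "vtx u \<otimes>\<^bsub>kQ\<^esub> lrb_idem kQ eps X L' =
    vtx u \<otimes>\<^bsub>kQ\<^esub> eps (first_in L' (X - \<sigma> u)) \<otimes>\<^bsub>kQ\<^esub> lrb_idem kQ eps X L'"
  using assms(3,4)
proof (induction L')
  case (Cons m L')
  have m: "m \<in> set L" and L': "set L' \<subseteq> set L" using Cons.prems by auto
  note c = vtx_closed[OF u] eps_closed Qfam.F_closed[OF L'] Qfam.co_closed[OF m]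
  show ?case
  proof (cases "m \<in> X - \<sigma> u")
    case True
    have "eps m \<otimes>\<^bsub>kQ\<^esub> eps m = eps m" using Qfam.x_absorb[OF m PB.B.one_closed] c by simp
    then have "vtx u \<otimes>\<^bsub>kQ\<^esub> eps m \<otimes>\<^bsub>kQ\<^esub> (eps m \<otimes>\<^bsub>kQ\<^esub> lrb_idem kQ eps X L') =
        vtx u \<otimes>\<^bsub>kQ\<^esub> (eps m \<otimes>\<^bsub>kQ\<^esub> lrb_idem kQ eps X L')"
      using c by (metis PB.B.m_assoc PB.B.m_closed)
    with True show ?thesis by (simp add: first_in_Cons)
  next
    case False
    define d where "d = first_in L' (X - \<sigma> u)"
    have d: "first_in (m # L') (X - \<sigma> u) = d" using False by (auto simp: first_in_Cons d_def)
    have IH: "vtx u \<otimes>\<^bsub>kQ\<^esub> lrb_idem kQ eps X L' = vtx u \<otimes>\<^bsub>kQ\<^esub> eps d \<otimes>\<^bsub>kQ\<^esub> lrb_idem kQ eps X L'"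
      using Cons.IH[OF L'] Cons.prems False by (auto simp: d_def)
    show ?thesis
    proof (cases "m \<in> X")
      case True
      then have mu: "m \<in> \<sigma> u" using False by auto
      have 1: "vtx u \<otimes>\<^bsub>kQ\<^esub> eps m = vtx u"
        using vtx_absorb[OF u mu PB.B.one_closed] c by simp
      have 2: "vtx u \<otimes>\<^bsub>kQ\<^esub> eps d \<otimes>\<^bsub>kQ\<^esub> eps m = vtx u \<otimes>\<^bsub>kQ\<^esub> eps d"
        by (rule vtx_absorb[OF u mu eps_closed])
      have "vtx u \<otimes>\<^bsub>kQ\<^esub> lrb_idem kQ eps X (m # L') = (vtx u \<otimes>\<^bsub>kQ\<^esub> eps m) \<otimes>\<^bsub>kQ\<^esub> lrb_idem kQ eps X L'"
        using True c by (simp add: PB.B.m_assoc)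
      also have "\<dots> = (vtx u \<otimes>\<^bsub>kQ\<^esub> eps d \<otimes>\<^bsub>kQ\<^esub> eps m) \<otimes>\<^bsub>kQ\<^esub> lrb_idem kQ eps X L'"
        by (simp only: 1 2 IH)
      also have "\<dots> = vtx u \<otimes>\<^bsub>kQ\<^esub> eps d \<otimes>\<^bsub>kQ\<^esub> lrb_idem kQ eps X (m # L')"
        using True c by (simp add: PB.B.m_assoc)
      finally show ?thesis by (simp only: d)
    next
      case False
      have "vtx u \<otimes>\<^bsub>kQ\<^esub> lrb_idem kQ eps X (m # L') =
          (vtx u \<otimes>\<^bsub>kQ\<^esub> lrb_idem kQ eps X L') \<otimes>\<^bsub>kQ\<^esub> Qfam.co m"
        using False c by (simp add: PB.B.m_assoc)
      also have "\<dots> = vtx u \<otimes>\<^bsub>kQ\<^esub> eps d \<otimes>\<^bsub>kQ\<^esub> lrb_idem kQ eps X (m # L')"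
        unfolding IH using False c by (simp add: PB.B.m_assoc)
      finally show ?thesis by (simp only: d)
    qed
  qed
qed simp

text \<open>As \<open>d\<close> belongs to D' without being its leader, that leader comes before
  \<open>d\<close>; as \<open>d\<close> is the leader of D, nothing before \<open>d\<close> belongs
  to D.\<close>

lemma first_in_precedes:
  assumes "d = first_in L D" "d \<in> D'" "d \<noteq> first_in L D'" "D \<subseteq> set L" "d \<in> D"
  shows "first_in L D' \<in> D' - D"
proof -
  have "first_in K D' \<in> D' - D"
    if "d = first_in K D" "d \<noteq> first_in K D'" "d \<in> set K" for K
    using that assms(2,5)
  proof (induction K)
    case (Cons m K)
    then show ?case by (auto simp: first_in_Cons split: if_splits)
  qed simp
  then show ?thesis using assms by auto
qed

text \<open>The remaining case is that \<open>X\<close> properly contains the subset of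
  \<open>u\<close>. Let d be the leader of the difference and insert \<open>eps d\<close>. Since d
  is not in the subset of \<open>u\<close>, only arrows from \<open>u\<close> labelled d contribute,
  and each of them ends at a vertex that F_X annihilates.\<close>

lemma vtx_mult_idem_neq:
  assumes u: "u \<in> verts Q" and X: "X \<subseteq> set L" and "X \<noteq> \<sigma> u"
  shows "vtx u \<otimes>\<^bsub>kQ\<^esub> lrb_idem kQ eps X L = \<zero>\<^bsub>kQ\<^esub>"
proof (cases "\<sigma> u \<subseteq> X")
  case False
  then show ?thesis using vtx_mult_idem_zero[OF u X] by auto
next
  case True
  define d where "d = first_in L (X - \<sigma> u)"
  have ne: "(X - \<sigma> u) \<inter> set L \<noteq> {}" using True X assms(3) by auto
  have d: "d \<in> X - \<sigma> u" using first_in_mem[OF ne] by (simp add: d_def)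
  note Fc = Qfam.F_closed[OF subset_refl, of X]
  have "vtx u \<otimes>\<^bsub>kQ\<^esub> lrb_idem kQ eps X L = vtx u \<otimes>\<^bsub>kQ\<^esub> eps d \<otimes>\<^bsub>kQ\<^esub> lrb_idem kQ eps X L"
    using vtx_mult_idem_first[OF u True subset_refl ne] by (simp only: d_def)
  also have "\<dots> = (\<Oplus>\<^bsub>kQ\<^esub>q\<in>label_paths d. vtx u \<otimes>\<^bsub>kQ\<^esub> pv q \<otimes>\<^bsub>kQ\<^esub> lrb_idem kQ eps X L)"
    by (rule hom_eps[OF sandwich_hom[OF vtx_closed[OF u] Fc]])
  also have "\<dots> = \<zero>\<^bsub>kQ\<^esub>"
  proof (rule PB.L.M.add.finprod_one_eqI)
    fix q assume q: "q \<in> label_paths d"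
    obtain u' p w where q': "q = (u', p, w)" by (cases q)
    have qp: "(u', p, w) \<in> quiver_paths Q" using q q' label_paths_subset by auto
    show "vtx u \<otimes>\<^bsub>kQ\<^esub> pv q \<otimes>\<^bsub>kQ\<^esub> lrb_idem kQ eps X L = \<zero>\<^bsub>kQ\<^esub>"
    proof (cases "u = u'")
      case False
      then show ?thesis using vtx_mult[OF u qp] q' Fc by simp
    next
      case uu: True
      then obtain e where e: "e \<in> arcs Q" "lab e = d" "tail Q e = u" "p = [e]" "w = head Q e"
        using q q' d by (auto simp: label_paths_def)
      have w: "w \<in> verts Q" using e by auto
      \<comment> \<open>The label d of an arrow is not the leader of the difference of its ends. So
        the leader of that difference precedes d and lies outside \<open>X\<close>; it belongs to
        the subset of \<open>w\<close> and makes \<open>w\<close> annihilate F_X.\<close>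
      have "first_in L (\<sigma> w - \<sigma> u) \<in> (\<sigma> w - \<sigma> u) - (X - \<sigma> u)"
        by (rule first_in_precedes[OF d_def]) (use e arc_props[OF e(1)] d X \<sigma>_subset[OF w] in auto)
      then have z: "vtx w \<otimes>\<^bsub>kQ\<^esub> lrb_idem kQ eps X L = \<zero>\<^bsub>kQ\<^esub>"
        using vtx_mult_idem_zero[OF w X] by blast
      have "vtx u \<otimes>\<^bsub>kQ\<^esub> pv q = pv q \<otimes>\<^bsub>kQ\<^esub> vtx w"
        using vtx_mult[OF u qp] mult_vtx[OF w qp] uu q' by simp
      then have "vtx u \<otimes>\<^bsub>kQ\<^esub> pv q \<otimes>\<^bsub>kQ\<^esub> lrb_idem kQ eps X L = pv q \<otimes>\<^bsub>kQ\<^esub> (vtx w \<otimes>\<^bsub>kQ\<^esub> lrb_idem kQ eps X L)"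
        using pv_closed[OF qp] vtx_closed[OF w] Fc q' by (simp add: PB.B.m_assoc)
      then show ?thesis using z pv_closed[OF qp] q' by simp
    qed
  qed
  finally show ?thesis .
qed

text \<open>Both sides equal their product: expand 1 as the sum of all F_X to the right of the
  vertex, and as the sum of all vertices to the left of the idempotent.\<close>

lemma vtx_eq_idem:
  assumes u: "u \<in> verts Q"
  shows "lrb_idem kQ eps (\<sigma> u) L = vtx u"
proof -
  note Fc = Qfam.F_closed[OF subset_refl]
  have "vtx u = vtx u \<otimes>\<^bsub>kQ\<^esub> (\<Oplus>\<^bsub>kQ\<^esub>X\<in>Pow (set L). lrb_idem kQ eps X L)"
    using Qfam.F_sum[OF subset_refl distinct_L] vtx_closed[OF u] by simp
  also have "\<dots> = (\<Oplus>\<^bsub>kQ\<^esub>X\<in>Pow (set L). vtx u \<otimes>\<^bsub>kQ\<^esub> lrb_idem kQ eps X L)"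
    using Fc vtx_closed[OF u] by (intro PB.B.finsum_rdistr) auto
  also have "\<dots> = vtx u \<otimes>\<^bsub>kQ\<^esub> lrb_idem kQ eps (\<sigma> u) L"
    by (rule sum_one_term[of "\<sigma> u"])
      (use \<sigma>_subset[OF u] vtx_mult_idem_neq[OF u] Fc vtx_closed[OF u] in auto)
  finally have 1: "vtx u = vtx u \<otimes>\<^bsub>kQ\<^esub> lrb_idem kQ eps (\<sigma> u) L" .
  have E: "pv \<in> {(v, [], v) | v. v \<in> verts Q} \<rightarrow> carrier kQ" using vtx_closed by auto
  have "lrb_idem kQ eps (\<sigma> u) L = \<one>\<^bsub>kQ\<^esub> \<otimes>\<^bsub>kQ\<^esub> lrb_idem kQ eps (\<sigma> u) L"
    using Fc by simp
  also have "\<dots> = (\<Oplus>\<^bsub>kQ\<^esub>q\<in>{(v, [], v) | v. v \<in> verts Q}. pv q \<otimes>\<^bsub>kQ\<^esub> lrb_idem kQ eps (\<sigma> u) L)"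
    unfolding PB.one_eq_finsum
    by (rule module_hom_finsum[OF PB.L.M.abelian_group_axioms PB.L.M.abelian_group_axioms
          PB.mult_left_hom[OF Fc] E])
  also have "\<dots> = vtx u \<otimes>\<^bsub>kQ\<^esub> lrb_idem kQ eps (\<sigma> u) L"
    by (rule sum_one_term[of "(u, [], u)"])
      (use u \<sigma>_subset[OF u] vtx_mult_idem_neq Fc vtx_closed finite_verts \<sigma>_eq_iff in auto)
  finally show ?thesis using 1 by simp
qed

text \<open>A vertex summand of \<open>eps (lab e)\<close> cannot be the tail of \<open>e\<close>,
  because the label is not in the subset of the tail; and an arrow is determined by its ends and its
  label.\<close>

lemma vtx_eps_vtx_arc:
  assumes e: "e \<in> arcs Q"
  shows "vtx (tail Q e) \<otimes>\<^bsub>kQ\<^esub> eps (lab e) \<otimes>\<^bsub>kQ\<^esub> vtx (head Q e) = arr e"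
proof -
  have v: "tail Q e \<in> verts Q" "head Q e \<in> verts Q" using e by auto
  have "vtx (tail Q e) \<otimes>\<^bsub>kQ\<^esub> eps (lab e) \<otimes>\<^bsub>kQ\<^esub> vtx (head Q e) =
      (\<Oplus>\<^bsub>kQ\<^esub>q\<in>label_paths (lab e). vtx (tail Q e) \<otimes>\<^bsub>kQ\<^esub> pv q \<otimes>\<^bsub>kQ\<^esub> vtx (head Q e))"
    by (rule hom_eps[OF sandwich_hom[OF vtx_closed vtx_closed]]) (use v in auto)
  also have "\<dots> = arr e"
  proof (rule sum_one_term[of "(tail Q e, [e], head Q e)"])
    show "(tail Q e, [e], head Q e) \<in> label_paths (lab e)" using e by (auto simp: label_paths_def)
    show "vtx (tail Q e) \<otimes>\<^bsub>kQ\<^esub> arr e \<otimes>\<^bsub>kQ\<^esub> vtx (head Q e) = arr e"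
      using vtx_mult[OF v(1) arc_path[OF e]] mult_vtx[OF v(2) arc_path[OF e]] by simp
    fix q assume q: "q \<in> label_paths (lab e)" "q \<noteq> (tail Q e, [e], head Q e)"
    obtain u' p w where q': "q = (u', p, w)" by (cases q)
    have qp: "(u', p, w) \<in> quiver_paths Q" using q q' label_paths_subset by auto
    have "u' \<noteq> tail Q e \<or> w \<noteq> head Q e"
      using q q' e arc_props(3)[OF e] arc_eqI[OF _ e] by (auto simp: label_paths_def)
    then show "vtx (tail Q e) \<otimes>\<^bsub>kQ\<^esub> pv q \<otimes>\<^bsub>kQ\<^esub> vtx (head Q e) = \<zero>\<^bsub>kQ\<^esub>"
      using vtx_mult[OF v(1) qp] mult_vtx[OF v(2) qp] q' vtx_closed v by auto
  qed (use e arr_closed finite_label_paths in auto)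
  finally show ?thesis .
qed

lemma vtx_eps_vtx_zero:
  assumes u: "u \<in> verts Q" and w: "w \<in> verts Q" and a: "a \<notin> \<sigma> u"
    and none: "\<And>e. \<lbrakk>e \<in> arcs Q; tail Q e = u; head Q e = w; lab e = a\<rbrakk> \<Longrightarrow> False"
  shows "vtx u \<otimes>\<^bsub>kQ\<^esub> eps a \<otimes>\<^bsub>kQ\<^esub> vtx w = \<zero>\<^bsub>kQ\<^esub>"
proof -
  have "vtx u \<otimes>\<^bsub>kQ\<^esub> eps a \<otimes>\<^bsub>kQ\<^esub> vtx w =
      (\<Oplus>\<^bsub>kQ\<^esub>q\<in>label_paths a. vtx u \<otimes>\<^bsub>kQ\<^esub> pv q \<otimes>\<^bsub>kQ\<^esub> vtx w)"
    by (rule hom_eps[OF sandwich_hom[OF vtx_closed vtx_closed]]) (use u w in auto)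
  also have "\<dots> = \<zero>\<^bsub>kQ\<^esub>"
  proof (rule PB.L.M.add.finprod_one_eqI)
    fix q assume q: "q \<in> label_paths a"
    obtain u' p w' where q': "q = (u', p, w')" by (cases q)
    have qp: "(u', p, w') \<in> quiver_paths Q" using q q' label_paths_subset by auto
    have "u' \<noteq> u \<or> w' \<noteq> w" using q q' a none by (auto simp: label_paths_def)
    then show "vtx u \<otimes>\<^bsub>kQ\<^esub> pv q \<otimes>\<^bsub>kQ\<^esub> vtx w = \<zero>\<^bsub>kQ\<^esub>"
      using vtx_mult[OF u qp] mult_vtx[OF w qp] q' vtx_closed w by auto
  qed
  finally show ?thesis .
qed

end

section \<open>The two mutually inverse homomorphisms\<close>

context lrb_quiver
begin

abbreviation "f u \<equiv> lrb_idem kS (\<lambda>a. lt [a]) (\<sigma> u) L"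
abbreviation "farc e \<equiv> f (tail Q e) \<otimes>\<^bsub>kS\<^esub> lt [lab e] \<otimes>\<^bsub>kS\<^esub> f (head Q e)"

text \<open>The leading idempotent makes the trivial path at \<open>u\<close> go to
  \<open>f u\<close> instead of 1.\<close>

definition path_elem :: "'v \<times> 'e list \<times> 'v \<Rightarrow> 'a list \<Rightarrow> 'k" where
  "path_elem = (\<lambda>(u, p, v). f u \<otimes>\<^bsub>kS\<^esub> list_prod kS farc p)"

definition from_paths :: "('v \<times> 'e list \<times> 'v \<Rightarrow> 'k) \<Rightarrow> 'a list \<Rightarrow> 'k" where
  "from_paths = lin_ext k kS path_elem"

definition to_paths :: "('a list \<Rightarrow> 'k) \<Rightarrow> 'v \<times> 'e list \<times> 'v \<Rightarrow> 'k" where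
  "to_paths = lin_ext k kQ (list_prod kQ eps)"

lemma f_closed: "f u \<in> carrier kS"
  by (rule fam.F_closed) simp

lemma f_idem: "u \<in> verts Q \<Longrightarrow> f u \<otimes>\<^bsub>kS\<^esub> f u = f u"
  by (rule fam.F_idem[OF subset_refl distinct_L \<sigma>_subset])

lemma f_orth: "\<lbrakk>u \<in> verts Q; v \<in> verts Q; u \<noteq> v\<rbrakk> \<Longrightarrow> f u \<otimes>\<^bsub>kS\<^esub> f v = \<zero>\<^bsub>kS\<^esub>"
  using fam.F_orthogonal[OF subset_refl \<sigma>_subset \<sigma>_subset, of v u] \<sigma>_eq_iff by metis

lemma lab_in: "e \<in> arcs Q \<Longrightarrow> lab e \<in> set L"
  using arc_props(2) \<sigma>_subset head_in_verts by blast

lemma letter_closed: "a \<in> set L \<Longrightarrow> lt [a] \<in> carrier kS"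
  by (rule fam.x_closed)

lemma farc_closed: "e \<in> arcs Q \<Longrightarrow> farc e \<in> carrier kS"
  using f_closed letter_closed lab_in by simp

lemma list_prod_farc_closed: "set p \<subseteq> arcs Q \<Longrightarrow> list_prod kS farc p \<in> carrier kS"
  by (rule SB.B.list_prod_closed) (use farc_closed in blast)

text \<open>Needed to compose path elements: with the idempotent of the target exposed, the product
  of two of them contains \<open>f v\<close> next to \<open>f v'\<close>, which decides whether it
  survives. In the induction the idempotent at the end of \<open>farc e\<close> serves as the
  leading one of the rest.\<close>

lemma path_elem_target:
  assumes "awalk u p v"
  shows "f u \<otimes>\<^bsub>kS\<^esub> list_prod kS farc p \<otimes>\<^bsub>kS\<^esub> f v = f u \<otimes>\<^bsub>kS\<^esub> list_prod kS farc p"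
  using assms
proof (induction p arbitrary: u)
  case Nil
  then show ?case using f_idem[of u] f_closed[of u] by (auto simp: awalk_simps)
next
  case (Cons e p)
  then have e: "e \<in> arcs Q" "u = tail Q e" and p: "awalk (head Q e) p v"
    by (auto simp: awalk_simps)
  have h: "head Q e \<in> verts Q" using e by auto
  note c = f_closed letter_closed[OF lab_in[OF e(1)]] farc_closed[OF e(1)]
  have cp: "list_prod kS farc p \<in> carrier kS" using p by (intro list_prod_farc_closed) auto
  have fe: "farc e \<otimes>\<^bsub>kS\<^esub> f (head Q e) = farc e"
    using c(1,2) f_idem[OF h] by (simp add: SB.B.m_assoc)
  have step: "f u \<otimes>\<^bsub>kS\<^esub> list_prod kS farc (e # p) =
      f u \<otimes>\<^bsub>kS\<^esub> farc e \<otimes>\<^bsub>kS\<^esub> (f (head Q e) \<otimes>\<^bsub>kS\<^esub> list_prod kS farc p)"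
  proof -
    have "f u \<otimes>\<^bsub>kS\<^esub> list_prod kS farc (e # p) =
        f u \<otimes>\<^bsub>kS\<^esub> ((farc e \<otimes>\<^bsub>kS\<^esub> f (head Q e)) \<otimes>\<^bsub>kS\<^esub> list_prod kS farc p)"
      by (simp only: fe list_prod_simps)
    then show ?thesis using c(1,3) cp by (simp only: SB.B.m_assoc SB.B.m_closed)
  qed
  show ?case
    unfolding step using Cons.IH[OF p] c(1,3) cp
    by (simp only: SB.B.m_assoc SB.B.m_closed)
qed

lemma path_elem_closed: "path_elem \<in> quiver_paths Q \<rightarrow> carrier kS"
  using f_closed list_prod_farc_closed
  by (auto simp: path_elem_def quiver_paths_def intro!: SB.B.m_closed)

lemma path_elem_mult:
  assumes "x \<in> quiver_paths Q" "y \<in> quiver_paths Q"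
  shows "path_elem x \<otimes>\<^bsub>kS\<^esub> path_elem y =
    (case path_concat x y of None \<Rightarrow> \<zero>\<^bsub>kS\<^esub> | Some z \<Rightarrow> path_elem z)"
proof -
  obtain u p v v' q w where xy: "x = (u, p, v)" "y = (v', q, w)" by (cases x; cases y)
  have aw: "awalk u p v" "awalk v' q w" using assms xy by (auto simp: quiver_paths_def)
  then have vs: "v \<in> verts Q" "v' \<in> verts Q" by (auto dest: awalk_hd_in_verts awalk_last_in_verts)
  have arcs: "set p \<subseteq> arcs Q" "set q \<subseteq> arcs Q" using aw by auto
  note c = f_closed list_prod_farc_closed[OF arcs(1)] list_prod_farc_closed[OF arcs(2)]
  have "path_elem x \<otimes>\<^bsub>kS\<^esub> path_elem y =
      (f u \<otimes>\<^bsub>kS\<^esub> list_prod kS farc p) \<otimes>\<^bsub>kS\<^esub> (f v' \<otimes>\<^bsub>kS\<^esub> list_prod kS farc q)"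
    by (simp add: path_elem_def xy)
  also have "\<dots> = (f u \<otimes>\<^bsub>kS\<^esub> list_prod kS farc p \<otimes>\<^bsub>kS\<^esub> f v) \<otimes>\<^bsub>kS\<^esub> (f v' \<otimes>\<^bsub>kS\<^esub> list_prod kS farc q)"
    by (simp only: path_elem_target[OF aw(1)])
  also have "\<dots> = f u \<otimes>\<^bsub>kS\<^esub> list_prod kS farc p \<otimes>\<^bsub>kS\<^esub> (f v \<otimes>\<^bsub>kS\<^esub> f v') \<otimes>\<^bsub>kS\<^esub> list_prod kS farc q"
    using c by (simp only: SB.B.m_assoc SB.B.m_closed)
  also have "\<dots> = (case path_concat x y of None \<Rightarrow> \<zero>\<^bsub>kS\<^esub> | Some z \<Rightarrow> path_elem z)"
  proof (cases "v = v'")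
    case True
    have "f u \<otimes>\<^bsub>kS\<^esub> list_prod kS farc p \<otimes>\<^bsub>kS\<^esub> (f v \<otimes>\<^bsub>kS\<^esub> f v') \<otimes>\<^bsub>kS\<^esub> list_prod kS farc q =
        f u \<otimes>\<^bsub>kS\<^esub> list_prod kS farc p \<otimes>\<^bsub>kS\<^esub> list_prod kS farc q"
      using True f_idem[OF vs(1)] path_elem_target[OF aw(1)] by simp
    also have "\<dots> = f u \<otimes>\<^bsub>kS\<^esub> list_prod kS farc (p @ q)"
      using c farc_closed arcs by (subst SB.B.list_prod_append) (auto simp: SB.B.m_assoc)
    finally show ?thesis using True xy by (simp add: path_elem_def)
  next
    case False
    then show ?thesis using c xy f_orth[OF vs] by simp
  qed
  finally show ?thesis .
qed

lemma path_elem_sum: "(\<Oplus>\<^bsub>kS\<^esub>e\<in>{(v, [], v) | v. v \<in> verts Q}. path_elem e) = \<one>\<^bsub>kS\<^esub>"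
proof -
  have E: "{(v, [] :: 'e list, v) | v. v \<in> verts Q} = (\<lambda>v. (v, [], v)) ` verts Q" by auto
  have "(\<Oplus>\<^bsub>kS\<^esub>e\<in>{(v, [], v) | v. v \<in> verts Q}. path_elem e) = (\<Oplus>\<^bsub>kS\<^esub>v\<in>verts Q. path_elem (v, [], v))"
    unfolding E using path_elem_closed vtx_path
    by (intro SB.L.M.finsum_reindex) (auto simp: inj_on_def)
  also have "\<dots> = (\<Oplus>\<^bsub>kS\<^esub>v\<in>verts Q. f v)"
    using f_closed by (intro SB.L.M.finsum_cong') (auto simp: path_elem_def)
  also have "\<dots> = (\<Oplus>\<^bsub>kS\<^esub>X\<in>\<sigma> ` verts Q. lrb_idem kS (\<lambda>a. lt [a]) X L)"
    using fam.F_closed[OF subset_refl] \<sigma>_bij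
    by (intro SB.L.M.finsum_reindex[symmetric]) (auto simp: bij_betw_def)
  also have "\<dots> = \<one>\<^bsub>kS\<^esub>"
    using fam.F_sum[OF subset_refl distinct_L] \<sigma>_bij by (simp add: bij_betw_def)
  finally show ?thesis .
qed

lemma from_paths_hom: "from_paths \<in> ring_hom kQ kS"
  unfolding from_paths_def
  by (rule PB.lin_ext_ring_hom[OF SB.k_algebra_axioms path_elem_closed path_elem_mult path_elem_sum])

lemma from_paths_linear: "from_paths \<in> mhom k kQ kS"
  using SB.L.lin_ext_hom[OF path_elem_closed]
  by (simp add: from_paths_def path_algebra_def)

lemma from_paths_pv: "p \<in> quiver_paths Q \<Longrightarrow> from_paths (pv p) = path_elem p"
  unfolding from_paths_def using path_elem_closed by (intro SB.L.lin_ext_basis_vec) auto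

lemma list_prod_eps_closed: "list_prod kQ eps w \<in> carrier kQ"
  by (rule PB.B.list_prod_closed) (rule eps_closed)

text \<open>Multiplicativity on words is the deletion of repeated letters in the left regular family
  \<open>eps\<close>.\<close>

lemma to_paths_hom: "to_paths \<in> ring_hom kS kQ"
  unfolding to_paths_def
proof (rule SB.lin_ext_ring_hom[OF PB.k_algebra_axioms])
  fix v w assume "v \<in> carrier (free_lrb (set L))" "w \<in> carrier (free_lrb (set L))"
  then have "list_prod kQ eps (keep_first (v @ w)) = list_prod kQ eps v \<otimes>\<^bsub>kQ\<^esub> list_prod kQ eps w"
    using PB.B.list_prod_append[of v w eps] eps_closed
    by (subst Qfam.list_prod_keep_first) auto
  then show "list_prod kQ eps v \<otimes>\<^bsub>kQ\<^esub> list_prod kQ eps w =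
    (case Some (v \<otimes>\<^bsub>free_lrb (set L)\<^esub> w) of None \<Rightarrow> \<zero>\<^bsub>kQ\<^esub> | Some z \<Rightarrow> list_prod kQ eps z)" by simp
qed (use list_prod_eps_closed in auto)

lemma to_paths_linear: "to_paths \<in> mhom k kS kQ"
  using PB.L.lin_ext_hom[of "list_prod kQ eps" "carrier S"] list_prod_eps_closed
  by (simp add: to_paths_def monoid_algebra_def)

lemma to_paths_word: "to_paths (lt w) = list_prod kQ eps w"
  unfolding to_paths_def using PB.L.lin_ext_basis_vec[of "list_prod kQ eps" w] list_prod_eps_closed
  by simp

lemma to_paths_letter: "to_paths (lt [a]) = eps a"
  using eps_closed by (simp add: to_paths_word)

lemma to_paths_f: "u \<in> verts Q \<Longrightarrow> to_paths (f u) = vtx u"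
  using ring_hom_lrb_idem[OF SB.ring_B PB.ring_B to_paths_hom, of L "\<lambda>a. lt [a]" "\<sigma> u"]
    letter_closed vtx_eq_idem[of u]
  by (simp add: to_paths_letter)

lemma to_paths_farc: "e \<in> arcs Q \<Longrightarrow> to_paths (farc e) = arr e"
proof -
  assume e: "e \<in> arcs Q"
  have v: "tail Q e \<in> verts Q" "head Q e \<in> verts Q" using e by auto
  have "to_paths (farc e) = to_paths (f (tail Q e)) \<otimes>\<^bsub>kQ\<^esub> to_paths (lt [lab e]) \<otimes>\<^bsub>kQ\<^esub> to_paths (f (head Q e))"
    using f_closed letter_closed[OF lab_in[OF e]] by (simp add: ring_hom_mult[OF to_paths_hom])
  then show ?thesis using v by (simp add: to_paths_f to_paths_letter vtx_eps_vtx_arc[OF e])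
qed

lemma to_from_path:
  assumes "p \<in> quiver_paths Q"
  shows "to_paths (path_elem p) = pv p"
proof -
  obtain u q v where p: "p = (u, q, v)" by (cases p)
  have aw: "awalk u q v" using assms p by (simp add: quiver_paths_def)
  have "vtx u \<otimes>\<^bsub>kQ\<^esub> list_prod kQ arr q = pv (u, q, v)"
    using aw
  proof (induction q arbitrary: u)
    case Nil
    then show ?case using vtx_closed[of u] by (auto simp: awalk_simps)
  next
    case (Cons e q)
    then have e: "e \<in> arcs Q" "u = tail Q e" and q: "awalk (head Q e) q v"
      by (auto simp: awalk_simps)
    have h: "u \<in> verts Q" "head Q e \<in> verts Q" using e by auto
    have c: "list_prod kQ arr q \<in> carrier kQ"
      using q arr_closed by (intro PB.B.list_prod_closed) (auto)
    have "vtx u \<otimes>\<^bsub>kQ\<^esub> list_prod kQ arr (e # q) = (vtx u \<otimes>\<^bsub>kQ\<^esub> arr e) \<otimes>\<^bsub>kQ\<^esub> list_prod kQ arr q"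
      using c vtx_closed[OF h(1)] arr_closed[OF e(1)] by (simp add: PB.B.m_assoc)
    \<comment> \<open>The vertex is moved past the arrow, so that it becomes the leading vertex
      required by the induction hypothesis.\<close>
    also have "vtx u \<otimes>\<^bsub>kQ\<^esub> arr e = arr e \<otimes>\<^bsub>kQ\<^esub> vtx (head Q e)"
      using vtx_mult[OF h(1) arc_path[OF e(1)]] mult_vtx[OF h(2) arc_path[OF e(1)]] e by simp
    also have "\<dots> \<otimes>\<^bsub>kQ\<^esub> list_prod kQ arr q = arr e \<otimes>\<^bsub>kQ\<^esub> pv (head Q e, q, v)"
      using c vtx_closed[OF h(2)] arr_closed[OF e(1)] Cons.IH[OF q] by (simp add: PB.B.m_assoc)
    also have "\<dots> = pv (u, e # q, v)"
      using pv_mult[OF arc_path[OF e(1)], of "head Q e" q v] q e by (simp add: quiver_paths_def)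
    finally show ?case .
  qed
  moreover have "to_paths (path_elem p) = vtx u \<otimes>\<^bsub>kQ\<^esub> list_prod kQ arr q"
  proof -
    have q: "set q \<subseteq> arcs Q" and u: "u \<in> verts Q" using aw by (auto dest: awalk_hd_in_verts)
    have "to_paths (list_prod kS farc q) = list_prod kQ (\<lambda>e. to_paths (farc e)) q"
      using q farc_closed by (intro ring_hom_list_prod[OF SB.ring_B PB.ring_B to_paths_hom]) blast
    also have "\<dots> = list_prod kQ arr q"
      using q by (induction q) (simp_all add: to_paths_farc)
    finally have "to_paths (list_prod kS farc q) = list_prod kQ arr q" .
    then show ?thesis
      using to_paths_f[OF u] f_closed list_prod_farc_closed[OF q]
      by (simp add: p path_elem_def ring_hom_mult[OF to_paths_hom])
  qed
  ultimately show ?thesis using p by simp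
qed

text \<open>Peirce decomposition: an element is the sum of its components between the idempotents,
  as these sum to 1 on either side.\<close>

lemma peirce_eqI:
  assumes y: "y \<in> carrier kS" and z: "z \<in> carrier kS"
    and eq: "\<And>u w. \<lbrakk>u \<in> verts Q; w \<in> verts Q\<rbrakk> \<Longrightarrow>
      f u \<otimes>\<^bsub>kS\<^esub> y \<otimes>\<^bsub>kS\<^esub> f w = f u \<otimes>\<^bsub>kS\<^esub> z \<otimes>\<^bsub>kS\<^esub> f w"
  shows "y = z"
proof -
  let ?F = "\<lambda>X. lrb_idem kS (\<lambda>a. lt [a]) X L"
  have Fc: "?F X \<in> carrier kS" for X by (rule fam.F_closed) simp
  have one: "(\<Oplus>\<^bsub>kS\<^esub>X\<in>Pow (set L). ?F X) = \<one>\<^bsub>kS\<^esub>" by (rule fam.F_sum[OF subset_refl distinct_L])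
  have eqF: "?F Y \<otimes>\<^bsub>kS\<^esub> y \<otimes>\<^bsub>kS\<^esub> ?F X = ?F Y \<otimes>\<^bsub>kS\<^esub> z \<otimes>\<^bsub>kS\<^esub> ?F X"
    if X: "X \<subseteq> set L" and Y: "Y \<subseteq> set L" for X Y
  proof -
    obtain w u where "w \<in> verts Q" "\<sigma> w = X" "u \<in> verts Q" "\<sigma> u = Y"
      using \<sigma>_surj[OF X] \<sigma>_surj[OF Y] by auto
    then show ?thesis using eq[of u w] by simp
  qed
  have row: "?F Y \<otimes>\<^bsub>kS\<^esub> x = (\<Oplus>\<^bsub>kS\<^esub>X\<in>Pow (set L). ?F Y \<otimes>\<^bsub>kS\<^esub> x \<otimes>\<^bsub>kS\<^esub> ?F X)"
    if "x \<in> carrier kS" for x Y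
    using SB.B.finsum_rdistr[of "Pow (set L)" "?F Y \<otimes>\<^bsub>kS\<^esub> x" ?F] Fc that one by simp
  have col: "x = (\<Oplus>\<^bsub>kS\<^esub>Y\<in>Pow (set L). ?F Y \<otimes>\<^bsub>kS\<^esub> x)" if "x \<in> carrier kS" for x
    using SB.B.finsum_ldistr[of "Pow (set L)" x ?F] Fc that one by simp
  have rows: "?F Y \<otimes>\<^bsub>kS\<^esub> y = ?F Y \<otimes>\<^bsub>kS\<^esub> z" if Y: "Y \<subseteq> set L" for Y
  proof -
    have "?F Y \<otimes>\<^bsub>kS\<^esub> y = (\<Oplus>\<^bsub>kS\<^esub>X\<in>Pow (set L). ?F Y \<otimes>\<^bsub>kS\<^esub> y \<otimes>\<^bsub>kS\<^esub> ?F X)" by (rule row[OF y])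
    also have "\<dots> = (\<Oplus>\<^bsub>kS\<^esub>X\<in>Pow (set L). ?F Y \<otimes>\<^bsub>kS\<^esub> z \<otimes>\<^bsub>kS\<^esub> ?F X)"
      by (rule SB.L.M.finsum_cong') (simp_all add: Y Fc z eqF)
    also have "\<dots> = ?F Y \<otimes>\<^bsub>kS\<^esub> z" by (rule row[OF z, symmetric])
    finally show ?thesis .
  qed
  have "y = (\<Oplus>\<^bsub>kS\<^esub>Y\<in>Pow (set L). ?F Y \<otimes>\<^bsub>kS\<^esub> y)" by (rule col[OF y])
  also have "\<dots> = (\<Oplus>\<^bsub>kS\<^esub>Y\<in>Pow (set L). ?F Y \<otimes>\<^bsub>kS\<^esub> z)"
    by (intro SB.L.M.finsum_cong') (simp_all add: Fc z rows)
  also have "\<dots> = z" by (rule col[OF z, symmetric])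
  finally show ?thesis .
qed

lemma from_paths_vtx: "u \<in> verts Q \<Longrightarrow> from_paths (vtx u) = f u"
  using f_closed by (simp add: from_paths_pv vtx_path path_elem_def)

text \<open>Peirce components are compared. If \<open>a\<close> is in the subset of
  \<open>u\<close>, both components equal \<open>f u\<close> times \<open>f w\<close>. If an arrow
  from \<open>u\<close> to \<open>w\<close> is labelled \<open>a\<close>, both are its image.
  Otherwise both vanish, and in \<open>kS\<close> this is where the vanishing rules for the
  idempotents are needed.\<close>

lemma from_paths_eps:
  assumes a: "a \<in> set L"
  shows "from_paths (eps a) = lt [a]"
proof (rule peirce_eqI)
  show "from_paths (eps a) \<in> carrier kS" using ring_hom_closed[OF from_paths_hom eps_closed] .
  show la: "lt [a] \<in> carrier kS" by (rule letter_closed[OF a])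
  fix u w assume u: "u \<in> verts Q" and w: "w \<in> verts Q"
  note m = ring_hom_mult[OF from_paths_hom]
  have z0: "from_paths \<zero>\<^bsub>kQ\<^esub> = \<zero>\<^bsub>kS\<^esub>"
    by (rule module_hom_zero[OF PB.L.M.abelian_group_axioms SB.L.M.abelian_group_axioms from_paths_linear])
  have "f u \<otimes>\<^bsub>kS\<^esub> from_paths (eps a) \<otimes>\<^bsub>kS\<^esub> f w = from_paths (vtx u \<otimes>\<^bsub>kQ\<^esub> eps a \<otimes>\<^bsub>kQ\<^esub> vtx w)"
    using u w vtx_closed eps_closed by (simp add: m from_paths_vtx)
  also have "\<dots> = f u \<otimes>\<^bsub>kS\<^esub> lt [a] \<otimes>\<^bsub>kS\<^esub> f w"
  proof (cases "a \<in> \<sigma> u")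
    case True
    have "vtx u \<otimes>\<^bsub>kQ\<^esub> eps a = vtx u"
      using vtx_absorb[OF u True PB.B.one_closed] vtx_closed[OF u] by simp
    then have "from_paths (vtx u \<otimes>\<^bsub>kQ\<^esub> eps a \<otimes>\<^bsub>kQ\<^esub> vtx w) = f u \<otimes>\<^bsub>kS\<^esub> f w"
      using u w vtx_closed by (simp add: m from_paths_vtx)
    also have "f u = f u \<otimes>\<^bsub>kS\<^esub> lt [a]"
      using fam.F_mult_x[OF subset_refl a True SB.B.one_closed] f_closed by simp
    finally show ?thesis .
  next
    case au: False
    show ?thesis
    proof (cases "\<exists>e\<in>arcs Q. tail Q e = u \<and> head Q e = w \<and> lab e = a")
      case True
      then obtain e where e: "e \<in> arcs Q" "tail Q e = u" "head Q e = w" "lab e = a" by auto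
      have "from_paths (vtx u \<otimes>\<^bsub>kQ\<^esub> eps a \<otimes>\<^bsub>kQ\<^esub> vtx w) = path_elem (u, [e], w)"
        using vtx_eps_vtx_arc[OF e(1)] e from_paths_pv[OF arc_path[OF e(1)]] by simp
      also have "\<dots> = (f u \<otimes>\<^bsub>kS\<^esub> f u) \<otimes>\<^bsub>kS\<^esub> lt [a] \<otimes>\<^bsub>kS\<^esub> f w"
        using e f_closed la by (simp add: path_elem_def SB.B.m_assoc)
      finally show ?thesis using f_idem[OF u] by simp
    next
      case False
      then have "vtx u \<otimes>\<^bsub>kQ\<^esub> eps a \<otimes>\<^bsub>kQ\<^esub> vtx w = \<zero>\<^bsub>kQ\<^esub>"
        using vtx_eps_vtx_zero[OF u w au] by blast
      moreover have "f u \<otimes>\<^bsub>kS\<^esub> lt [a] \<otimes>\<^bsub>kS\<^esub> f w = \<zero>\<^bsub>kS\<^esub>"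
      proof (cases "\<sigma> u \<subseteq> \<sigma> w \<and> a \<in> \<sigma> w")
        case True
        \<comment> \<open>Every other letter of the difference labels an arrow from \<open>u\<close>
          to \<open>w\<close>, which is excluded here.\<close>
        have "a = first_in L (\<sigma> w - \<sigma> u)"
        proof (rule ccontr)
          assume "a \<noteq> first_in L (\<sigma> w - \<sigma> u)"
          then obtain e where "e \<in> arcs Q" "\<sigma> (tail Q e) = \<sigma> u" "\<sigma> (head Q e) = \<sigma> w" "lab e = a"
            using arc_exists[of "\<sigma> u" "\<sigma> w" a] True au \<sigma>_subset[OF w] by auto
          with False show False using \<sigma>_eq_iff u w tail_in_verts head_in_verts by metis
        qed
        then show ?thesis
          using fam.F_F_subset[OF subset_refl, of "\<sigma> u" "\<sigma> w" "lt [a]"] True a au by auto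
      next
        case n: False
        show ?thesis
        proof (cases "a \<in> \<sigma> w")
          case True
          then obtain b where "b \<in> \<sigma> u" "b \<notin> \<sigma> w" using n by auto
          then show ?thesis
            using fam.F_F_not_subset[OF subset_refl _ _ _ la, of b "\<sigma> u" "\<sigma> w"] \<sigma>_subset[OF u] by auto
        next
          case False
          have "lt [a] \<otimes>\<^bsub>kS\<^esub> f w = \<zero>\<^bsub>kS\<^esub>"
            using fam.x_mult_F[OF subset_refl a False SB.B.one_closed] la by simp
          then show ?thesis using f_closed la by (simp add: SB.B.m_assoc)
        qed
      qed
      ultimately show ?thesis using z0 by simp
    qed
  qed
  finally show "f u \<otimes>\<^bsub>kS\<^esub> from_paths (eps a) \<otimes>\<^bsub>kS\<^esub> f w = f u \<otimes>\<^bsub>kS\<^esub> lt [a] \<otimes>\<^bsub>kS\<^esub> f w" .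
qed

text \<open>Each composite is linear and so is compared with the identity on a basis: on paths, and
  on words, where multiplicativity reduces the claim to letters.\<close>

lemma algebra_isomorphic_path_algebra: "algebra_isomorphic k kS kQ"
proof -
  have tf: "to_paths (from_paths y) = y" if "y \<in> carrier kQ" for y
  proof (rule PB.B_hom_eqI[OF module_hom_comp[OF from_paths_linear to_paths_linear] _ _ that])
    show "(\<lambda>y. y) \<in> mhom k kQ kQ"
      unfolding mhom_def by auto
  qed (simp add: from_paths_pv to_from_path)
  have ft: "from_paths (to_paths x) = x" if "x \<in> carrier kS" for x
  proof (rule SB.B_hom_eqI[OF module_hom_comp[OF to_paths_linear from_paths_linear] _ _ that])
    show "(\<lambda>y. y) \<in> mhom k kS kS"
      unfolding mhom_def by auto
    fix w assume w: "w \<in> carrier S"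
    have "from_paths (to_paths (lt w)) = list_prod kS (\<lambda>a. from_paths (eps a)) w"
      unfolding to_paths_word
      by (rule ring_hom_list_prod[OF PB.ring_B SB.ring_B from_paths_hom eps_closed])
    also have "\<dots> = list_prod kS (\<lambda>a. lt [a]) w"
      using w by (induction w) (simp_all add: from_paths_eps)
    finally show "from_paths (to_paths (lt w)) = lt w" using word_eq_list_prod[OF w] by simp
  qed
  have "bij_betw to_paths (carrier kS) (carrier kQ)"
    using tf ft ring_hom_closed[OF to_paths_hom] ring_hom_closed[OF from_paths_hom]
    by (intro bij_betwI[of _ _ _ from_paths]) auto
  then have "to_paths \<in> ring_iso kS kQ"
    using to_paths_hom by (simp add: ring_iso_def)
  then show ?thesis
    unfolding algebra_isomorphic_def
    using mhom_smult[OF to_paths_linear] by blast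
qed

end

section \<open>Simple modules\<close>

text \<open>Viewing a module as a \<open>k\<close>-space makes identities linear in the acting
  algebra element, so that they can be checked on words.\<close>

definition res_scalars ::
    "('k, 'b, 'c) module_scheme \<Rightarrow> ('b, 'm, 'd) module_scheme \<Rightarrow> ('k, 'm) module" where
  "res_scalars B M = \<lparr>carrier = carrier M, monoid.mult = undefined, one = undefined,
     zero = \<zero>\<^bsub>M\<^esub>, add = add M, smult = (\<lambda>c m. (c \<odot>\<^bsub>B\<^esub> \<one>\<^bsub>B\<^esub>) \<odot>\<^bsub>M\<^esub> m)\<rparr>"

lemma res_scalars_simps [simp]:
  "carrier (res_scalars B M) = carrier M" "zero (res_scalars B M) = zero M"
  "add (res_scalars B M) = add M"
  "c \<odot>\<^bsub>res_scalars B M\<^esub> m = (c \<odot>\<^bsub>B\<^esub> \<one>\<^bsub>B\<^esub>) \<odot>\<^bsub>M\<^esub> m"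
  by (simp_all add: res_scalars_def)

lemma abelian_group_cong:
  assumes "abelian_group M" "carrier N = carrier M" "add N = add M" "zero N = zero M"
  shows "abelian_group N"
proof -
  interpret abelian_group M by fact
  show ?thesis by (rule abelian_groupI) (auto simp: assms a_ac intro: l_neg)
qed

context k_algebra
begin

lemma scalar_closed: "c \<in> carrier k \<Longrightarrow> c \<odot>\<^bsub>B\<^esub> \<one>\<^bsub>B\<^esub> \<in> carrier B"
  by (rule L.smult_closed) simp_all

text \<open>The multiples of the identity are central in the algebra.\<close>

lemma scalar_smult:
  assumes "left_module B M" "c \<in> carrier k" "r \<in> carrier B" "m \<in> carrier M"
  shows "(c \<odot>\<^bsub>B\<^esub> r) \<odot>\<^bsub>M\<^esub> m = (c \<odot>\<^bsub>B\<^esub> \<one>\<^bsub>B\<^esub>) \<odot>\<^bsub>M\<^esub> (r \<odot>\<^bsub>M\<^esub> m)"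
    and "r \<odot>\<^bsub>M\<^esub> ((c \<odot>\<^bsub>B\<^esub> \<one>\<^bsub>B\<^esub>) \<odot>\<^bsub>M\<^esub> m) = (c \<odot>\<^bsub>B\<^esub> \<one>\<^bsub>B\<^esub>) \<odot>\<^bsub>M\<^esub> (r \<odot>\<^bsub>M\<^esub> m)"
proof -
  interpret M: left_module B M by fact
  have "(c \<odot>\<^bsub>B\<^esub> \<one>\<^bsub>B\<^esub>) \<otimes>\<^bsub>B\<^esub> r = c \<odot>\<^bsub>B\<^esub> r" "r \<otimes>\<^bsub>B\<^esub> (c \<odot>\<^bsub>B\<^esub> \<one>\<^bsub>B\<^esub>) = c \<odot>\<^bsub>B\<^esub> r"
    using assms by (simp_all add: smult_mult_left smult_mult_right)
  then show 1: "(c \<odot>\<^bsub>B\<^esub> r) \<odot>\<^bsub>M\<^esub> m = (c \<odot>\<^bsub>B\<^esub> \<one>\<^bsub>B\<^esub>) \<odot>\<^bsub>M\<^esub> (r \<odot>\<^bsub>M\<^esub> m)"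
    and "r \<odot>\<^bsub>M\<^esub> ((c \<odot>\<^bsub>B\<^esub> \<one>\<^bsub>B\<^esub>) \<odot>\<^bsub>M\<^esub> m) = (c \<odot>\<^bsub>B\<^esub> \<one>\<^bsub>B\<^esub>) \<odot>\<^bsub>M\<^esub> (r \<odot>\<^bsub>M\<^esub> m)"
    using M.smult_assoc[of "c \<odot>\<^bsub>B\<^esub> \<one>\<^bsub>B\<^esub>" r m] M.smult_assoc[of r "c \<odot>\<^bsub>B\<^esub> \<one>\<^bsub>B\<^esub>" m]
      assms scalar_closed by simp_all
qed

lemma res_scalars_left_module:
  assumes "left_module B M"
  shows "left_module k (res_scalars B M)"
proof -
  interpret M: left_module B M by fact
  have grp: "abelian_group (res_scalars B M)"
    by (rule abelian_group_cong[OF M.M.abelian_group_axioms]) simp_all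
  show ?thesis
  proof (intro left_module.intro left_module_axioms.intro K.ring_axioms grp, goal_cases)
    case (4 a b x)
    have "(a \<otimes>\<^bsub>k\<^esub> b) \<odot>\<^bsub>B\<^esub> \<one>\<^bsub>B\<^esub> = (a \<odot>\<^bsub>B\<^esub> \<one>\<^bsub>B\<^esub>) \<otimes>\<^bsub>B\<^esub> (b \<odot>\<^bsub>B\<^esub> \<one>\<^bsub>B\<^esub>)"
      using 4 scalar_closed by (simp add: smult_mult_left L.smult_assoc)
    then show ?case using 4 scalar_closed by (simp add: M.smult_assoc)
  qed (simp_all add: scalar_closed L.smult_l_distr M.smult_l_distr M.smult_r_distr M.smult_closed
      L.smult_one M.smult_one)
qed

lemma act_hom:
  assumes "left_module B M" "m \<in> carrier M"
  shows "(\<lambda>r. r \<odot>\<^bsub>M\<^esub> m) \<in> mhom k B (res_scalars B M)"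
proof -
  interpret M: left_module B M by fact
  show ?thesis
    unfolding mhom_def
    by (auto simp: M.smult_l_distr M.smult_closed assms scalar_smult(1)[OF assms(1)])
qed

lemma res_scalars_hom:
  assumes "h \<in> mhom B M N"
  shows "h \<in> mhom k (res_scalars B M) (res_scalars B N)"
  using assms scalar_closed unfolding mhom_def by auto

lemma smult_hom:
  assumes "left_module B M" "r \<in> carrier B"
  shows "(\<lambda>m. r \<odot>\<^bsub>M\<^esub> m) \<in> mhom k (res_scalars B M) (res_scalars B M)"
proof -
  interpret M: left_module B M by fact
  show ?thesis
    unfolding mhom_def
    by (auto simp: M.smult_r_distr M.smult_closed assms scalar_smult(2)[OF assms(1)])
qed

end

lemma module_hom_sum:
  assumes "abelian_group N" "\<And>c x y. \<lbrakk>c \<in> carrier R; x \<in> carrier N; y \<in> carrier N\<rbrakk> \<Longrightarrow>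
      c \<odot>\<^bsub>N\<^esub> (x \<oplus>\<^bsub>N\<^esub> y) = c \<odot>\<^bsub>N\<^esub> x \<oplus>\<^bsub>N\<^esub> c \<odot>\<^bsub>N\<^esub> y"
    and g: "g \<in> mhom R M N" and h: "h \<in> mhom R M N"
  shows "(\<lambda>x. g x \<oplus>\<^bsub>N\<^esub> h x) \<in> mhom R M N"
proof -
  interpret N: abelian_group N by fact
  have c: "g x \<in> carrier N" "h x \<in> carrier N" if "x \<in> carrier M" for x
    using mhom_closed[OF g] mhom_closed[OF h] that by auto
  show ?thesis
    unfolding mhom_def
    by (auto simp: c assms(2) mhom_add[OF g]
        mhom_add[OF h] mhom_smult[OF g]
        mhom_smult[OF h] N.a_ac)
qed

lemma (in left_module) module_hom_const_zero:
  "(\<lambda>_. \<zero>\<^bsub>M\<^esub>) \<in> mhom R N M"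
  unfolding mhom_def by (auto simp: smult_zero_right)

section \<open>Modules from representations of the monoid\<close>

definition rep_module ::
    "('k, 'c) ring_scheme \<Rightarrow> ('k, 'm, 'd) module_scheme \<Rightarrow> ('a list \<Rightarrow> 'm \<Rightarrow> 'm) \<Rightarrow>
      ('a list \<Rightarrow> 'k, 'm) module" where
  "rep_module k E act = \<lparr>carrier = carrier E, monoid.mult = undefined, one = undefined,
     zero = \<zero>\<^bsub>E\<^esub>, add = add E, smult = (\<lambda>r e. lin_ext k E (\<lambda>w. act w e) r)\<rparr>"

lemma rep_module_simps [simp]:
  "carrier (rep_module k E act) = carrier E" "zero (rep_module k E act) = zero E"
  "add (rep_module k E act) = add E"
  "r \<odot>\<^bsub>rep_module k E act\<^esub> e = lin_ext k E (\<lambda>w. act w e) r"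
  by (simp_all add: rep_module_def)

context free_lrb_algebra
begin

lemma module_hom_kS: "mhom k kS E = mhom k (free_module k (carrier S)) E"
  unfolding monoid_algebra_def by (rule module_hom_basis_algebra)

lemma kS_hom_eqI:
  assumes "left_module k E" "g \<in> mhom k kS E"
    "h \<in> mhom k kS E"
    "\<And>w. w \<in> carrier S \<Longrightarrow> g (lt w) = h (lt w)" "r \<in> carrier kS"
  shows "g r = h r"
  using left_module.module_hom_free_eqI[OF assms(1), of g "carrier S" h r] assms(2-5)
  by (simp only: module_hom_kS kS_carrier)

lemma kS_linearI:
  assumes M: "left_module kS M" and N: "left_module kS N"
    and h: "h \<in> mhom k (res_scalars kS M) (res_scalars kS N)"
    and words: "\<And>w m. \<lbrakk>w \<in> carrier S; m \<in> carrier M\<rbrakk> \<Longrightarrow> h (lt w \<odot>\<^bsub>M\<^esub> m) = lt w \<odot>\<^bsub>N\<^esub> h m"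
  shows "h \<in> mhom kS M N"
proof -
  have c: "h \<in> carrier M \<rightarrow> carrier N" using mhom_closed[OF h] by simp
  have "h (r \<odot>\<^bsub>M\<^esub> m) = r \<odot>\<^bsub>N\<^esub> h m" if r: "r \<in> carrier kS" and m: "m \<in> carrier M" for r m
  proof (rule kS_hom_eqI[OF SB.res_scalars_left_module[OF N] _ _ _ r])
    show "(\<lambda>r. h (r \<odot>\<^bsub>M\<^esub> m)) \<in> mhom k kS (res_scalars kS N)"
      by (rule module_hom_comp[OF SB.act_hom[OF M m] h])
    show "(\<lambda>r. r \<odot>\<^bsub>N\<^esub> h m) \<in> mhom k kS (res_scalars kS N)"
      using c m by (intro SB.act_hom[OF N]) auto
  qed (use words m in auto)
  moreover have "h (x \<oplus>\<^bsub>M\<^esub> y) = h x \<oplus>\<^bsub>N\<^esub> h y" if "x \<in> carrier M" "y \<in> carrier M" for x y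
    using mhom_add[OF h, of x y] that by simp
  ultimately show ?thesis using c unfolding mhom_def by simp
qed

lemma word_smult_word:
  assumes "left_module kS M" "v \<in> carrier S" "w \<in> carrier S" "m \<in> carrier M"
  shows "lt v \<odot>\<^bsub>M\<^esub> (lt w \<odot>\<^bsub>M\<^esub> m) = lt (keep_first (v @ w)) \<odot>\<^bsub>M\<^esub> m"
  using left_module.smult_assoc[OF assms(1) word_closed word_closed assms(4), OF assms(2,3)]
    word_mult[OF assms(2,3)] by simp

lemma Nil_smult:
  assumes "left_module kS M" "m \<in> carrier M"
  shows "lt [] \<odot>\<^bsub>M\<^esub> m = m"
  using left_module.smult_one[OF assms] by (simp add: word_one)

text \<open>Associativity of the linearly extended action is obtained in two stages: first with a
  word on the left and a general element on the right, then by linearity in the left factor.\<close>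

lemma rep_module_left_module:
  assumes E: "left_module k E"
    and hom: "\<And>w. w \<in> carrier S \<Longrightarrow> act w \<in> mhom k E E"
    and mult: "\<And>v w e. \<lbrakk>v \<in> carrier S; w \<in> carrier S; e \<in> carrier E\<rbrakk> \<Longrightarrow>
      act (keep_first (v @ w)) e = act v (act w e)"
    and one: "\<And>e. e \<in> carrier E \<Longrightarrow> act [] e = e"
  shows "left_module kS (rep_module k E act)"
    and "\<And>w e. \<lbrakk>w \<in> carrier S; e \<in> carrier E\<rbrakk> \<Longrightarrow> lt w \<odot>\<^bsub>rep_module k E act\<^esub> e = act w e"
    and "\<And>c e. \<lbrakk>c \<in> carrier k; e \<in> carrier E\<rbrakk> \<Longrightarrow>
      (c \<odot>\<^bsub>kS\<^esub> \<one>\<^bsub>kS\<^esub>) \<odot>\<^bsub>rep_module k E act\<^esub> e = c \<odot>\<^bsub>E\<^esub> e"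
proof -
  interpret E: left_module k E by fact
  let ?l = "\<lambda>e. lin_ext k E (\<lambda>w. act w e)"
  have ac: "act w e \<in> carrier E" if "w \<in> carrier S" "e \<in> carrier E" for w e
    using mhom_closed[OF hom[OF that(1)]] that(2) by auto
  have lh: "?l e \<in> mhom k kS E" if "e \<in> carrier E" for e
    unfolding module_hom_kS using ac[OF _ that] by (intro E.lin_ext_hom) auto
  have lc: "?l e r \<in> carrier E" if "e \<in> carrier E" "r \<in> carrier kS" for e r
    using mhom_closed[OF lh[OF that(1)]] that(2) by auto
  show lw: "lt w \<odot>\<^bsub>rep_module k E act\<^esub> e = act w e" if "w \<in> carrier S" "e \<in> carrier E" for w e
    using E.lin_ext_basis_vec[of "\<lambda>w. act w e" w] ac[OF that] by simp
  then have lw': "?l e (lt w) = act w e" if "w \<in> carrier S" "e \<in> carrier E" for w e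
    using that by simp
  have act_lin: "?l e (lt v \<otimes>\<^bsub>kS\<^esub> r) = act v (?l e r)"
    if v: "v \<in> carrier S" and e: "e \<in> carrier E" and r: "r \<in> carrier kS" for v e r
  proof (rule kS_hom_eqI[OF E _ _ _ r])
    show "(\<lambda>r. ?l e (lt v \<otimes>\<^bsub>kS\<^esub> r)) \<in> mhom k kS E"
      by (rule module_hom_comp[OF SB.mult_right_hom[OF word_closed[OF v]] lh[OF e]])
    show "(\<lambda>r. act v (?l e r)) \<in> mhom k kS E"
      by (rule module_hom_comp[OF lh[OF e] hom[OF v]])
    fix w assume w: "w \<in> carrier S"
    have "keep_first (v @ w) \<in> carrier S" using v w by auto
    then show "?l e (lt v \<otimes>\<^bsub>kS\<^esub> lt w) = act v (?l e (lt w))"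
      using v w e by (simp only: word_mult lw' mult)
  qed
  have assoc: "?l e (r \<otimes>\<^bsub>kS\<^esub> s) = ?l (?l e s) r"
    if e: "e \<in> carrier E" and r: "r \<in> carrier kS" and s: "s \<in> carrier kS" for e r s
  proof (rule kS_hom_eqI[OF E _ _ _ r])
    show "(\<lambda>r. ?l e (r \<otimes>\<^bsub>kS\<^esub> s)) \<in> mhom k kS E"
      by (rule module_hom_comp[OF SB.mult_left_hom[OF s] lh[OF e]])
    show "?l (?l e s) \<in> mhom k kS E" by (rule lh[OF lc[OF e s]])
    fix v assume "v \<in> carrier S"
    then show "?l e (lt v \<otimes>\<^bsub>kS\<^esub> s) = ?l (?l e s) (lt v)"
      using act_lin[OF _ e s] lw' lc[OF e s] by simp
  qed
  have distr: "?l (e \<oplus>\<^bsub>E\<^esub> e') r = ?l e r \<oplus>\<^bsub>E\<^esub> ?l e' r"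
    if e: "e \<in> carrier E" "e' \<in> carrier E" and r: "r \<in> carrier kS" for e e' r
  proof (rule kS_hom_eqI[OF E _ _ _ r])
    show "?l (e \<oplus>\<^bsub>E\<^esub> e') \<in> mhom k kS E" by (rule lh) (simp add: e)
    show "(\<lambda>r. ?l e r \<oplus>\<^bsub>E\<^esub> ?l e' r) \<in> mhom k kS E"
      by (rule module_hom_sum[OF E.M.abelian_group_axioms E.smult_r_distr lh[OF e(1)] lh[OF e(2)]])
    fix w assume w: "w \<in> carrier S"
    show "?l (e \<oplus>\<^bsub>E\<^esub> e') (lt w) = ?l e (lt w) \<oplus>\<^bsub>E\<^esub> ?l e' (lt w)"
      using lw'[OF w] e mhom_add[OF hom[OF w]] by simp
  qed
  have "[] \<in> carrier S" by simp
  then have l1: "?l e \<one>\<^bsub>kS\<^esub> = e" if "e \<in> carrier E" for e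
    using lw'[of "[]" e] that one by (simp add: word_one)
  then show "(c \<odot>\<^bsub>kS\<^esub> \<one>\<^bsub>kS\<^esub>) \<odot>\<^bsub>rep_module k E act\<^esub> e = c \<odot>\<^bsub>E\<^esub> e"
    if "c \<in> carrier k" "e \<in> carrier E" for c e
    using mhom_smult[OF lh[OF that(2)] that(1) SB.B.one_closed] that by simp
  have "abelian_group (rep_module k E act)"
    by (rule abelian_group_cong[OF E.M.abelian_group_axioms]) simp_all
  then show "left_module kS (rep_module k E act)"
    by (intro left_module.intro left_module_axioms.intro SB.ring_B)
      (simp_all add: lc distr assoc l1 mhom_add[OF lh])
qed

text \<open>The modules M_X of the overview, up to isomorphism and on an arbitrary type of
  elements.\<close>

definition char_module :: "'a set \<Rightarrow> ('a list \<Rightarrow> 'k, 'm, 'd) module_scheme \<Rightarrow> bool" where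
  "char_module X M \<longleftrightarrow> left_module kS M \<and>
    (\<exists>m\<in>carrier M. m \<noteq> \<zero>\<^bsub>M\<^esub> \<and> carrier M = {(c \<odot>\<^bsub>kS\<^esub> \<one>\<^bsub>kS\<^esub>) \<odot>\<^bsub>M\<^esub> m | c. c \<in> carrier k}) \<and>
    (\<forall>w\<in>carrier S. \<forall>m\<in>carrier M. lt w \<odot>\<^bsub>M\<^esub> m = (if set w \<subseteq> X then m else \<zero>\<^bsub>M\<^esub>))"

lemma char_module_exists:
  "\<exists>M :: ('a list \<Rightarrow> 'k, 'a list \<Rightarrow> 'k) module. char_module X M"
proof -
  \<comment> \<open>The functions supported at the empty word form a one-dimensional space on the
    element type of \<open>kS\<close>, the type on which \<open>simple_classes\<close> collects its
    modules.\<close>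
  let ?E = "free_module k {[] :: 'a list}"
  let ?act = "\<lambda>w e. if set w \<subseteq> X then e else \<zero>\<^bsub>?E\<^esub>"
  interpret E: left_module k ?E by (rule free_module_left_module[OF K.ring_axioms])
  have id: "(\<lambda>e. e) \<in> mhom k ?E ?E"
    unfolding mhom_def by auto
  have hom: "?act w \<in> mhom k ?E ?E" for w
    using id E.module_hom_const_zero[of ?E] by (cases "set w \<subseteq> X") simp_all
  have mult: "?act (keep_first (v @ w)) e = ?act v (?act w e)" for v w e by auto
  note rep = rep_module_left_module[OF E.left_module_axioms, of ?act, OF hom mult]
  let ?b = "basis_vec k ([] :: 'a list)"
  have b: "?b \<in> carrier ?E" by (rule basis_vec_closed[OF K.ring_axioms]) simp
  have "?b [] \<noteq> \<zero>\<^bsub>k\<^esub>" by (simp add: basis_vec_def)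
  then have b0: "?b \<noteq> \<zero>\<^bsub>?E\<^esub>" by auto
  have "e = e [] \<odot>\<^bsub>?E\<^esub> ?b \<and> e [] \<in> carrier k" if "e \<in> carrier ?E" for e
    using that by (auto simp: free_module_carrier_iff basis_vec_def fun_eq_iff)
  then have gen: "carrier ?E = {c \<odot>\<^bsub>?E\<^esub> ?b | c. c \<in> carrier k}"
    using E.smult_closed[OF _ b] by blast
  have gen': "carrier ?E = {(c \<odot>\<^bsub>kS\<^esub> \<one>\<^bsub>kS\<^esub>) \<odot>\<^bsub>rep_module k ?E ?act\<^esub> ?b | c. c \<in> carrier k}"
  proof -
    have eq: "c \<in> carrier k \<Longrightarrow>
        (c \<odot>\<^bsub>kS\<^esub> \<one>\<^bsub>kS\<^esub>) \<odot>\<^bsub>rep_module k ?E ?act\<^esub> ?b = c \<odot>\<^bsub>?E\<^esub> ?b" for c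
      using b by (intro rep(3)) auto
    have "{c \<odot>\<^bsub>?E\<^esub> ?b | c. c \<in> carrier k} =
        {(c \<odot>\<^bsub>kS\<^esub> \<one>\<^bsub>kS\<^esub>) \<odot>\<^bsub>rep_module k ?E ?act\<^esub> ?b | c. c \<in> carrier k}"
      by (intro Collect_cong iffI; elim exE conjE) (metis eq)+
    then show ?thesis by (simp only: gen)
  qed
  have "char_module X (rep_module k ?E ?act)"
    unfolding char_module_def
  proof (intro conjI ballI)
    show "left_module kS (rep_module k ?E ?act)" by (rule rep(1)) auto
    show "\<exists>m\<in>carrier (rep_module k ?E ?act). m \<noteq> \<zero>\<^bsub>rep_module k ?E ?act\<^esub> \<and>
      carrier (rep_module k ?E ?act) = {(c \<odot>\<^bsub>kS\<^esub> \<one>\<^bsub>kS\<^esub>) \<odot>\<^bsub>rep_module k ?E ?act\<^esub> m |c. c \<in> carrier k}"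
      unfolding rep_module_simps(1,2) using b b0 gen' by blast
    fix w m assume "w \<in> carrier S" "m \<in> carrier (rep_module k ?E ?act)"
    then show "lt w \<odot>\<^bsub>rep_module k ?E ?act\<^esub> m = (if set w \<subseteq> X then m else \<zero>\<^bsub>rep_module k ?E ?act\<^esub>)"
      using rep(2)[of w m] by (simp del: rep_module_simps(4))
  qed
  then show ?thesis by blast
qed

end

lemma res_scalars_minus: "\<ominus>\<^bsub>res_scalars B M\<^esub> x = \<ominus>\<^bsub>M\<^esub> x"
  by (simp add: a_inv_def m_inv_def)

section \<open>Coordinates in a one-dimensional module\<close>

locale char_mod = free_lrb_algebra k A for k :: "('k, 'c) ring_scheme" and A :: "'a set" +
  fixes X :: "'a set" and M :: "('a list \<Rightarrow> 'k, 'm, 'd) module_scheme" and gen :: 'm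
  assumes left_module_M: "left_module kS M" and gen_closed: "gen \<in> carrier M"
    and gen_nonzero: "gen \<noteq> \<zero>\<^bsub>M\<^esub>"
    and carrier_M: "carrier M = {(c \<odot>\<^bsub>kS\<^esub> \<one>\<^bsub>kS\<^esub>) \<odot>\<^bsub>M\<^esub> gen | c. c \<in> carrier k}"
    and word_smult: "\<lbrakk>w \<in> carrier S; m \<in> carrier M\<rbrakk> \<Longrightarrow>
      lt w \<odot>\<^bsub>M\<^esub> m = (if set w \<subseteq> X then m else \<zero>\<^bsub>M\<^esub>)"
begin

sublocale M: left_module kS M by (rule left_module_M)

abbreviation "Mk \<equiv> res_scalars kS M"

sublocale Mk: left_module k Mk by (rule SB.res_scalars_left_module[OF left_module_M])

definition coord :: "'m \<Rightarrow> 'k" where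
  "coord m = (THE c. c \<in> carrier k \<and> c \<odot>\<^bsub>Mk\<^esub> gen = m)"

lemma scalar_inverse:
  assumes "c \<in> carrier k" "c \<noteq> \<zero>\<^bsub>k\<^esub>" "m \<in> carrier M"
  shows "(inv\<^bsub>k\<^esub> c) \<odot>\<^bsub>Mk\<^esub> (c \<odot>\<^bsub>Mk\<^esub> m) = m"
proof -
  have c: "c \<in> Units k" using assms K.field_Units by auto
  have "(inv\<^bsub>k\<^esub> c) \<odot>\<^bsub>Mk\<^esub> (c \<odot>\<^bsub>Mk\<^esub> m) = (inv\<^bsub>k\<^esub> c \<otimes>\<^bsub>k\<^esub> c) \<odot>\<^bsub>Mk\<^esub> m"
    using c assms Mk.smult_assoc[of "inv\<^bsub>k\<^esub> c" c m] by (simp del: res_scalars_simps(4))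
  also have "\<dots> = m" using c assms Mk.smult_one[of m] by (simp del: res_scalars_simps(4))
  finally show ?thesis .
qed

lemma scalar_gen_zero:
  assumes "c \<in> carrier k" "c \<odot>\<^bsub>Mk\<^esub> gen = \<zero>\<^bsub>M\<^esub>"
  shows "c = \<zero>\<^bsub>k\<^esub>"
proof (rule ccontr)
  assume "c \<noteq> \<zero>\<^bsub>k\<^esub>"
  moreover have "c \<in> Units k" using assms(1) calculation K.field_Units by auto
  ultimately have "gen = \<zero>\<^bsub>M\<^esub>"
    using scalar_inverse[OF assms(1) _ gen_closed] assms(2) Mk.smult_zero_right[of "inv\<^bsub>k\<^esub> c"]
    by (simp del: res_scalars_simps(4))
  then show False using gen_nonzero by simp
qed

lemma scalar_gen_inj:
  assumes "c \<in> carrier k" "d \<in> carrier k" "c \<odot>\<^bsub>Mk\<^esub> gen = d \<odot>\<^bsub>Mk\<^esub> gen"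
  shows "c = d"
proof -
  have cl: "c \<odot>\<^bsub>Mk\<^esub> gen \<in> carrier M" "d \<odot>\<^bsub>Mk\<^esub> gen \<in> carrier M"
    using Mk.smult_closed gen_closed assms by (simp_all del: res_scalars_simps(4))
  have "(c \<ominus>\<^bsub>k\<^esub> d) \<odot>\<^bsub>Mk\<^esub> gen = c \<odot>\<^bsub>Mk\<^esub> gen \<oplus>\<^bsub>M\<^esub> (\<ominus>\<^bsub>k\<^esub> d) \<odot>\<^bsub>Mk\<^esub> gen"
    using Mk.smult_l_distr[of c "\<ominus>\<^bsub>k\<^esub> d" gen] assms gen_closed
    by (simp add: K.minus_eq del: res_scalars_simps(4))
  also have "\<dots> = d \<odot>\<^bsub>Mk\<^esub> gen \<oplus>\<^bsub>Mk\<^esub> \<ominus>\<^bsub>Mk\<^esub> (d \<odot>\<^bsub>Mk\<^esub> gen)"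
    using Mk.smult_minus_left[of d gen] assms gen_closed by (simp del: res_scalars_simps(4))
  also have "\<dots> = \<zero>\<^bsub>M\<^esub>" using Mk.M.r_neg[of "d \<odot>\<^bsub>Mk\<^esub> gen"] cl by (simp del: res_scalars_simps(4))
  finally have "c \<ominus>\<^bsub>k\<^esub> d = \<zero>\<^bsub>k\<^esub>" using scalar_gen_zero assms by simp
  then show ?thesis using assms by simp
qed

lemma coord_scalar: "c \<in> carrier k \<Longrightarrow> coord (c \<odot>\<^bsub>Mk\<^esub> gen) = c"
  unfolding coord_def using scalar_gen_inj by (intro the_equality) blast+

lemma coord:
  assumes "m \<in> carrier M"
  shows "coord m \<in> carrier k" "coord m \<odot>\<^bsub>Mk\<^esub> gen = m"
proof -
  obtain c where "c \<in> carrier k" "m = c \<odot>\<^bsub>Mk\<^esub> gen"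
    using assms carrier_M by auto
  then show "coord m \<in> carrier k" "coord m \<odot>\<^bsub>Mk\<^esub> gen = m" using coord_scalar by auto
qed

lemma coord_eqI: "\<lbrakk>c \<in> carrier k; c \<odot>\<^bsub>Mk\<^esub> gen = m\<rbrakk> \<Longrightarrow> coord m = c"
  using coord_scalar by blast

lemma coord_gen: "coord gen = \<one>\<^bsub>k\<^esub>"
  using Mk.smult_one[of gen] gen_closed by (intro coord_eqI) (simp_all del: res_scalars_simps(4))

lemma coord_zero: "coord \<zero>\<^bsub>M\<^esub> = \<zero>\<^bsub>k\<^esub>"
  using Mk.smult_zero_left[of gen] gen_closed by (intro coord_eqI) (simp_all del: res_scalars_simps(4))

lemma coord_add: "\<lbrakk>m \<in> carrier M; n \<in> carrier M\<rbrakk> \<Longrightarrow> coord (m \<oplus>\<^bsub>M\<^esub> n) = coord m \<oplus>\<^bsub>k\<^esub> coord n"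
  using Mk.smult_l_distr[of "coord m" "coord n" gen] coord[of m] coord[of n] gen_closed
  by (intro coord_eqI) (simp_all del: res_scalars_simps(4))

lemma coord_smult: "\<lbrakk>c \<in> carrier k; m \<in> carrier M\<rbrakk> \<Longrightarrow> coord (c \<odot>\<^bsub>Mk\<^esub> m) = c \<otimes>\<^bsub>k\<^esub> coord m"
  using Mk.smult_assoc[of c "coord m" gen] coord[of m] gen_closed
  by (intro coord_eqI) (simp_all del: res_scalars_simps(4))

lemma simple: "simple_module kS M"
  unfolding simple_module_def
proof (intro conjI allI impI)
  show "left_module kS M" by (rule left_module_M)
  show "carrier M \<noteq> {\<zero>\<^bsub>M\<^esub>}" using gen_closed gen_nonzero by auto
  fix U assume U: "Module.submodule U kS M"
  interpret U: Module.submodule U kS M by (rule U)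
  have zU: "\<zero>\<^bsub>M\<^esub> \<in> U" using U.one_closed by simp
  have sub: "U \<subseteq> carrier M" using U.subset by simp
  have sc: "c \<odot>\<^bsub>Mk\<^esub> m \<in> U" if "c \<in> carrier k" "m \<in> U" for c m
    using U.smult_closed[OF SB.scalar_closed[OF that(1)] that(2)] by simp
  show "U = {\<zero>\<^bsub>M\<^esub>} \<or> U = carrier M"
  proof (cases "U \<subseteq> {\<zero>\<^bsub>M\<^esub>}")
    case True
    then show ?thesis using zU by auto
  next
    case False
    then obtain m where m: "m \<in> U" "m \<noteq> \<zero>\<^bsub>M\<^esub>" by auto
    have mM: "m \<in> carrier M" using m sub by auto
    note c = coord[OF mM]
    \<comment> \<open>A nonzero element of the submodule has an invertible coordinate, and dividing
      by it puts the generator into the submodule.\<close>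
    have "coord m \<noteq> \<zero>\<^bsub>k\<^esub>" using c m Mk.smult_zero_left[of gen] gen_closed by auto
    then have "gen = (inv\<^bsub>k\<^esub> (coord m)) \<odot>\<^bsub>Mk\<^esub> m" "inv\<^bsub>k\<^esub> (coord m) \<in> carrier k"
      using scalar_inverse[OF c(1) _ gen_closed] c K.field_Units by auto
    then have "gen \<in> U" using sc m by metis
    then have "x \<in> U" if "x \<in> carrier M" for x
      using coord[OF that] sc[of "coord x" gen] by simp
    then show ?thesis using sub by auto
  qed
qed

lemma char_module: "char_module X M"
  unfolding char_module_def
  using left_module_M gen_closed gen_nonzero carrier_M word_smult by blast

end

section \<open>Classification of the simple modules\<close>

context free_lrb_algebra
begin

lemma char_moduleE:
  assumes "char_module X M"
  obtains g where "char_mod k A X M g"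
proof -
  obtain g where g: "left_module kS M" "g \<in> carrier M" "g \<noteq> \<zero>\<^bsub>M\<^esub>"
      "carrier M = {(c \<odot>\<^bsub>kS\<^esub> \<one>\<^bsub>kS\<^esub>) \<odot>\<^bsub>M\<^esub> g | c. c \<in> carrier k}"
    and w: "\<forall>w\<in>carrier S. \<forall>m\<in>carrier M. lt w \<odot>\<^bsub>M\<^esub> m = (if set w \<subseteq> X then m else \<zero>\<^bsub>M\<^esub>)"
  proof -
    note c = assms[unfolded char_module_def]
    from c[THEN conjunct2, THEN conjunct1] obtain g where "g \<in> carrier M" "g \<noteq> \<zero>\<^bsub>M\<^esub> \<and>
        carrier M = {(c \<odot>\<^bsub>kS\<^esub> \<one>\<^bsub>kS\<^esub>) \<odot>\<^bsub>M\<^esub> g | c. c \<in> carrier k}" by (rule bexE)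
    then show ?thesis
      using that[OF c[THEN conjunct1] _ _ _ c[THEN conjunct2, THEN conjunct2]] by (elim conjE)
  qed
  have "char_mod k A X M g"
    by (intro char_mod.intro char_mod_axioms.intro free_lrb_algebra_axioms g)
      (rule w[rule_format])
  then show thesis by (rule that)
qed

lemma char_module_simple: "char_module X M \<Longrightarrow> simple_module kS M"
  by (erule char_moduleE) (rule char_mod.simple)

text \<open>\<open>X\<close> is the set of letters of a largest word that acts nontrivially. After a
  word v with letter set \<open>X\<close>, a word inside \<open>X\<close> is absorbed, and any other
  word enlarges the letter set and so gives zero. Hence the elements annihilated by all such v form
  a proper submodule, which is zero by simplicity, and every word is forced to act as 0 or
  1.\<close>

lemma simple_char_module:
  assumes fin: "finite A" and sM: "simple_module kS M"
  shows "\<exists>X. X \<subseteq> A \<and> char_module X M"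
proof -
  have M: "left_module kS M" and nz: "carrier M \<noteq> {\<zero>\<^bsub>M\<^esub>}"
    and sub: "\<And>U. Module.submodule U kS M \<Longrightarrow> U = {\<zero>\<^bsub>M\<^esub>} \<or> U = carrier M"
    using sM unfolding simple_module_def by auto
  interpret M: left_module kS M by (rule M)
  let ?Mk = "res_scalars kS M"
  interpret Mk: left_module k ?Mk by (rule SB.res_scalars_left_module[OF M])
  \<comment> \<open>The possible sizes of nontrivially acting words; \<open>P 0\<close> holds by the
    empty word, and finiteness of \<open>A\<close> bounds them.\<close>
  define P where "P n \<longleftrightarrow> (\<exists>w\<in>carrier S. card (set w) = n \<and> (\<exists>m\<in>carrier M. lt w \<odot>\<^bsub>M\<^esub> m \<noteq> \<zero>\<^bsub>M\<^esub>))" for n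
  obtain m1 where m1: "m1 \<in> carrier M" "m1 \<noteq> \<zero>\<^bsub>M\<^esub>" using nz M.M.zero_closed by blast
  have "P 0" unfolding P_def
    using m1 Nil_smult[OF M m1(1)] by (intro bexI[of _ "[]"] conjI bexI[of _ m1]) auto
  moreover have "n \<le> card A" if "P n" for n
    using that fin unfolding P_def by (auto intro: card_mono)
  ultimately obtain n where n: "P n" "\<And>n'. P n' \<Longrightarrow> n' \<le> n"
    using GreatestI_nat[of P 0 "card A"] Greatest_le_nat[of P _ "card A"] by blast
  obtain w0 m0 where w0: "w0 \<in> carrier S" "card (set w0) = n" "m0 \<in> carrier M" "lt w0 \<odot>\<^bsub>M\<^esub> m0 \<noteq> \<zero>\<^bsub>M\<^esub>"
    using n(1) unfolding P_def by auto
  define X where "X = set w0"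
  have XA: "X \<subseteq> A" using w0 by (auto simp: X_def)
  have big: "lt v \<odot>\<^bsub>M\<^esub> m = \<zero>\<^bsub>M\<^esub>" if "v \<in> carrier S" "X \<subset> set v" "m \<in> carrier M" for v m
  proof (rule ccontr)
    assume "lt v \<odot>\<^bsub>M\<^esub> m \<noteq> \<zero>\<^bsub>M\<^esub>"
    then have "P (card (set v))" unfolding P_def using that by blast
    then have "card (set v) \<le> card X" using n(2) w0(2) by (simp add: X_def)
    moreover have "card X < card (set v)" using that(2) by (intro psubset_card_mono) auto
    ultimately show False by simp
  qed
  \<comment> \<open>The common annihilator of all arrangements of \<open>X\<close>, not only of
    \<open>w0\<close>. It is not everything, because \<open>w0\<close> acts nontrivially, and
    \<open>vw\<close> makes it stable under words.\<close>
  define U where "U = {m \<in> carrier M. \<forall>v\<in>carrier S. set v = X \<longrightarrow> lt v \<odot>\<^bsub>M\<^esub> m = \<zero>\<^bsub>M\<^esub>}"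
  have vw: "lt v \<odot>\<^bsub>M\<^esub> (lt w \<odot>\<^bsub>M\<^esub> m) = (if set w \<subseteq> X then lt v \<odot>\<^bsub>M\<^esub> m else \<zero>\<^bsub>M\<^esub>)"
    if "v \<in> carrier S" "set v = X" "w \<in> carrier S" "m \<in> carrier M" for v w m
  proof -
    have 1: "lt v \<odot>\<^bsub>M\<^esub> (lt w \<odot>\<^bsub>M\<^esub> m) = lt (keep_first (v @ w)) \<odot>\<^bsub>M\<^esub> m"
      by (rule word_smult_word[OF M that(1,3,4)])
    show ?thesis
    proof (cases "set w \<subseteq> X")
      case True
      then have "filter (\<lambda>y. y \<notin> set v) (keep_first w) = []"
        using that(2) by (auto simp: filter_empty_conv)
      then have "keep_first (v @ w) = v" using that(1) by (simp add: keep_first_append keep_first_distinct)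
      then show ?thesis using 1 True by simp
    next
      case False
      then have "X \<subset> set (keep_first (v @ w))" using that(2) by auto
      moreover have "keep_first (v @ w) \<in> carrier S" using that by auto
      ultimately show ?thesis using 1 False big that(4) by simp
    qed
  qed
  have "Module.submodule U kS M"
  proof (intro Module.submodule.intro submodule_axioms.intro subgroup.intro)
    show "U \<subseteq> carrier (add_monoid M)" by (auto simp: U_def)
    show "\<one>\<^bsub>add_monoid M\<^esub> \<in> U" by (auto simp: U_def intro!: M.smult_zero_right word_closed)
  next
    fix x y assume xy: "x \<in> U" "y \<in> U"
    then show "x \<otimes>\<^bsub>add_monoid M\<^esub> y \<in> U"
      by (simp add: U_def M.smult_r_distr word_closed del: free_lrb_simps)
    have "\<ominus>\<^bsub>M\<^esub> x \<in> U"
      using xy by (simp add: U_def M.smult_minus_right word_closed del: free_lrb_simps)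
    then show "inv\<^bsub>add_monoid M\<^esub> x \<in> U" by (simp add: a_inv_def)
  next
    fix r m assume r: "r \<in> carrier kS" and m: "m \<in> U"
    have mM: "m \<in> carrier M" using m by (simp add: U_def)
    have "lt v \<odot>\<^bsub>M\<^esub> (r \<odot>\<^bsub>M\<^esub> m) = \<zero>\<^bsub>M\<^esub>" if v: "v \<in> carrier S" "set v = X" for v
    proof (rule kS_hom_eqI[OF Mk.left_module_axioms _ _ _ r])
      show "(\<lambda>r. lt v \<odot>\<^bsub>M\<^esub> (r \<odot>\<^bsub>M\<^esub> m)) \<in> mhom k kS ?Mk"
        by (rule module_hom_comp[OF SB.act_hom[OF M mM] SB.smult_hom[OF M word_closed[OF v(1)]]])
      show "(\<lambda>_. \<zero>\<^bsub>M\<^esub>) \<in> mhom k kS ?Mk"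
        using Mk.module_hom_const_zero by simp
      show "lt v \<odot>\<^bsub>M\<^esub> (lt w \<odot>\<^bsub>M\<^esub> m) = \<zero>\<^bsub>M\<^esub>" if "w \<in> carrier S" for w
        using vw[OF v that mM] m v by (simp add: U_def)
    qed
    then show "r \<odot>\<^bsub>M\<^esub> m \<in> U" using r mM by (auto simp: U_def M.smult_closed)
  qed
  then have "U = {\<zero>\<^bsub>M\<^esub>} \<or> U = carrier M" by (rule sub)
  moreover have "U \<noteq> carrier M" using w0 by (auto simp: U_def X_def)
  ultimately have U0: "U = {\<zero>\<^bsub>M\<^esub>}" by simp
  have word: "lt w \<odot>\<^bsub>M\<^esub> m = (if set w \<subseteq> X then m else \<zero>\<^bsub>M\<^esub>)"
    if w: "w \<in> carrier S" and m: "m \<in> carrier M" for w m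
  proof (cases "set w \<subseteq> X")
    case True
    have wm: "lt w \<odot>\<^bsub>M\<^esub> m \<in> carrier M" using word_closed[OF w] m by (rule M.smult_closed)
    \<comment> \<open>The words with letter set \<open>X\<close> do not distinguish w m from m, so
      the difference lies in \<open>U\<close>, which is zero.\<close>
    have "lt w \<odot>\<^bsub>M\<^esub> m \<ominus>\<^bsub>M\<^esub> m \<in> U"
      unfolding U_def
    proof (intro CollectI conjI ballI impI)
      fix v assume v: "v \<in> carrier S" "set v = X"
      note c = word_closed[OF v(1)]
      have "lt v \<odot>\<^bsub>M\<^esub> (lt w \<odot>\<^bsub>M\<^esub> m \<ominus>\<^bsub>M\<^esub> m) = lt v \<odot>\<^bsub>M\<^esub> (lt w \<odot>\<^bsub>M\<^esub> m) \<oplus>\<^bsub>M\<^esub> \<ominus>\<^bsub>M\<^esub> (lt v \<odot>\<^bsub>M\<^esub> m)"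
        using c wm m by (simp add: M.M.minus_eq M.smult_r_distr M.smult_minus_right)
      also have "\<dots> = \<zero>\<^bsub>M\<^esub>" using vw[OF v w m] True c m by (simp add: M.M.r_neg M.smult_closed)
      finally show "lt v \<odot>\<^bsub>M\<^esub> (lt w \<odot>\<^bsub>M\<^esub> m \<ominus>\<^bsub>M\<^esub> m) = \<zero>\<^bsub>M\<^esub>" .
    qed (use wm m in simp)
    then have "lt w \<odot>\<^bsub>M\<^esub> m \<ominus>\<^bsub>M\<^esub> m = \<zero>\<^bsub>M\<^esub>" using U0 by simp
    then show ?thesis using True wm m by simp
  next
    case False
    have "lt w \<odot>\<^bsub>M\<^esub> m \<in> U"
      using vw[OF _ _ w m] False word_closed[OF w] m by (auto simp: U_def M.smult_closed)
    then show ?thesis using U0 False by simp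
  qed
  have gen: "carrier M = {(c \<odot>\<^bsub>kS\<^esub> \<one>\<^bsub>kS\<^esub>) \<odot>\<^bsub>M\<^esub> m1 | c. c \<in> carrier k}"
  proof -
    \<comment> \<open>Since every word acts as a scalar, the line through \<open>m1\<close> is a
      submodule, hence all of \<open>M\<close>.\<close>
    define V where "V = {c \<odot>\<^bsub>?Mk\<^esub> m1 | c. c \<in> carrier k}"
    have VM: "V \<subseteq> carrier M" using Mk.smult_closed m1(1) by (auto simp: V_def)
    have zV: "\<zero>\<^bsub>M\<^esub> \<in> V" using Mk.smult_zero_left[of m1] m1(1) unfolding V_def by force
    have m1V: "m1 \<in> V" using Mk.smult_one[of m1] m1(1) unfolding V_def by force
    have addV: "x \<oplus>\<^bsub>M\<^esub> y \<in> V" if x: "x \<in> V" and y: "y \<in> V" for x y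
    proof -
      obtain c d where "c \<in> carrier k" "x = c \<odot>\<^bsub>?Mk\<^esub> m1" "d \<in> carrier k" "y = d \<odot>\<^bsub>?Mk\<^esub> m1"
        using x y unfolding V_def by auto
      then have "c \<oplus>\<^bsub>k\<^esub> d \<in> carrier k" "x \<oplus>\<^bsub>M\<^esub> y = (c \<oplus>\<^bsub>k\<^esub> d) \<odot>\<^bsub>?Mk\<^esub> m1"
        using Mk.smult_l_distr[of c d m1] m1(1) by simp_all
      then show ?thesis unfolding V_def by blast
    qed
    have sc: "c \<odot>\<^bsub>?Mk\<^esub> x \<in> V" if c: "c \<in> carrier k" and x: "x \<in> V" for c x
    proof -
      obtain d where "d \<in> carrier k" "x = d \<odot>\<^bsub>?Mk\<^esub> m1" using x unfolding V_def by auto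
      then have "c \<otimes>\<^bsub>k\<^esub> d \<in> carrier k" "c \<odot>\<^bsub>?Mk\<^esub> x = (c \<otimes>\<^bsub>k\<^esub> d) \<odot>\<^bsub>?Mk\<^esub> m1"
        using Mk.smult_assoc[of c d m1] m1(1) c by simp_all
      then show ?thesis unfolding V_def by blast
    qed
    have "Module.submodule V kS M"
    proof (intro Module.submodule.intro submodule_axioms.intro subgroup.intro)
      show "V \<subseteq> carrier (add_monoid M)" using VM by simp
      show "\<one>\<^bsub>add_monoid M\<^esub> \<in> V" using zV by simp
    next
      fix x y assume xy: "x \<in> V" "y \<in> V"
      then show "x \<otimes>\<^bsub>add_monoid M\<^esub> y \<in> V" using addV by simp
      have "\<ominus>\<^bsub>M\<^esub> x = (\<ominus>\<^bsub>k\<^esub> \<one>\<^bsub>k\<^esub>) \<odot>\<^bsub>?Mk\<^esub> x"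
        using Mk.smult_minus_left[of "\<one>\<^bsub>k\<^esub>" x] Mk.smult_one[of x] xy VM
        by (auto simp: res_scalars_minus)
      then have "\<ominus>\<^bsub>M\<^esub> x \<in> V" using sc[of "\<ominus>\<^bsub>k\<^esub> \<one>\<^bsub>k\<^esub>" x] xy by simp
      then show "inv\<^bsub>add_monoid M\<^esub> x \<in> V" by (simp add: a_inv_def)
    next
      fix r m assume r: "r \<in> carrier kS" and m: "m \<in> V"
      have "r \<in> carrier (free_module k (carrier S))" using r by (simp only: kS_carrier)
      with K.ring_axioms show "r \<odot>\<^bsub>M\<^esub> m \<in> V"
      proof (induction rule: free_module_induct)
        case zero
        have "\<zero>\<^bsub>kS\<^esub> = (\<lambda>_. \<zero>\<^bsub>k\<^esub>)" by (simp add: monoid_algebra_def)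
        then show ?case using M.smult_zero_left[of m] m VM zV by auto
      next
        case (add f g)
        have "f \<oplus>\<^bsub>kS\<^esub> g = (\<lambda>x. f x \<oplus>\<^bsub>k\<^esub> g x)" by (simp add: monoid_algebra_def)
        then show ?case using M.smult_l_distr[of f g m] add addV m VM kS_carrier by auto
      next
        case (basis c w)
        have "c \<odot>\<^bsub>kS\<^esub> lt w = (\<lambda>x. c \<otimes>\<^bsub>k\<^esub> lt w x)" by (simp add: monoid_algebra_def)
        moreover have "lt w \<odot>\<^bsub>M\<^esub> m \<in> V" using word[OF basis(2)] m VM zV by auto
        ultimately show ?case
          using SB.scalar_smult(1)[OF M basis(1) word_closed[OF basis(2)], of m] sc[OF basis(1)] m VM by auto
      qed
    qed
    then have "V = {\<zero>\<^bsub>M\<^esub>} \<or> V = carrier M" by (rule sub)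
    then have "V = carrier M" using m1V m1(2) by auto
    then show ?thesis unfolding V_def by simp
  qed
  have "char_module X M"
    unfolding char_module_def using M m1 gen word by blast
  then show ?thesis using XA by blast
qed

text \<open>A letter in exactly one of the two sets acts as the identity on one module and as zero
  on the other, which forces the image of the generator to vanish.\<close>

lemma char_module_hom_inj:
  assumes M: "char_module X M" and N: "char_module Y N" and XY: "X \<subseteq> A" "Y \<subseteq> A"
    and h: "h \<in> mhom kS M N" "inj_on h (carrier M)"
  shows "X = Y"
proof (rule ccontr)
  assume "X \<noteq> Y"
  obtain g where "char_mod k A X M g" by (rule char_moduleE[OF M])
  then interpret M: char_mod k A X M g .
  obtain g' where "char_mod k A Y N g'" by (rule char_moduleE[OF N])
  then interpret N: char_mod k A Y N g' .
  have hz: "h \<zero>\<^bsub>M\<^esub> = \<zero>\<^bsub>N\<^esub>"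
    by (rule module_hom_zero[OF M.M.M.abelian_group_axioms N.M.M.abelian_group_axioms h(1)])
  have hg: "h g \<in> carrier N" using mhom_closed[OF h(1)] M.gen_closed by auto
  obtain a where a: "a \<in> A" "(a \<in> X) \<noteq> (a \<in> Y)" using \<open>X \<noteq> Y\<close> XY by auto
  then have w: "[a] \<in> carrier S" by simp
  have "h (lt [a] \<odot>\<^bsub>M\<^esub> g) = lt [a] \<odot>\<^bsub>N\<^esub> h g"
    by (rule mhom_smult[OF h(1) word_closed[OF w] M.gen_closed])
  then have "h g = \<zero>\<^bsub>N\<^esub>"
    using M.word_smult[OF w M.gen_closed] N.word_smult[OF w hg] a(2) hz by (auto split: if_splits)
  then have "g = \<zero>\<^bsub>M\<^esub>" using h(2) hz M.gen_closed M.M.M.zero_closed by (metis inj_onD)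
  then show False using M.gen_nonzero by simp
qed

lemma char_module_isomorphic:
  assumes M: "char_module X M" and N: "char_module X N"
  shows "module_isomorphic kS M N"
proof -
  obtain g where "char_mod k A X M g" by (rule char_moduleE[OF M])
  then interpret M: char_mod k A X M g .
  obtain g' where "char_mod k A X N g'" by (rule char_moduleE[OF N])
  then interpret N: char_mod k A X N g' .
  define h where "h m = M.coord m \<odot>\<^bsub>N.Mk\<^esub> g'" for m
  have c: "h m \<in> carrier N" if "m \<in> carrier M" for m
    unfolding h_def using N.Mk.smult_closed[OF M.coord(1)[OF that], of g'] N.gen_closed by simp
  have "h \<in> mhom kS M N"
  proof (rule kS_linearI[OF M.left_module_M N.left_module_M])
    show "h \<in> mhom k M.Mk N.Mk"
      unfolding mhom_def
    proof (intro CollectI conjI allI impI funcsetI)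
      fix x assume "x \<in> carrier M.Mk" then show "h x \<in> carrier N.Mk" using c by simp
    next
      fix x y assume "x \<in> carrier M.Mk \<and> y \<in> carrier M.Mk"
      then show "h (x \<oplus>\<^bsub>M.Mk\<^esub> y) = h x \<oplus>\<^bsub>N.Mk\<^esub> h y"
        using N.Mk.smult_l_distr[of "M.coord x" "M.coord y" g'] M.coord(1) N.gen_closed
        by (simp add: h_def M.coord_add del: res_scalars_simps(4))
    next
      fix a x assume "a \<in> carrier k \<and> x \<in> carrier M.Mk"
      then show "h (a \<odot>\<^bsub>M.Mk\<^esub> x) = a \<odot>\<^bsub>N.Mk\<^esub> h x"
        using N.Mk.smult_assoc[of a "M.coord x" g'] M.coord(1) N.gen_closed
        by (simp add: h_def M.coord_smult del: res_scalars_simps(4))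
    qed
    fix w m assume "w \<in> carrier S" "m \<in> carrier M"
    moreover have "h \<zero>\<^bsub>M\<^esub> = \<zero>\<^bsub>N\<^esub>"
      using N.Mk.smult_zero_left[of g'] N.gen_closed by (simp add: h_def M.coord_zero)
    ultimately show "h (lt w \<odot>\<^bsub>M\<^esub> m) = lt w \<odot>\<^bsub>N\<^esub> h m"
      using c by (simp only: M.word_smult N.word_smult split: if_split) simp
  qed
  moreover have "bij_betw h (carrier M) (carrier N)"
  proof (rule bij_betwI[of _ _ _ "\<lambda>n. N.coord n \<odot>\<^bsub>M.Mk\<^esub> g"])
    show "h \<in> carrier M \<rightarrow> carrier N" using c by auto
    show "(\<lambda>n. N.coord n \<odot>\<^bsub>M.Mk\<^esub> g) \<in> carrier N \<rightarrow> carrier M"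
      using M.Mk.smult_closed[OF N.coord(1), of _ g] M.gen_closed by auto
    fix m assume "m \<in> carrier M"
    then show "N.coord (h m) \<odot>\<^bsub>M.Mk\<^esub> g = m"
      using M.coord N.coord_scalar by (simp add: h_def del: res_scalars_simps(4))
  next
    fix n assume "n \<in> carrier N"
    then show "h (N.coord n \<odot>\<^bsub>M.Mk\<^esub> g) = n"
      using N.coord M.coord_scalar by (simp add: h_def del: res_scalars_simps(4))
  qed
  ultimately show ?thesis unfolding module_isomorphic_def by blast
qed

definition char_class :: "'a set \<Rightarrow> ('a list \<Rightarrow> 'k, 'a list \<Rightarrow> 'k) module set" where
  "char_class X = {M. char_module X M}"

lemma module_isomorphic_char_iff:
  assumes "char_module X M" "char_module Y N" "X \<subseteq> A" "Y \<subseteq> A"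
  shows "module_isomorphic kS M N \<longleftrightarrow> X = Y"
proof
  assume "module_isomorphic kS M N"
  then obtain h where "h \<in> mhom kS M N" "bij_betw h (carrier M) (carrier N)"
    unfolding module_isomorphic_def by (elim bexE)
  then show "X = Y" using char_module_hom_inj[OF assms] by (simp add: bij_betw_def)
qed (use char_module_isomorphic[OF assms(1)] assms(2) in simp)

lemma char_class_nonempty: "char_class X \<noteq> {}"
  using char_module_exists by (auto simp: char_class_def)

lemma char_class_inj:
  assumes "X \<subseteq> A" "Y \<subseteq> A" "char_class X = char_class Y"
  shows "X = Y"
proof -
  obtain M where "M \<in> char_class X" using char_class_nonempty by auto
  then have "char_module X M" "char_module Y M" using assms(3) by (auto simp: char_class_def)
  then show ?thesis using module_isomorphic_char_iff assms(1,2) char_module_isomorphic by metis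
qed

lemma simple_classes_eq:
  assumes fin: "finite A"
  shows "simple_classes kS = char_class ` Pow A"
proof -
  let ?r = "{(M :: ('a list \<Rightarrow> 'k, 'a list \<Rightarrow> 'k) module, N). simple_module kS M \<and> simple_module kS N \<and> module_isomorphic kS M N}"
  have cls: "?r `` {M} = char_class X" if "char_module X M" "X \<subseteq> A" for M X
  proof -
    have "N \<in> ?r `` {M} \<longleftrightarrow> char_module X N" for N
    proof
      assume "N \<in> ?r `` {M}"
      then have N: "simple_module kS N" "module_isomorphic kS M N" by auto
      obtain Y where Y: "Y \<subseteq> A" "char_module Y N" using simple_char_module[OF fin N(1)] by auto
      then show "char_module X N" using module_isomorphic_char_iff[OF that(1) Y(2) that(2) Y(1)] N(2) by simp
    next
      assume "char_module X N"
      then show "N \<in> ?r `` {M}"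
        using char_module_simple[of X N] char_module_simple[OF that(1)] char_module_isomorphic[OF that(1)] by simp
    qed
    then show ?thesis unfolding char_class_def by blast
  qed
  show ?thesis
  proof
    show "simple_classes kS \<subseteq> char_class ` Pow A"
    proof
      fix C assume "C \<in> simple_classes kS"
      then obtain M where M: "simple_module kS M" "C = ?r `` {M}"
        unfolding simple_classes_def by (auto elim!: quotientE)
      obtain X where "X \<subseteq> A" "char_module X M" using simple_char_module[OF fin M(1)] by auto
      then show "C \<in> char_class ` Pow A" using cls M(2) by auto
    qed
    show "char_class ` Pow A \<subseteq> simple_classes kS"
    proof
      fix C assume "C \<in> char_class ` Pow A"
      then obtain X where X: "X \<subseteq> A" "C = char_class X" by auto
      obtain M where M: "char_module X (M :: ('a list \<Rightarrow> 'k, 'a list \<Rightarrow> 'k) module)"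
        using char_module_exists by auto
      then have "C = ?r `` {M}" using cls X by simp
      moreover have "?r `` {M} \<in> simple_classes kS"
        unfolding simple_classes_def by (rule quotientI) (simp add: char_module_simple[OF M])
      ultimately show "C \<in> simple_classes kS" by simp
    qed
  qed
qed

end

section \<open>Computing \<open>Ext\<^sup>1\<close>\<close>

lemma left_module_vectorspace:
  assumes "field k" "left_module k V"
  shows "vectorspace k V"
proof -
  interpret K: field k by fact
  interpret left_module k V by fact
  have "Module.module k V"
    by (rule moduleI)
      (auto simp: K.cring_axioms M.abelian_group_axioms smult_closed smult_l_distr smult_r_distr
        smult_assoc smult_one)
  then show ?thesis by (intro vectorspace.intro assms(1))
qed

lemma free_module_basis:
  assumes "field k" "finite I"
  shows "vectorspace.basis k (free_module k I) (basis_vec k ` I)"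
    and "inj_on (basis_vec k) I"
proof -
  interpret K: field k by fact
  let ?F = "free_module k I"
  interpret F: left_module k ?F by (rule free_module_left_module[OF K.ring_axioms])
  interpret V: vectorspace k ?F by (rule left_module_vectorspace[OF assms(1) F.left_module_axioms])
  have bc: "basis_vec k i \<in> carrier ?F" if "i \<in> I" for i
    using basis_vec_closed[OF K.ring_axioms that] .
  show inj: "inj_on (basis_vec k) I"
  proof (rule inj_onI)
    fix i j assume "basis_vec k i = basis_vec k j"
    then have "basis_vec k i i = basis_vec k j i" by simp
    then show "i = j" by (simp add: basis_vec_def split: if_splits)
  qed
  have expand: "f = (\<Oplus>\<^bsub>?F\<^esub>i\<in>I. f i \<odot>\<^bsub>?F\<^esub> basis_vec k i)" if f: "f \<in> carrier ?F" for f
  proof -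
    have id: "(\<lambda>x. x) \<in> mhom k ?F ?F"
      unfolding mhom_def by auto
    have "f = lin_ext k ?F (basis_vec k) f"
      by (rule F.module_hom_free_eqI[OF id F.lin_ext_hom _ f]) (auto simp: bc F.lin_ext_basis_vec)
    also have "\<dots> = (\<Oplus>\<^bsub>?F\<^esub>i\<in>I. f i \<odot>\<^bsub>?F\<^esub> basis_vec k i)"
      by (rule F.lin_ext_superset[OF f]) (use bc assms(2) f in \<open>auto simp: free_module_carrier_iff\<close>)
    finally show ?thesis .
  qed
  have comb: "V.lincomb a (basis_vec k ` I) = f"
    if a: "a \<in> basis_vec k ` I \<rightarrow> carrier k" and f: "f \<in> carrier ?F" and eq: "\<And>i. i \<in> I \<Longrightarrow> a (basis_vec k i) = f i"
    for a f
  proof -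
    have sc: "a v \<odot>\<^bsub>?F\<^esub> v \<in> carrier ?F" if "v \<in> basis_vec k ` I" for v
      using that a bc by (intro F.smult_closed) auto
    have "V.lincomb a (basis_vec k ` I) = (\<Oplus>\<^bsub>?F\<^esub>i\<in>I. a (basis_vec k i) \<odot>\<^bsub>?F\<^esub> basis_vec k i)"
      unfolding V.lincomb_def by (rule F.M.finsum_reindex) (use sc inj in auto)
    also have "\<dots> = (\<Oplus>\<^bsub>?F\<^esub>i\<in>I. f i \<odot>\<^bsub>?F\<^esub> basis_vec k i)"
    proof (rule F.M.finsum_cong')
      show "(\<lambda>i. f i \<odot>\<^bsub>?F\<^esub> basis_vec k i) \<in> I \<rightarrow> carrier ?F"
        using bc f by (intro funcsetI F.smult_closed) (simp_all add: free_module_carrier_iff)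
    qed (simp_all only: eq)
    finally show ?thesis using expand[OF f] by simp
  qed
  have "\<exists>!a. a \<in> basis_vec k ` I \<rightarrow>\<^sub>E carrier k \<and> V.lincomb a (basis_vec k ` I) = f"
    if f: "f \<in> carrier ?F" for f
  proof
    let ?a = "\<lambda>v\<in>basis_vec k ` I. f (the_inv_into I (basis_vec k) v)"
    have ai: "?a (basis_vec k i) = f i" if "i \<in> I" for i
      using that inj by (simp add: the_inv_into_f_f)
    have aE: "?a \<in> basis_vec k ` I \<rightarrow>\<^sub>E carrier k" using f by (auto simp: free_module_carrier_iff)
    then show "?a \<in> basis_vec k ` I \<rightarrow>\<^sub>E carrier k \<and> V.lincomb ?a (basis_vec k ` I) = f"
      using comb[of ?a f] f ai by (auto simp: PiE_def)
    fix a assume a: "a \<in> basis_vec k ` I \<rightarrow>\<^sub>E carrier k \<and> V.lincomb a (basis_vec k ` I) = f"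
    \<comment> \<open>The coefficients of a combination, extended by zero, form an element of the
      free module; expanding it in the basis identifies it with \<open>f\<close>.\<close>
    define f' where "f' i = (if i \<in> I then a (basis_vec k i) else \<zero>\<^bsub>k\<^esub>)" for i
    have "finite {i. f' i \<noteq> \<zero>\<^bsub>k\<^esub>}" by (rule finite_subset[OF _ assms(2)]) (auto simp: f'_def)
    then have "f' \<in> carrier ?F" using a by (auto simp: free_module_carrier_iff f'_def)
    then have "f' = f" using comb[of a f'] a by (auto simp: PiE_def f'_def)
    then have "a (basis_vec k i) = f i" if "i \<in> I" for i using that by (metis f'_def)
    then show "a = ?a" using a aE ai by (intro PiE_ext[of a "basis_vec k ` I" "\<lambda>_. carrier k"]) auto
  qed
  then show "V.basis (basis_vec k ` I)"
    using bc assms(2) by (subst V.basis_criterion) auto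
qed

text \<open>The first isomorphism theorem in coordinates: the cosets of the kernel are the fibres of
  \<Phi>, so they are parametrised linearly by the free module on \<open>I\<close>.\<close>

lemma dim_quotient_module:
  fixes k :: "('k, 'c) ring_scheme" and V :: "('k, 'v, 'd) module_scheme" and I :: "'i set"
  defines "F \<equiv> free_module k I"
  assumes k: "field k" and V: "abelian_group V" and I: "finite I"
    and smult: "\<And>c v. \<lbrakk>c \<in> carrier k; v \<in> carrier V\<rbrakk> \<Longrightarrow> c \<odot>\<^bsub>V\<^esub> v \<in> carrier V"
    and \<Phi>: "\<Phi> \<in> mhom k V F"
    and surj: "\<And>\<phi>. \<phi> \<in> carrier F \<Longrightarrow> \<exists>v\<in>carrier V. \<Phi> v = \<phi>"
    and W: "W = {v \<in> carrier V. \<Phi> v = \<zero>\<^bsub>F\<^esub>}"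
  shows "vectorspace.dim k (quotient_module V W) = card I"
proof -
  interpret K: field k by (rule k)
  interpret V: abelian_group V by (rule V)
  interpret F: left_module k F unfolding F_def by (rule free_module_left_module[OF K.ring_axioms])
  let ?Q = "quotient_module V W"
  \<comment> \<open>The fibre of \<Phi> over \<phi>; as a map on the free module it is the inverse
    of the isomorphism that \<Phi> induces.\<close>
  define U where "U \<phi> = {v \<in> carrier V. \<Phi> v = \<phi>}" for \<phi>
  have \<Phi>c: "\<Phi> v \<in> carrier F" if "v \<in> carrier V" for v
    using mhom_closed[OF \<Phi>] that by auto
  note \<Phi>a = mhom_add[OF \<Phi>] and \<Phi>s = mhom_smult[OF \<Phi>]
  have \<Phi>m: "\<Phi> (\<ominus>\<^bsub>V\<^esub> v) = \<ominus>\<^bsub>F\<^esub> \<Phi> v" if "v \<in> carrier V" for v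
    by (rule additive_minus[OF V F.M.abelian_group_axioms _ _ that]) (use \<Phi>c \<Phi>a in auto)
  have diff: "\<Phi> (v \<ominus>\<^bsub>V\<^esub> w) = \<Phi> v \<ominus>\<^bsub>F\<^esub> \<Phi> w" if "v \<in> carrier V" "w \<in> carrier V" for v w
    using that by (simp add: V.minus_eq F.M.minus_eq \<Phi>a \<Phi>m)
  have cancel: "(v \<ominus>\<^bsub>V\<^esub> w) \<oplus>\<^bsub>V\<^esub> w = v" if "v \<in> carrier V" "w \<in> carrier V" for v w
    using that by (simp add: V.minus_eq V.a_assoc V.l_neg)
  have coset: "W +>\<^bsub>V\<^esub> v = U (\<Phi> v)" if v: "v \<in> carrier V" for v
  proof
    show "W +>\<^bsub>V\<^esub> v \<subseteq> U (\<Phi> v)"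
      using v \<Phi>c by (auto simp: a_r_coset_def' W U_def \<Phi>a)
    show "U (\<Phi> v) \<subseteq> W +>\<^bsub>V\<^esub> v"
    proof
      fix y assume "y \<in> U (\<Phi> v)"
      then have y: "y \<in> carrier V" "\<Phi> y = \<Phi> v" by (auto simp: U_def)
      have "y \<ominus>\<^bsub>V\<^esub> v \<in> W" using y v diff[OF y(1) v] \<Phi>c[OF v] by (simp add: W)
      then show "y \<in> W +>\<^bsub>V\<^esub> v" using cancel[OF y(1) v] unfolding a_r_coset_def' by force
    qed
  qed
  have car: "carrier ?Q = U ` carrier F"
  proof -
    have "carrier ?Q = (\<lambda>v. U (\<Phi> v)) ` carrier V"
      unfolding quotient_module_def A_RCOSETS_def' using coset by auto
    also have "\<dots> = U ` carrier F" using surj \<Phi>c by (auto simp: image_iff)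
    finally show ?thesis .
  qed
  have ne: "\<exists>v. v \<in> carrier V \<and> \<Phi> v = \<phi> \<and> v \<in> U \<phi>" if "\<phi> \<in> carrier F" for \<phi>
    using surj[OF that] by (auto simp: U_def)
  have add: "U \<phi> \<oplus>\<^bsub>?Q\<^esub> U \<psi> = U (\<phi> \<oplus>\<^bsub>F\<^esub> \<psi>)" if \<phi>: "\<phi> \<in> carrier F" and \<psi>: "\<psi> \<in> carrier F" for \<phi> \<psi>
  proof -
    have "U \<phi> <+>\<^bsub>V\<^esub> U \<psi> = U (\<phi> \<oplus>\<^bsub>F\<^esub> \<psi>)"
    proof
      show "U \<phi> <+>\<^bsub>V\<^esub> U \<psi> \<subseteq> U (\<phi> \<oplus>\<^bsub>F\<^esub> \<psi>)" by (auto simp: set_add_def' U_def \<Phi>a)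
      show "U (\<phi> \<oplus>\<^bsub>F\<^esub> \<psi>) \<subseteq> U \<phi> <+>\<^bsub>V\<^esub> U \<psi>"
      proof
        fix y assume "y \<in> U (\<phi> \<oplus>\<^bsub>F\<^esub> \<psi>)"
        then have y: "y \<in> carrier V" "\<Phi> y = \<phi> \<oplus>\<^bsub>F\<^esub> \<psi>" by (auto simp: U_def)
        obtain w where w: "w \<in> carrier V" "\<Phi> w = \<psi>" using surj[OF \<psi>] by auto
        have "\<Phi> (y \<ominus>\<^bsub>V\<^esub> w) = \<phi>"
          using diff[OF y(1) w(1)] y w \<phi> \<psi> by (simp add: F.M.minus_eq F.M.a_assoc F.M.r_neg)
        then have "y \<ominus>\<^bsub>V\<^esub> w \<in> U \<phi>" "w \<in> U \<psi>" using y w by (auto simp: U_def)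
        then show "y \<in> U \<phi> <+>\<^bsub>V\<^esub> U \<psi>" using cancel[OF y(1) w(1)] unfolding set_add_def' by force
      qed
    qed
    then show ?thesis by (simp add: quotient_module_def)
  qed
  have sm: "c \<odot>\<^bsub>?Q\<^esub> U \<phi> = U (c \<odot>\<^bsub>F\<^esub> \<phi>)" if c: "c \<in> carrier k" and \<phi>: "\<phi> \<in> carrier F" for c \<phi>
  proof -
    have "(\<Union>x\<in>U \<phi>. W +>\<^bsub>V\<^esub> (c \<odot>\<^bsub>V\<^esub> x)) = (\<Union>x\<in>U \<phi>. U (c \<odot>\<^bsub>F\<^esub> \<phi>))"
      using c by (intro SUP_cong refl) (auto simp: U_def coset smult \<Phi>s)
    also have "\<dots> = U (c \<odot>\<^bsub>F\<^esub> \<phi>)" using ne[OF \<phi>] by auto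
    finally show ?thesis by (simp add: quotient_module_def)
  qed
  have zero: "\<zero>\<^bsub>?Q\<^esub> = U \<zero>\<^bsub>F\<^esub>" by (simp add: quotient_module_def W U_def)
  have ex: "\<exists>\<phi>\<in>carrier F. q = U \<phi>" if "q \<in> carrier ?Q" for q using that car by auto
  have Uc: "U \<phi> \<in> carrier ?Q" if "\<phi> \<in> carrier F" for \<phi> using that car by auto
  \<comment> \<open>The axioms are transported along \<open>U\<close>: every coset is a fibre, and
    the operations on fibres are those of the free module.\<close>
  have "vectorspace k ?Q"
  proof (rule vs_criteria[OF k])
    show "\<zero>\<^bsub>?Q\<^esub> \<in> carrier ?Q" using zero Uc by simp
    show "\<forall>v w. v \<in> carrier ?Q \<and> w \<in> carrier ?Q \<longrightarrow> v \<oplus>\<^bsub>?Q\<^esub> w \<in> carrier ?Q"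
      using ex Uc add F.M.a_closed by metis
    show "\<forall>v\<in>carrier ?Q. \<exists>w\<in>carrier ?Q. v \<oplus>\<^bsub>?Q\<^esub> w = \<zero>\<^bsub>?Q\<^esub>"
    proof
      fix v assume "v \<in> carrier ?Q"
      then obtain \<phi> where \<phi>: "\<phi> \<in> carrier F" "v = U \<phi>" using ex by auto
      show "\<exists>w\<in>carrier ?Q. v \<oplus>\<^bsub>?Q\<^esub> w = \<zero>\<^bsub>?Q\<^esub>"
        using \<phi> add[of \<phi> "\<ominus>\<^bsub>F\<^esub> \<phi>"] zero Uc by (intro bexI[of _ "U (\<ominus>\<^bsub>F\<^esub> \<phi>)"]) (simp_all add: F.M.r_neg)
    qed
    show "\<forall>c v. c \<in> carrier k \<and> v \<in> carrier ?Q \<longrightarrow> c \<odot>\<^bsub>?Q\<^esub> v \<in> carrier ?Q"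
      using ex Uc sm F.smult_closed by metis
    show "\<forall>v w. v \<in> carrier ?Q \<and> w \<in> carrier ?Q \<longrightarrow> v \<oplus>\<^bsub>?Q\<^esub> w = w \<oplus>\<^bsub>?Q\<^esub> v"
      using ex add F.M.a_comm by metis
    show "\<forall>v w x. v \<in> carrier ?Q \<and> w \<in> carrier ?Q \<and> x \<in> carrier ?Q \<longrightarrow>
        v \<oplus>\<^bsub>?Q\<^esub> w \<oplus>\<^bsub>?Q\<^esub> x = v \<oplus>\<^bsub>?Q\<^esub> (w \<oplus>\<^bsub>?Q\<^esub> x)"
    proof (intro allI impI)
      fix v w x assume "v \<in> carrier ?Q \<and> w \<in> carrier ?Q \<and> x \<in> carrier ?Q"
      then obtain a b c where "a \<in> carrier F" "v = U a" "b \<in> carrier F" "w = U b" "c \<in> carrier F" "x = U c"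
        using ex by metis
      then show "v \<oplus>\<^bsub>?Q\<^esub> w \<oplus>\<^bsub>?Q\<^esub> x = v \<oplus>\<^bsub>?Q\<^esub> (w \<oplus>\<^bsub>?Q\<^esub> x)" by (simp add: add F.M.a_assoc)
    qed
    show "\<forall>v\<in>carrier ?Q. v \<oplus>\<^bsub>?Q\<^esub> \<zero>\<^bsub>?Q\<^esub> = v"
      using ex add zero F.M.r_zero F.M.zero_closed by metis
    show "\<forall>a b v. a \<in> carrier k \<and> b \<in> carrier k \<and> v \<in> carrier ?Q \<longrightarrow>
        (a \<otimes>\<^bsub>k\<^esub> b) \<odot>\<^bsub>?Q\<^esub> v = a \<odot>\<^bsub>?Q\<^esub> (b \<odot>\<^bsub>?Q\<^esub> v)"
    proof (intro allI impI)
      fix a b v assume h: "a \<in> carrier k \<and> b \<in> carrier k \<and> v \<in> carrier ?Q"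
      then obtain \<phi> where "\<phi> \<in> carrier F" "v = U \<phi>" using ex by metis
      then show "(a \<otimes>\<^bsub>k\<^esub> b) \<odot>\<^bsub>?Q\<^esub> v = a \<odot>\<^bsub>?Q\<^esub> (b \<odot>\<^bsub>?Q\<^esub> v)"
        using h by (simp add: sm F.smult_closed F.smult_assoc)
    qed
    show "\<forall>v\<in>carrier ?Q. \<one>\<^bsub>k\<^esub> \<odot>\<^bsub>?Q\<^esub> v = v"
      using ex sm F.smult_one K.one_closed by metis
    show "\<forall>a b v. a \<in> carrier k \<and> b \<in> carrier k \<and> v \<in> carrier ?Q \<longrightarrow>
        (a \<oplus>\<^bsub>k\<^esub> b) \<odot>\<^bsub>?Q\<^esub> v = a \<odot>\<^bsub>?Q\<^esub> v \<oplus>\<^bsub>?Q\<^esub> b \<odot>\<^bsub>?Q\<^esub> v"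
    proof (intro allI impI)
      fix a b v assume h: "a \<in> carrier k \<and> b \<in> carrier k \<and> v \<in> carrier ?Q"
      then obtain \<phi> where "\<phi> \<in> carrier F" "v = U \<phi>" using ex by metis
      then show "(a \<oplus>\<^bsub>k\<^esub> b) \<odot>\<^bsub>?Q\<^esub> v = a \<odot>\<^bsub>?Q\<^esub> v \<oplus>\<^bsub>?Q\<^esub> b \<odot>\<^bsub>?Q\<^esub> v"
        using h by (simp add: sm add F.smult_closed F.smult_l_distr)
    qed
    show "\<forall>a v w. a \<in> carrier k \<and> v \<in> carrier ?Q \<and> w \<in> carrier ?Q \<longrightarrow>
        a \<odot>\<^bsub>?Q\<^esub> (v \<oplus>\<^bsub>?Q\<^esub> w) = a \<odot>\<^bsub>?Q\<^esub> v \<oplus>\<^bsub>?Q\<^esub> a \<odot>\<^bsub>?Q\<^esub> w"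
    proof (intro allI impI)
      fix a v w assume h: "a \<in> carrier k \<and> v \<in> carrier ?Q \<and> w \<in> carrier ?Q"
      then obtain \<phi> \<psi> where "\<phi> \<in> carrier F" "v = U \<phi>" "\<psi> \<in> carrier F" "w = U \<psi>" using ex by metis
      then show "a \<odot>\<^bsub>?Q\<^esub> (v \<oplus>\<^bsub>?Q\<^esub> w) = a \<odot>\<^bsub>?Q\<^esub> v \<oplus>\<^bsub>?Q\<^esub> a \<odot>\<^bsub>?Q\<^esub> w"
        using h by (simp add: sm add F.smult_closed F.smult_r_distr)
    qed
  qed
  then interpret Q: vectorspace k ?Q .
  interpret FV: vectorspace k F by (rule left_module_vectorspace[OF k F.left_module_axioms])
  have hom: "U \<in> mhom k F ?Q"
    unfolding mhom_def
    by (intro CollectI conjI allI impI funcsetI) (auto simp: Uc add sm)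
  have "linear_map k F ?Q U"
    by (intro linear_map.intro mod_hom.intro mod_hom_axioms.intro hom FV.vectorspace_axioms
        Q.vectorspace_axioms FV.module_axioms Q.module_axioms)
  then interpret T: linear_map k F ?Q U .
  have basis: "FV.basis (basis_vec k ` I)" and inj: "inj_on (basis_vec k) I"
    using free_module_basis[OF k I] by (simp_all add: F_def)
  have fin: "FV.fin_dim"
    using basis I unfolding FV.fin_dim_def FV.basis_def by (intro exI[of _ "basis_vec k ` I"]) simp
  have "inj_on U (carrier F)"
  proof (rule inj_onI)
    fix \<phi> \<psi> assume "\<phi> \<in> carrier F" "U \<phi> = U \<psi>"
    then show "\<phi> = \<psi>" using ne[of \<phi>] by (auto simp: U_def)
  qed
  then have "Q.dim = FV.dim" using T.dim_eq[OF fin] car by simp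
  also have "\<dots> = card (basis_vec k ` I)" using basis I by (intro FV.dim_basis) auto
  also have "\<dots> = card I" using inj by (rule card_image)
  finally show ?thesis .
qed

section \<open>Cocycles as homomorphisms on the first syzygy\<close>

lemma cover_map_eq_lin_ext: "cover_map R M = lin_ext R M (\<lambda>m. m)"
  by (simp add: fun_eq_iff cover_map_def lin_ext_def)

lemma kernel_left_module:
  assumes P: "left_module R P" and M: "left_module R M" and h: "h \<in> mhom R P M"
  shows "left_module R (P\<lparr>carrier := {x \<in> carrier P. h x = \<zero>\<^bsub>M\<^esub>}\<rparr>)"
proof -
  interpret P: left_module R P by fact
  interpret M: left_module R M by fact
  note ha = mhom_add[OF h] and hs = mhom_smult[OF h]
  have z: "h \<zero>\<^bsub>P\<^esub> = \<zero>\<^bsub>M\<^esub>"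
    by (rule module_hom_zero[OF P.M.abelian_group_axioms M.M.abelian_group_axioms h])
  have m: "h (\<ominus>\<^bsub>P\<^esub> x) = \<ominus>\<^bsub>M\<^esub> h x" if "x \<in> carrier P" for x
    by (rule additive_minus[OF P.M.abelian_group_axioms M.M.abelian_group_axioms
          mhom_closed[OF h] _ that]) (rule ha)
  let ?K = "P\<lparr>carrier := {x \<in> carrier P. h x = \<zero>\<^bsub>M\<^esub>}\<rparr>"
  have grp: "abelian_group ?K"
  proof (rule abelian_groupI, goal_cases)
    case (6 x)
    then have "\<ominus>\<^bsub>P\<^esub> x \<in> carrier ?K" "\<ominus>\<^bsub>P\<^esub> x \<oplus>\<^bsub>P\<^esub> x = \<zero>\<^bsub>P\<^esub>" by (simp_all add: m P.M.l_neg)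
    then show ?case by (intro bexI[of _ "\<ominus>\<^bsub>P\<^esub> x"]) simp_all
  qed (simp_all add: ha z P.M.a_ac)
  show ?thesis
    by (intro left_module.intro left_module_axioms.intro P.R.ring_axioms grp)
      (simp_all add: hs P.smult_closed M.smult_zero_right P.smult_l_distr P.smult_r_distr
        P.smult_assoc P.smult_one)
qed

context left_module
begin

lemma free_cover_left_module: "left_module R (free_cover R M)"
  unfolding free_cover_def by (rule free_module_left_module[OF R.ring_axioms])

lemma cover_map_hom: "cover_map R M \<in> mhom R (free_cover R M) M"
  unfolding cover_map_eq_lin_ext free_cover_def by (rule lin_ext_hom) simp

lemma cover_map_basis_vec: "m \<in> carrier M \<Longrightarrow> cover_map R M (basis_vec R m) = m"
  unfolding cover_map_eq_lin_ext by (rule lin_ext_basis_vec)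

lemma basis_vec_free_cover: "m \<in> carrier M \<Longrightarrow> basis_vec R m \<in> carrier (free_cover R M)"
  unfolding free_cover_def by (rule basis_vec_closed[OF R.ring_axioms])

lemma syzygy_left_module: "left_module R (syzygy R M)"
  unfolding syzygy_def
  by (rule kernel_left_module[OF free_cover_left_module left_module_axioms cover_map_hom])

lemma free_cover_hom_eqI:
  assumes "left_module R N" "g \<in> mhom R (free_cover R M) N"
    "h \<in> mhom R (free_cover R M) N"
    "\<And>m. m \<in> carrier M \<Longrightarrow> g (basis_vec R m) = h (basis_vec R m)" "f \<in> carrier (free_cover R M)"
  shows "g f = h f"
  using left_module.module_hom_free_eqI[OF assms(1), of g "carrier M" h f] assms(2-5)
  by (simp add: free_cover_def)

end

lemma syzygy_simps [simp]:
  "carrier (syzygy R M) = {f \<in> carrier (free_cover R M). cover_map R M f = \<zero>\<^bsub>M\<^esub>}"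
  "add (syzygy R M) = add (free_cover R M)" "zero (syzygy R M) = zero (free_cover R M)"
  "smult (syzygy R M) = smult (free_cover R M)"
  by (simp_all add: syzygy_def)

locale ext_setting = k_algebra k B + M: left_module B M + N: left_module B N
  for k :: "('k, 'c) ring_scheme" and B :: "('k, 'b, 'e) module_scheme"
    and M :: "('b, 'm, 'd) module_scheme" and N :: "('b, 'n, 'f) module_scheme"
begin

abbreviation "P0 \<equiv> free_cover B M"
abbreviation "Kz \<equiv> syzygy B M"
abbreviation "P1 \<equiv> free_cover B Kz"
abbreviation "V \<equiv> ext1_cocycles B M N"

sublocale P0: left_module B P0 by (rule M.free_cover_left_module)
sublocale Kz: left_module B Kz by (rule M.syzygy_left_module)
sublocale P1: left_module B P1 by (rule Kz.free_cover_left_module)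
sublocale K2: left_module B "syzygy B Kz" by (rule Kz.syzygy_left_module)

text \<open>Composition with the surjection of P1 onto the syzygy. Homomorphisms on the syzygy yield
  all cocycles in this way, and those that come from P0 yield the coboundaries.\<close>

definition cob :: "(('m \<Rightarrow> 'b) \<Rightarrow> 'n) \<Rightarrow> (('m \<Rightarrow> 'b) \<Rightarrow> 'b) \<Rightarrow> 'n" where
  "cob h = (\<lambda>y\<in>carrier P1. h (cover_map B Kz y))"

lemma cover_K_closed: "y \<in> carrier P1 \<Longrightarrow> cover_map B Kz y \<in> carrier Kz"
  using mhom_closed[OF Kz.cover_map_hom] by auto

lemma cob_basis_vec: "\<kappa> \<in> carrier Kz \<Longrightarrow> cob h (basis_vec B \<kappa>) = h \<kappa>"
  using Kz.basis_vec_free_cover[of \<kappa>] Kz.cover_map_basis_vec[of \<kappa>] by (simp add: cob_def del: syzygy_simps)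

lemma V_ops:
  "add V = (\<lambda>f g. \<lambda>x\<in>carrier P1. f x \<oplus>\<^bsub>N\<^esub> g x)"
  "zero V = (\<lambda>x\<in>carrier P1. \<zero>\<^bsub>N\<^esub>)"
  "smult V = (\<lambda>c f. \<lambda>x\<in>carrier P1. (c \<odot>\<^bsub>B\<^esub> \<one>\<^bsub>B\<^esub>) \<odot>\<^bsub>N\<^esub> f x)"
  by (simp_all add: ext1_cocycles_def hom_space_def)

lemma V_carrier:
  "carrier V = {f \<in> mhom B P1 N \<inter> extensional (carrier P1).
    \<forall>x \<in> carrier (free_cover B (syzygy B Kz)). f (cover_map B (syzygy B Kz) x) = \<zero>\<^bsub>N\<^esub>}"
  by (simp add: ext1_cocycles_def hom_space_def)

lemma cob_in_V:
  assumes h: "h \<in> mhom B Kz N"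
  shows "cob h \<in> carrier V"
proof -
  have hom: "(\<lambda>y. h (cover_map B Kz y)) \<in> mhom B P1 N"
    by (rule module_hom_comp[OF Kz.cover_map_hom h])
  have "cob h \<in> mhom B P1 N"
    unfolding mhom_def
  proof (intro CollectI conjI allI impI funcsetI)
    fix y assume "y \<in> carrier P1"
    then show "cob h y \<in> carrier N"
      using mhom_closed[OF hom] by (auto simp: cob_def)
  next
    fix x y assume "x \<in> carrier P1 \<and> y \<in> carrier P1"
    then show "cob h (x \<oplus>\<^bsub>P1\<^esub> y) = cob h x \<oplus>\<^bsub>N\<^esub> cob h y"
      using mhom_add[OF hom, of x y] P1.M.a_closed[of x y] by (simp add: cob_def)
  next
    fix r x assume "r \<in> carrier B \<and> x \<in> carrier P1"
    then show "cob h (r \<odot>\<^bsub>P1\<^esub> x) = r \<odot>\<^bsub>N\<^esub> cob h x"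
      using mhom_smult[OF hom, of r x] P1.smult_closed[of r x] by (simp add: cob_def)
  qed
  moreover have "cob h (cover_map B (syzygy B Kz) x) = \<zero>\<^bsub>N\<^esub>"
    if "x \<in> carrier (free_cover B (syzygy B Kz))" for x
  proof -
    have "cover_map B (syzygy B Kz) x \<in> carrier (syzygy B Kz)"
      using mhom_closed[OF K2.cover_map_hom] that by auto
    then have "cover_map B (syzygy B Kz) x \<in> carrier P1"
      "cover_map B Kz (cover_map B (syzygy B Kz) x) = \<zero>\<^bsub>Kz\<^esub>" by (simp_all only: syzygy_simps mem_Collect_eq)
    then show ?thesis
      using module_hom_zero[OF Kz.M.abelian_group_axioms N.M.abelian_group_axioms h] by (simp add: cob_def)
  qed
  ultimately show ?thesis unfolding V_carrier by (simp add: cob_def)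
qed

text \<open>A cocycle vanishes on the second syzygy, the kernel of P1 onto the first, so it factors
  through the first. The factor is read off on basis vectors, which are preimages of the elements
  they are indexed by.\<close>

lemma V_cob:
  assumes f: "f \<in> carrier V"
  shows "(\<lambda>\<kappa>. f (basis_vec B \<kappa>)) \<in> mhom B Kz N"
    and "f = cob (\<lambda>\<kappa>. f (basis_vec B \<kappa>))"
proof -
  have hom: "f \<in> mhom B P1 N" and ext: "f \<in> extensional (carrier P1)"
    and van: "\<And>x. x \<in> carrier (free_cover B (syzygy B Kz)) \<Longrightarrow> f (cover_map B (syzygy B Kz) x) = \<zero>\<^bsub>N\<^esub>"
    using f unfolding V_carrier by auto
  note fa = mhom_add[OF hom] and fs = mhom_smult[OF hom]
  have fc: "f y \<in> carrier N" if "y \<in> carrier P1" for y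
    using mhom_closed[OF hom] that by auto
  have fm: "f (\<ominus>\<^bsub>P1\<^esub> y) = \<ominus>\<^bsub>N\<^esub> f y" if "y \<in> carrier P1" for y
    by (rule additive_minus[OF P1.M.abelian_group_axioms N.M.abelian_group_axioms
          mhom_closed[OF hom] _ that]) (rule fa)
  note ca = mhom_add[OF Kz.cover_map_hom]
    and cs = mhom_smult[OF Kz.cover_map_hom]
  have cm: "cover_map B Kz (\<ominus>\<^bsub>P1\<^esub> y) = \<ominus>\<^bsub>Kz\<^esub> cover_map B Kz y" if "y \<in> carrier P1" for y
    by (rule additive_minus[OF P1.M.abelian_group_axioms Kz.M.abelian_group_axioms
          mhom_closed[OF Kz.cover_map_hom] _ that]) (rule ca)
  \<comment> \<open>The difference of \<open>y\<close> and \<open>z\<close> lies in the second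
    syzygy and is the image of its own basis vector there, so \<open>f\<close> annihilates
    it.\<close>
  have eq: "f y = f z" if y: "y \<in> carrier P1" and z: "z \<in> carrier P1"
    and yz: "cover_map B Kz y = cover_map B Kz z" for y z
  proof -
    have d: "y \<oplus>\<^bsub>P1\<^esub> \<ominus>\<^bsub>P1\<^esub> z \<in> carrier P1" using y z by simp
    have "cover_map B Kz (y \<oplus>\<^bsub>P1\<^esub> \<ominus>\<^bsub>P1\<^esub> z) = \<zero>\<^bsub>Kz\<^esub>"
      using ca[of y "\<ominus>\<^bsub>P1\<^esub> z"] cm[OF z] y z yz Kz.M.r_neg[OF cover_K_closed[OF z]]
      by (simp del: syzygy_simps)
    then have k2: "y \<oplus>\<^bsub>P1\<^esub> \<ominus>\<^bsub>P1\<^esub> z \<in> carrier (syzygy B Kz)" using d by (simp only: syzygy_simps mem_Collect_eq)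
    have "f (y \<oplus>\<^bsub>P1\<^esub> \<ominus>\<^bsub>P1\<^esub> z) = \<zero>\<^bsub>N\<^esub>"
      using van[OF K2.basis_vec_free_cover[OF k2]] K2.cover_map_basis_vec[OF k2] by (simp only:)
    then have "f y \<oplus>\<^bsub>N\<^esub> \<ominus>\<^bsub>N\<^esub> f z = \<zero>\<^bsub>N\<^esub>" using fa[of y "\<ominus>\<^bsub>P1\<^esub> z"] fm[OF z] y z by (simp del: syzygy_simps)
    then show ?thesis
      using N.M.minus_equality[of "f y" "\<ominus>\<^bsub>N\<^esub> f z"] fc[OF y] fc[OF z] by simp
  qed
  note bv = Kz.basis_vec_free_cover and cb = Kz.cover_map_basis_vec
  show "(\<lambda>\<kappa>. f (basis_vec B \<kappa>)) \<in> mhom B Kz N"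
    unfolding mhom_def
  proof (intro CollectI conjI allI impI funcsetI)
    fix \<kappa> assume "\<kappa> \<in> carrier Kz"
    then show "f (basis_vec B \<kappa>) \<in> carrier N" by (intro fc bv)
  next
    fix \<kappa> \<mu> assume k: "\<kappa> \<in> carrier Kz \<and> \<mu> \<in> carrier Kz"
    then have s: "\<kappa> \<oplus>\<^bsub>Kz\<^esub> \<mu> \<in> carrier Kz" by (intro Kz.M.a_closed) auto
    have bs: "basis_vec B \<kappa> \<oplus>\<^bsub>P1\<^esub> basis_vec B \<mu> \<in> carrier P1" using k bv by (intro P1.M.a_closed) auto
    have "f (basis_vec B (\<kappa> \<oplus>\<^bsub>Kz\<^esub> \<mu>)) = f (basis_vec B \<kappa> \<oplus>\<^bsub>P1\<^esub> basis_vec B \<mu>)"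
      by (rule eq[OF bv[OF s] bs]) (use k bv ca cb cb[OF s] in \<open>simp del: syzygy_simps\<close>)
    then show "f (basis_vec B (\<kappa> \<oplus>\<^bsub>Kz\<^esub> \<mu>)) = f (basis_vec B \<kappa>) \<oplus>\<^bsub>N\<^esub> f (basis_vec B \<mu>)"
      using fa bv k by (simp del: syzygy_simps)
  next
    fix r \<kappa> assume k: "r \<in> carrier B \<and> \<kappa> \<in> carrier Kz"
    then have s: "r \<odot>\<^bsub>Kz\<^esub> \<kappa> \<in> carrier Kz" by (intro Kz.smult_closed) auto
    have bs: "r \<odot>\<^bsub>P1\<^esub> basis_vec B \<kappa> \<in> carrier P1" using k bv by (intro P1.smult_closed) auto
    have "f (basis_vec B (r \<odot>\<^bsub>Kz\<^esub> \<kappa>)) = f (r \<odot>\<^bsub>P1\<^esub> basis_vec B \<kappa>)"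
      by (rule eq[OF bv[OF s] bs]) (use k bv cs cb cb[OF s] in \<open>simp del: syzygy_simps\<close>)
    then show "f (basis_vec B (r \<odot>\<^bsub>Kz\<^esub> \<kappa>)) = r \<odot>\<^bsub>N\<^esub> f (basis_vec B \<kappa>)"
      using fs bv k by (simp del: syzygy_simps)
  qed
  show "f = cob (\<lambda>\<kappa>. f (basis_vec B \<kappa>))"
  proof (rule extensionalityI[OF ext])
    show "cob (\<lambda>\<kappa>. f (basis_vec B \<kappa>)) \<in> extensional (carrier P1)" by (simp add: cob_def)
    fix y assume y: "y \<in> carrier P1"
    have "f y = f (basis_vec B (cover_map B Kz y))"
      by (rule eq[OF y bv[OF cover_K_closed[OF y]]]) (simp only: cb[OF cover_K_closed[OF y]])
    then show "f y = cob (\<lambda>\<kappa>. f (basis_vec B \<kappa>)) y" using y by (simp add: cob_def)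
  qed
qed

lemma cob_cong: "(\<And>\<kappa>. \<kappa> \<in> carrier Kz \<Longrightarrow> h \<kappa> = h' \<kappa>) \<Longrightarrow> cob h = cob h'"
  unfolding cob_def by (intro restrict_ext) (use cover_K_closed in blast)

lemma cob_add: "cob h \<oplus>\<^bsub>V\<^esub> cob h' = cob (\<lambda>\<kappa>. h \<kappa> \<oplus>\<^bsub>N\<^esub> h' \<kappa>)"
  by (auto simp: V_ops cob_def fun_eq_iff)

lemma cob_smult: "c \<odot>\<^bsub>V\<^esub> cob h = cob (\<lambda>\<kappa>. (c \<odot>\<^bsub>B\<^esub> \<one>\<^bsub>B\<^esub>) \<odot>\<^bsub>N\<^esub> h \<kappa>)"
  by (auto simp: V_ops cob_def fun_eq_iff)

lemma cob_zero: "\<zero>\<^bsub>V\<^esub> = cob (\<lambda>_. \<zero>\<^bsub>N\<^esub>)"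
  by (auto simp: V_ops cob_def fun_eq_iff)

lemma hom_K_closed: "\<lbrakk>h \<in> mhom B Kz N; \<kappa> \<in> carrier Kz\<rbrakk> \<Longrightarrow> h \<kappa> \<in> carrier N"
  using mhom_closed by blast

lemma hom_K_sum:
  assumes "h \<in> mhom B Kz N" "h' \<in> mhom B Kz N"
  shows "(\<lambda>\<kappa>. h \<kappa> \<oplus>\<^bsub>N\<^esub> h' \<kappa>) \<in> mhom B Kz N"
  by (rule module_hom_sum[OF N.M.abelian_group_axioms N.smult_r_distr assms])

lemma V_smult_closed:
  assumes c: "c \<in> carrier k" and f: "f \<in> carrier V"
  shows "c \<odot>\<^bsub>V\<^esub> f \<in> carrier V"
proof -
  let ?h = "\<lambda>\<kappa>. f (basis_vec B \<kappa>)"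
  have h: "?h \<in> mhom B Kz N" by (rule V_cob(1)[OF f])
  have "(\<lambda>n. (c \<odot>\<^bsub>B\<^esub> \<one>\<^bsub>B\<^esub>) \<odot>\<^bsub>N\<^esub> n) \<in> mhom B N N"
    unfolding mhom_def
    using scalar_closed[OF c] scalar_smult(2)[OF N.left_module_axioms c]
    by (auto simp: N.smult_closed N.smult_r_distr)
  then have "cob (\<lambda>\<kappa>. (c \<odot>\<^bsub>B\<^esub> \<one>\<^bsub>B\<^esub>) \<odot>\<^bsub>N\<^esub> ?h \<kappa>) \<in> carrier V"
    by (intro cob_in_V module_hom_comp[OF h])
  then show ?thesis using V_cob(2)[OF f] cob_smult[of c ?h] by simp
qed

text \<open>Every cocycle is \<open>cob h\<close>, so the group laws are inherited pointwise from
  \<open>N\<close>.\<close>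

lemma V_abelian_group: "abelian_group V"
proof -
  have ex: "\<exists>h\<in>mhom B Kz N. f = cob h" if "f \<in> carrier V" for f
    using V_cob[OF that] by blast
  show ?thesis
  proof (rule abelian_groupI)
    fix f g assume "f \<in> carrier V" "g \<in> carrier V"
    then obtain h h' where h: "h \<in> mhom B Kz N" "f = cob h"
      "h' \<in> mhom B Kz N" "g = cob h'" using ex by metis
    then show "f \<oplus>\<^bsub>V\<^esub> g \<in> carrier V" using cob_in_V[OF hom_K_sum[OF h(1,3)]] by (simp add: cob_add)
    show "f \<oplus>\<^bsub>V\<^esub> g = g \<oplus>\<^bsub>V\<^esub> f"
      unfolding h cob_add by (rule cob_cong) (intro N.M.a_comm hom_K_closed[OF h(1)] hom_K_closed[OF h(3)])
    fix e assume "e \<in> carrier V"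
    then obtain h'' where h'': "h'' \<in> mhom B Kz N" "e = cob h''" using ex by metis
    show "f \<oplus>\<^bsub>V\<^esub> g \<oplus>\<^bsub>V\<^esub> e = f \<oplus>\<^bsub>V\<^esub> (g \<oplus>\<^bsub>V\<^esub> e)"
      unfolding h h'' cob_add
      by (rule cob_cong) (intro N.M.a_assoc hom_K_closed[OF h(1)] hom_K_closed[OF h(3)] hom_K_closed[OF h''(1)])
  next
    show "\<zero>\<^bsub>V\<^esub> \<in> carrier V" unfolding cob_zero by (intro cob_in_V N.module_hom_const_zero)
  next
    fix f assume "f \<in> carrier V"
    then obtain h where h: "h \<in> mhom B Kz N" "f = cob h" using ex by metis
    show "\<zero>\<^bsub>V\<^esub> \<oplus>\<^bsub>V\<^esub> f = f"
      unfolding h cob_zero cob_add by (rule cob_cong) (intro N.M.l_zero hom_K_closed[OF h(1)])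
    have "(\<lambda>n. \<ominus>\<^bsub>N\<^esub> n) \<in> mhom B N N"
      unfolding mhom_def
      by (auto simp: N.M.minus_add N.M.a_comm N.smult_minus_right)
    then have "cob (\<lambda>\<kappa>. \<ominus>\<^bsub>N\<^esub> h \<kappa>) \<in> carrier V" by (intro cob_in_V module_hom_comp[OF h(1)])
    moreover have "cob (\<lambda>\<kappa>. \<ominus>\<^bsub>N\<^esub> h \<kappa>) \<oplus>\<^bsub>V\<^esub> f = \<zero>\<^bsub>V\<^esub>"
      unfolding h cob_zero cob_add by (rule cob_cong) (intro N.M.l_neg hom_K_closed[OF h(1)])
    ultimately show "\<exists>g\<in>carrier V. g \<oplus>\<^bsub>V\<^esub> f = \<zero>\<^bsub>V\<^esub>" by blast
  qed
qed

text \<open>\<open>hom_space\<close> contains extensional functions only. Restricting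
  \<open>g\<close> to P0 does not change \<open>cob g\<close>, because the syzygy lies in
  P0.\<close>

lemma coboundaries_eq:
  "ext1_coboundaries B M N = {cob g | g. g \<in> mhom B P0 N}"
proof -
  have "cob (restrict g (carrier P0)) = cob g" for g
    by (rule cob_cong) simp
  moreover have "restrict g (carrier P0) \<in> mhom B P0 N"
    if g: "g \<in> mhom B P0 N" for g
    unfolding mhom_def
  proof (intro CollectI conjI allI impI funcsetI)
    fix x assume "x \<in> carrier P0"
    then show "restrict g (carrier P0) x \<in> carrier N"
      using mhom_closed[OF g] by auto
  next
    fix x y assume "x \<in> carrier P0 \<and> y \<in> carrier P0"
    then show "restrict g (carrier P0) (x \<oplus>\<^bsub>P0\<^esub> y) = restrict g (carrier P0) x \<oplus>\<^bsub>N\<^esub> restrict g (carrier P0) y"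
      using mhom_add[OF g, of x y] P0.M.a_closed[of x y] by simp
  next
    fix r x assume "r \<in> carrier B \<and> x \<in> carrier P0"
    then show "restrict g (carrier P0) (r \<odot>\<^bsub>P0\<^esub> x) = r \<odot>\<^bsub>N\<^esub> restrict g (carrier P0) x"
      using mhom_smult[OF g, of r x] P0.smult_closed[of r x] by simp
  qed
  ultimately show ?thesis
    unfolding ext1_coboundaries_def hom_space_def cob_def[symmetric]
    by (auto intro: restrict_extensional) (metis IntI restrict_extensional)
qed

lemma hom_P0_K: "g \<in> mhom B P0 N \<Longrightarrow> g \<in> mhom B Kz N"
  unfolding mhom_def by (auto simp: Pi_iff)

end

section \<open>Derivations and the syzygy of a one-dimensional module\<close>

locale char_pair = free_lrb_algebra k A + M: char_mod k A X M gM + N: char_mod k A Y N gN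
  for k :: "('k, 'c) ring_scheme" and A :: "'a set"
    and X :: "'a set" and M :: "('a list \<Rightarrow> 'k, 'm, 'd) module_scheme" and gM
    and Y :: "'a set" and N :: "('a list \<Rightarrow> 'k, 'n, 'e) module_scheme" and gN
begin

sublocale E: ext_setting k kS M N
  by (intro ext_setting.intro SB.k_algebra_axioms M.left_module_M N.left_module_M)

text \<open>The Leibniz rule with both actions evaluated: \<open>v\<close> acts from the left
  through M_Y and \<open>w\<close> from the right through M_X, each as 0 or 1.\<close>

definition is_der :: "('a list \<Rightarrow> 'n) \<Rightarrow> bool" where
  "is_der d \<longleftrightarrow> (\<forall>w\<in>carrier S. d w \<in> carrier N) \<and>
    (\<forall>v\<in>carrier S. \<forall>w\<in>carrier S. d (keep_first (v @ w)) =
      (if set v \<subseteq> Y then d w else \<zero>\<^bsub>N\<^esub>) \<oplus>\<^bsub>N\<^esub> (if set w \<subseteq> X then d v else \<zero>\<^bsub>N\<^esub>))"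

text \<open>The commutator of \<open>w\<close> with \<theta> for the same two actions.\<close>

definition inner_der :: "'n \<Rightarrow> 'a list \<Rightarrow> 'n" where
  "inner_der \<theta> w = (if set w \<subseteq> Y then \<theta> else \<zero>\<^bsub>N\<^esub>) \<ominus>\<^bsub>N\<^esub> (if set w \<subseteq> X then \<theta> else \<zero>\<^bsub>N\<^esub>)"

lemma der_closed: "\<lbrakk>is_der d; w \<in> carrier S\<rbrakk> \<Longrightarrow> d w \<in> carrier N"
  unfolding is_der_def by blast

lemma der_mult:
  "\<lbrakk>is_der d; v \<in> carrier S; w \<in> carrier S\<rbrakk> \<Longrightarrow> d (keep_first (v @ w)) =
      (if set v \<subseteq> Y then d w else \<zero>\<^bsub>N\<^esub>) \<oplus>\<^bsub>N\<^esub> (if set w \<subseteq> X then d v else \<zero>\<^bsub>N\<^esub>)"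
  unfolding is_der_def by blast

lemma minus_zero_N: "\<ominus>\<^bsub>N\<^esub> \<zero>\<^bsub>N\<^esub> = \<zero>\<^bsub>N\<^esub>"
  by (rule N.M.M.minus_equality) simp_all

lemma inner_is_der:
  assumes \<theta>: "\<theta> \<in> carrier N"
  shows "is_der (inner_der \<theta>)"
  unfolding is_der_def
proof (intro conjI ballI)
  fix v w
  show "inner_der \<theta> (keep_first (v @ w)) = (if set v \<subseteq> Y then inner_der \<theta> w else \<zero>\<^bsub>N\<^esub>) \<oplus>\<^bsub>N\<^esub>
      (if set w \<subseteq> X then inner_der \<theta> v else \<zero>\<^bsub>N\<^esub>)"
    using \<theta> N.M.M.r_neg[OF \<theta>] N.M.M.l_neg[OF \<theta>]
    by (cases "set v \<subseteq> Y"; cases "set w \<subseteq> Y"; cases "set v \<subseteq> X"; cases "set w \<subseteq> X")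
      (simp_all add: inner_der_def N.M.M.minus_eq minus_zero_N)
qed (use \<theta> in \<open>simp add: inner_der_def\<close>)

lemma double_zero: "\<lbrakk>x \<in> carrier N; x = x \<oplus>\<^bsub>N\<^esub> x\<rbrakk> \<Longrightarrow> x = \<zero>\<^bsub>N\<^esub>"
  by (rule iffD1[OF N.M.M.add.r_cancel_one'])

lemma der_Nil:
  assumes d: "is_der d"
  shows "d [] = \<zero>\<^bsub>N\<^esub>"
proof (rule double_zero)
  have "d [] = d (keep_first ([] @ []))" by simp
  also have "\<dots> = (if set [] \<subseteq> Y then d [] else \<zero>\<^bsub>N\<^esub>) \<oplus>\<^bsub>N\<^esub> (if set [] \<subseteq> X then d [] else \<zero>\<^bsub>N\<^esub>)"
    by (rule der_mult[OF d]) simp_all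
  also have "\<dots> = d [] \<oplus>\<^bsub>N\<^esub> d []" by simp
  finally show "d [] = d [] \<oplus>\<^bsub>N\<^esub> d []" .
qed (rule der_closed[OF d], simp)

text \<open>The Leibniz rule for a a = a doubles the value if \<open>a\<close> is in both sets and
  annihilates it if \<open>a\<close> is in neither.\<close>

lemma der_letter:
  assumes d: "is_der d" and a: "a \<in> A" "a \<in> X \<longleftrightarrow> a \<in> Y"
  shows "d [a] = \<zero>\<^bsub>N\<^esub>"
proof -
  have "d [a] = d (keep_first ([a] @ [a]))" by simp
  also have "\<dots> = (if set [a] \<subseteq> Y then d [a] else \<zero>\<^bsub>N\<^esub>) \<oplus>\<^bsub>N\<^esub> (if set [a] \<subseteq> X then d [a] else \<zero>\<^bsub>N\<^esub>)"
    by (rule der_mult[OF d]) (use a in simp_all)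
  also have "\<dots> = (if a \<in> X then d [a] \<oplus>\<^bsub>N\<^esub> d [a] else \<zero>\<^bsub>N\<^esub>)" using a by simp
  finally have eq: "d [a] = (if a \<in> X then d [a] \<oplus>\<^bsub>N\<^esub> d [a] else \<zero>\<^bsub>N\<^esub>)" .
  have c: "d [a] \<in> carrier N" by (rule der_closed[OF d]) (use a in simp)
  show ?thesis
  proof (cases "a \<in> X")
    case True
    then have "d [a] = d [a] \<oplus>\<^bsub>N\<^esub> d [a]" using eq by argo
    then show ?thesis by (rule double_zero[OF c])
  next
    case False
    then show ?thesis using eq by argo
  qed
qed

lemma der_eqI:
  assumes d: "is_der d" and d': "is_der d'" and eq: "\<And>a. a \<in> A \<Longrightarrow> d [a] = d' [a]"
    and w: "w \<in> carrier S"
  shows "d w = d' w"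
  using w
proof (induction w)
  case Nil
  then show ?case using der_Nil[OF d] der_Nil[OF d'] by simp
next
  case (Cons a w)
  have aw: "keep_first ([a] @ w) = a # w" using Cons.prems by (subst keep_first_distinct) auto
  have c: "[a] \<in> carrier S" "w \<in> carrier S" "a \<in> A" using Cons.prems by auto
  show ?case
    using der_mult[OF d c(1,2)] der_mult[OF d' c(1,2)] Cons.IH[OF c(2)] eq[OF c(3)] by (simp only: aw)
qed

text \<open>The condition on \<open>c\<close> is vacuous unless \<open>Y\<close> lies in
  \<open>X\<close>. Then a derivation is determined by its letters, and those outside X - Y give
  zero. Otherwise a letter of Y - X provides \<theta> directly.\<close>

lemma der_is_inner:
  assumes d: "is_der d" and XY: "X \<subseteq> A" "Y \<subseteq> A" and c: "c \<in> carrier N"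
    and const: "\<And>a. \<lbrakk>Y \<subseteq> X; a \<in> X - Y\<rbrakk> \<Longrightarrow> d [a] = c"
  shows "\<exists>\<theta>\<in>carrier N. \<forall>w\<in>carrier S. d w = inner_der \<theta> w"
proof (cases "Y \<subseteq> X")
  case True
  \<comment> \<open>At a letter of X - Y the inner derivation of \<theta> has the value - \<theta>,
    hence the sign.\<close>
  have "d w = inner_der (\<ominus>\<^bsub>N\<^esub> c) w" if "w \<in> carrier S" for w
  proof (rule der_eqI[OF d inner_is_der _ that])
    fix a assume a: "a \<in> A"
    show "d [a] = inner_der (\<ominus>\<^bsub>N\<^esub> c) [a]"
    proof (cases "a \<in> X - Y")
      case aX: True
      then show ?thesis using const[OF True aX] c by (simp add: inner_der_def N.M.M.minus_eq)
    next
      case False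
      then have "a \<in> X \<longleftrightarrow> a \<in> Y" using True by auto
      then show ?thesis
        using der_letter[OF d a] c
          by (simp add: inner_der_def N.M.M.minus_eq N.M.M.l_neg minus_zero_N)
    qed
  qed (use c in simp)
  then show ?thesis using c by (intro bexI[of _ "\<ominus>\<^bsub>N\<^esub> c"]) auto
next
  case False
  then obtain a where a: "a \<in> Y" "a \<notin> X" by auto
  then have aS: "[a] \<in> carrier S" using XY by auto
  note da = der_closed[OF d aS]
  \<comment> \<open>The word a w absorbs a further \<open>a\<close>. Computing its value once as (a
    w) a and once as a w, with \<open>a\<close> acting as 1 from the left and 0 from the right,
    expresses \<open>d w\<close> through \<open>d [a]\<close>.\<close>
  have "d w = inner_der (d [a]) w" if w: "w \<in> carrier S" for w
  proof -
    let ?v = "keep_first ([a] @ w)"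
    have v: "?v \<in> carrier S" using w aS by auto
    have "keep_first (?v @ [a]) = ?v"
      by (subst keep_first_append) (simp add: keep_first_idem keep_first_distinct)
    then have "d ?v = (if set w \<subseteq> Y then d [a] else \<zero>\<^bsub>N\<^esub>) \<oplus>\<^bsub>N\<^esub> \<zero>\<^bsub>N\<^esub>"
      using der_mult[OF d v aS] a by (simp del: append.simps keep_first.simps)
    moreover have "d ?v = d w \<oplus>\<^bsub>N\<^esub> (if set w \<subseteq> X then d [a] else \<zero>\<^bsub>N\<^esub>)"
      using der_mult[OF d aS w] a by (simp del: append.simps keep_first.simps)
    ultimately have "d w \<oplus>\<^bsub>N\<^esub> (if set w \<subseteq> X then d [a] else \<zero>\<^bsub>N\<^esub>) = (if set w \<subseteq> Y then d [a] else \<zero>\<^bsub>N\<^esub>)"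
      using da by simp
    moreover have "d w = (d w \<oplus>\<^bsub>N\<^esub> (if set w \<subseteq> X then d [a] else \<zero>\<^bsub>N\<^esub>)) \<ominus>\<^bsub>N\<^esub> (if set w \<subseteq> X then d [a] else \<zero>\<^bsub>N\<^esub>)"
      using da der_closed[OF d w] by (simp add: N.M.M.minus_eq N.M.M.a_assoc N.M.M.r_neg)
    ultimately show ?thesis by (simp only: inner_der_def)
  qed
  then show ?thesis using da by blast
qed

definition chi :: "('a list \<Rightarrow> 'k) \<Rightarrow> 'k" where
  "chi r = M.coord (r \<odot>\<^bsub>M\<^esub> gM)"

text \<open>The projection of \<open>kS\<close> onto the annihilator of the generator
  \<open>gM\<close>, along the multiples of the identity; \<open>chi\<close> is the character of
  \<open>M\<close>.\<close>

definition aug :: "('a list \<Rightarrow> 'k) \<Rightarrow> 'a list \<Rightarrow> 'k" where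
  "aug r = r \<ominus>\<^bsub>kS\<^esub> (chi r \<odot>\<^bsub>kS\<^esub> \<one>\<^bsub>kS\<^esub>)"

abbreviation "\<delta> \<equiv> basis_vec kS gM"

lemma chi_closed: "r \<in> carrier kS \<Longrightarrow> chi r \<in> carrier k"
  unfolding chi_def by (intro M.coord M.M.smult_closed M.gen_closed)

lemma chi_add: "\<lbrakk>r \<in> carrier kS; s \<in> carrier kS\<rbrakk> \<Longrightarrow> chi (r \<oplus>\<^bsub>kS\<^esub> s) = chi r \<oplus>\<^bsub>k\<^esub> chi s"
  unfolding chi_def by (simp add: M.M.smult_l_distr M.gen_closed M.coord_add M.M.smult_closed)

lemma chi_smult: "\<lbrakk>c \<in> carrier k; r \<in> carrier kS\<rbrakk> \<Longrightarrow> chi (c \<odot>\<^bsub>kS\<^esub> r) = c \<otimes>\<^bsub>k\<^esub> chi r"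
  unfolding chi_def using SB.scalar_smult(1)[OF M.left_module_M _ _ M.gen_closed, of c r]
    M.coord_smult[of c "r \<odot>\<^bsub>M\<^esub> gM"] by (simp add: M.M.smult_closed M.gen_closed)

lemma chi_word: "w \<in> carrier S \<Longrightarrow> chi (lt w) = (if set w \<subseteq> X then \<one>\<^bsub>k\<^esub> else \<zero>\<^bsub>k\<^esub>)"
  unfolding chi_def by (simp only: M.word_smult M.gen_closed M.coord_gen M.coord_zero split: if_split) simp

lemma aug_closed: "r \<in> carrier kS \<Longrightarrow> aug r \<in> carrier kS"
  unfolding aug_def by (simp add: chi_closed SB.scalar_closed)

lemma aug_hom: "aug \<in> mhom k kS kS"
  unfolding mhom_def
proof (intro CollectI conjI allI impI funcsetI aug_closed)
  fix r s assume "r \<in> carrier kS \<and> s \<in> carrier kS"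
  then show "aug (r \<oplus>\<^bsub>kS\<^esub> s) = aug r \<oplus>\<^bsub>kS\<^esub> aug s"
    by (simp add: aug_def chi_add SB.L.smult_l_distr chi_closed SB.scalar_closed SB.L.M.minus_eq
        SB.L.M.minus_add SB.L.M.a_ac)
next
  fix c r assume "c \<in> carrier k \<and> r \<in> carrier kS"
  then show "aug (c \<odot>\<^bsub>kS\<^esub> r) = c \<odot>\<^bsub>kS\<^esub> aug r"
    by (simp add: aug_def chi_smult SB.L.smult_assoc chi_closed SB.scalar_closed SB.L.M.minus_eq
        SB.L.smult_r_distr SB.L.smult_minus_right)
qed

lemma aug_word:
  "w \<in> carrier S \<Longrightarrow> aug (lt w) = lt w \<ominus>\<^bsub>kS\<^esub> (if set w \<subseteq> X then \<one>\<^bsub>kS\<^esub> else \<zero>\<^bsub>kS\<^esub>)"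
  unfolding aug_def chi_word by (simp add: SB.L.smult_one SB.L.smult_zero_left)

text \<open>Writing \<chi> for \<open>chi\<close>: v w - \<chi>(v w) = v (w - \<chi>(w)) + \<chi>(w)
  (v - \<chi>(v)). This is the Leibniz rule before a homomorphism is applied.\<close>

lemma aug_mult:
  assumes v: "v \<in> carrier S" and w: "w \<in> carrier S"
  shows "aug (lt (keep_first (v @ w))) =
    lt v \<otimes>\<^bsub>kS\<^esub> aug (lt w) \<oplus>\<^bsub>kS\<^esub> (if set w \<subseteq> X then aug (lt v) else \<zero>\<^bsub>kS\<^esub>)"
proof -
  have vw: "keep_first (v @ w) \<in> carrier S" using v w by auto
  note c = word_closed[OF v] word_closed[OF w]
  have "aug (lt (keep_first (v @ w))) =
      lt v \<otimes>\<^bsub>kS\<^esub> lt w \<ominus>\<^bsub>kS\<^esub> (if set v \<subseteq> X \<and> set w \<subseteq> X then \<one>\<^bsub>kS\<^esub> else \<zero>\<^bsub>kS\<^esub>)"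
    using aug_word[OF vw] word_mult[OF v w] by simp
  also have "\<dots> = lt v \<otimes>\<^bsub>kS\<^esub> aug (lt w) \<oplus>\<^bsub>kS\<^esub> (if set w \<subseteq> X then aug (lt v) else \<zero>\<^bsub>kS\<^esub>)"
    using c unfolding aug_word[OF w] aug_word[OF v]
    by (simp add: SB.L.M.minus_eq SB.B.r_distr SB.B.r_minus SB.L.M.a_assoc SB.L.M.r_neg1)
  finally show ?thesis .
qed

text \<open>These elements lie in the syzygy, and evaluating a homomorphism at those of words turns
  it into a derivation.\<close>

definition aug_elem :: "('a list \<Rightarrow> 'k) \<Rightarrow> 'm \<Rightarrow> 'a list \<Rightarrow> 'k" where
  "aug_elem r = aug r \<odot>\<^bsub>E.P0\<^esub> \<delta>"

lemma \<delta>_closed: "\<delta> \<in> carrier E.P0"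
  by (rule M.M.basis_vec_free_cover[OF M.gen_closed])

lemma cover_\<delta>: "r \<in> carrier kS \<Longrightarrow> cover_map kS M (r \<odot>\<^bsub>E.P0\<^esub> \<delta>) = r \<odot>\<^bsub>M\<^esub> gM"
  using mhom_smult[OF M.M.cover_map_hom _ \<delta>_closed, of r]
    M.M.cover_map_basis_vec[OF M.gen_closed] by simp

lemma scalar_chi: "r \<in> carrier kS \<Longrightarrow> (chi r \<odot>\<^bsub>kS\<^esub> \<one>\<^bsub>kS\<^esub>) \<odot>\<^bsub>M\<^esub> gM = r \<odot>\<^bsub>M\<^esub> gM"
  unfolding chi_def using M.coord(2)[of "r \<odot>\<^bsub>M\<^esub> gM"] by (simp add: M.M.smult_closed M.gen_closed)

lemma aug_elem_closed:
  assumes r: "r \<in> carrier kS"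
  shows "aug_elem r \<in> carrier E.Kz"
proof -
  have "aug r \<odot>\<^bsub>M\<^esub> gM = r \<odot>\<^bsub>M\<^esub> gM \<oplus>\<^bsub>M\<^esub> \<ominus>\<^bsub>M\<^esub> ((chi r \<odot>\<^bsub>kS\<^esub> \<one>\<^bsub>kS\<^esub>) \<odot>\<^bsub>M\<^esub> gM)"
    using r unfolding aug_def
    by (simp add: SB.L.M.minus_eq M.M.smult_l_distr M.M.smult_minus_left chi_closed SB.scalar_closed M.gen_closed)
  also have "\<dots> = \<zero>\<^bsub>M\<^esub>"
    using r by (simp add: scalar_chi M.M.M.r_neg M.M.smult_closed M.gen_closed)
  finally show ?thesis
    using aug_closed[OF r] cover_\<delta>[OF aug_closed[OF r]] E.P0.smult_closed[OF aug_closed[OF r] \<delta>_closed]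
    by (simp add: aug_elem_def)
qed

lemma aug_elem_hom: "aug_elem \<in> mhom k kS (res_scalars kS E.Kz)"
proof -
  have h: "aug_elem \<in> mhom k kS (res_scalars kS E.P0)"
    unfolding aug_elem_def
    by (rule module_hom_comp[OF aug_hom SB.act_hom[OF E.P0.left_module_axioms \<delta>_closed]])
  show ?thesis
    unfolding mhom_def
  proof (intro CollectI conjI allI impI funcsetI)
    fix r assume "r \<in> carrier kS"
    then show "aug_elem r \<in> carrier (res_scalars kS E.Kz)" using aug_elem_closed by simp
  next
    fix r s assume "r \<in> carrier kS \<and> s \<in> carrier kS"
    then show "aug_elem (r \<oplus>\<^bsub>kS\<^esub> s) = aug_elem r \<oplus>\<^bsub>res_scalars kS E.Kz\<^esub> aug_elem s"
      using mhom_add[OF h, of r s] by simp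
  next
    fix c r assume "c \<in> carrier k \<and> r \<in> carrier kS"
    then show "aug_elem (c \<odot>\<^bsub>kS\<^esub> r) = c \<odot>\<^bsub>res_scalars kS E.Kz\<^esub> aug_elem r"
      using mhom_smult[OF h, of c r] by simp
  qed
qed

abbreviation "kap w \<equiv> aug_elem (lt w)"

lemma kap_closed: "w \<in> carrier S \<Longrightarrow> kap w \<in> carrier E.Kz"
  by (rule aug_elem_closed[OF word_closed])

lemma hom_is_der:
  assumes h: "h \<in> mhom kS E.Kz N"
  shows "is_der (\<lambda>w. h (kap w))"
  unfolding is_der_def
proof (intro conjI ballI)
  fix w assume "w \<in> carrier S"
  then show "h (kap w) \<in> carrier N" by (rule E.hom_K_closed[OF h kap_closed])
next
  fix v w assume v: "v \<in> carrier S" and w: "w \<in> carrier S"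
  note c = word_closed[OF v] word_closed[OF w]
  have "kap (keep_first (v @ w)) =
      (lt v \<otimes>\<^bsub>kS\<^esub> aug (lt w) \<oplus>\<^bsub>kS\<^esub> (if set w \<subseteq> X then aug (lt v) else \<zero>\<^bsub>kS\<^esub>)) \<odot>\<^bsub>E.P0\<^esub> \<delta>"
    unfolding aug_elem_def aug_mult[OF v w] ..
  also have "\<dots> = lt v \<odot>\<^bsub>E.Kz\<^esub> kap w \<oplus>\<^bsub>E.Kz\<^esub> (if set w \<subseteq> X then kap v else \<zero>\<^bsub>E.Kz\<^esub>)"
    using c aug_closed[OF c(1)] aug_closed[OF c(2)] \<delta>_closed
    by (simp add: E.P0.smult_l_distr E.P0.smult_assoc E.P0.smult_zero_left aug_elem_def)
  finally have kap: "kap (keep_first (v @ w)) =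
      lt v \<odot>\<^bsub>E.Kz\<^esub> kap w \<oplus>\<^bsub>E.Kz\<^esub> (if set w \<subseteq> X then kap v else \<zero>\<^bsub>E.Kz\<^esub>)" .
  have z: "h \<zero>\<^bsub>E.Kz\<^esub> = \<zero>\<^bsub>N\<^esub>"
    by (rule module_hom_zero[OF E.Kz.M.abelian_group_axioms N.M.M.abelian_group_axioms h])
  have c1: "lt v \<odot>\<^bsub>E.Kz\<^esub> kap w \<in> carrier E.Kz" by (rule E.Kz.smult_closed[OF c(1) kap_closed[OF w]])
  have c2: "(if set w \<subseteq> X then kap v else \<zero>\<^bsub>E.Kz\<^esub>) \<in> carrier E.Kz"
    using kap_closed[OF v] E.Kz.M.zero_closed by (simp only: split: if_split) simp
  have "h (kap (keep_first (v @ w))) =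
      lt v \<odot>\<^bsub>N\<^esub> h (kap w) \<oplus>\<^bsub>N\<^esub> h (if set w \<subseteq> X then kap v else \<zero>\<^bsub>E.Kz\<^esub>)"
    unfolding kap mhom_add[OF h c1 c2]
      mhom_smult[OF h c(1) kap_closed[OF w]] ..
  also have "lt v \<odot>\<^bsub>N\<^esub> h (kap w) = (if set v \<subseteq> Y then h (kap w) else \<zero>\<^bsub>N\<^esub>)"
    by (rule N.word_smult[OF v E.hom_K_closed[OF h kap_closed[OF w]]])
  finally show "h (kap (keep_first (v @ w))) =
      (if set v \<subseteq> Y then h (kap w) else \<zero>\<^bsub>N\<^esub>) \<oplus>\<^bsub>N\<^esub> (if set w \<subseteq> X then h (kap v) else \<zero>\<^bsub>N\<^esub>)"
    using z by (simp only: if_distrib[of h])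
qed

text \<open>The cover P0 has a basis vector for every element of \<open>M\<close>, so the syzygy is
  larger than the span of the \<open>aug_elem r\<close>. An element of P0 is split into a part in
  the syzygy and a part in kS \<delta>. The extension is \<open>h\<close> on the first part and
  sends r \<delta> to r \<theta> on the second; on the syzygy it agrees with \<open>h\<close>,
  because there \<chi>(r) = 0.\<close>

lemma inner_hom_extends:
  assumes h: "h \<in> mhom kS E.Kz N" and \<theta>: "\<theta> \<in> carrier N"
    and inner: "\<And>w. w \<in> carrier S \<Longrightarrow> h (kap w) = inner_der \<theta> w"
  shows "\<exists>g\<in>mhom kS E.P0 N. \<forall>\<kappa>\<in>carrier E.Kz. h \<kappa> = g \<kappa>"
proof -
  note P0 = E.P0.left_module_axioms
  \<comment> \<open>Both sides are linear in \<open>r\<close>, and on words this is the assumption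
    that the derivation is inner.\<close>
  have aug_val: "h (aug_elem r) = r \<odot>\<^bsub>N\<^esub> \<theta> \<oplus>\<^bsub>N\<^esub> \<ominus>\<^bsub>N\<^esub> ((chi r \<odot>\<^bsub>kS\<^esub> \<one>\<^bsub>kS\<^esub>) \<odot>\<^bsub>N\<^esub> \<theta>)"
    if r: "r \<in> carrier kS" for r
  proof (rule kS_hom_eqI[OF N.Mk.left_module_axioms _ _ _ r])
    show "(\<lambda>r. h (aug_elem r)) \<in> mhom k kS N.Mk"
      by (rule module_hom_comp[OF aug_elem_hom SB.res_scalars_hom[OF h]])
    have 1: "(\<lambda>r. chi r \<odot>\<^bsub>kS\<^esub> \<one>\<^bsub>kS\<^esub>) \<in> mhom k kS kS"
      unfolding mhom_def
      by (auto simp: chi_closed SB.scalar_closed chi_add chi_smult SB.L.smult_l_distr SB.L.smult_assoc)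
    have 2: "(\<lambda>n. \<ominus>\<^bsub>N\<^esub> n) \<in> mhom k N.Mk N.Mk"
      unfolding mhom_def
      by (auto simp: N.M.M.minus_add N.M.M.a_comm N.M.smult_minus_right SB.scalar_closed)
    have "(\<lambda>r. r \<odot>\<^bsub>N\<^esub> \<theta> \<oplus>\<^bsub>N.Mk\<^esub> \<ominus>\<^bsub>N\<^esub> ((chi r \<odot>\<^bsub>kS\<^esub> \<one>\<^bsub>kS\<^esub>) \<odot>\<^bsub>N\<^esub> \<theta>)) \<in> mhom k kS N.Mk"
      by (rule module_hom_sum[OF N.Mk.M.abelian_group_axioms N.Mk.smult_r_distr
            SB.act_hom[OF N.left_module_M \<theta>]
            module_hom_comp[OF module_hom_comp[OF 1 SB.act_hom[OF N.left_module_M \<theta>]] 2]])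
    then show "(\<lambda>r. r \<odot>\<^bsub>N\<^esub> \<theta> \<oplus>\<^bsub>N\<^esub> \<ominus>\<^bsub>N\<^esub> ((chi r \<odot>\<^bsub>kS\<^esub> \<one>\<^bsub>kS\<^esub>) \<odot>\<^bsub>N\<^esub> \<theta>)) \<in> mhom k kS N.Mk"
      by simp
    fix w assume w: "w \<in> carrier S"
    show "h (kap w) = lt w \<odot>\<^bsub>N\<^esub> \<theta> \<oplus>\<^bsub>N\<^esub> \<ominus>\<^bsub>N\<^esub> ((chi (lt w) \<odot>\<^bsub>kS\<^esub> \<one>\<^bsub>kS\<^esub>) \<odot>\<^bsub>N\<^esub> \<theta>)"
      unfolding inner[OF w] inner_der_def chi_word[OF w] N.word_smult[OF w \<theta>]
      using \<theta> by (simp add: N.M.M.minus_eq SB.L.smult_one SB.L.smult_zero_left N.M.smult_one N.M.smult_zero_left)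
  qed
  have on_\<delta>: "h (r \<odot>\<^bsub>E.P0\<^esub> \<delta>) = r \<odot>\<^bsub>N\<^esub> \<theta>"
    if r: "r \<in> carrier kS" and K: "r \<odot>\<^bsub>E.P0\<^esub> \<delta> \<in> carrier E.Kz" for r
  proof -
    have "r \<odot>\<^bsub>M\<^esub> gM = \<zero>\<^bsub>M\<^esub>" using K cover_\<delta>[OF r] by simp
    then have chi: "chi r = \<zero>\<^bsub>k\<^esub>" by (simp add: chi_def M.coord_zero)
    have z: "chi r \<odot>\<^bsub>kS\<^esub> \<one>\<^bsub>kS\<^esub> = \<zero>\<^bsub>kS\<^esub>" unfolding chi by (rule SB.L.smult_zero_left) simp
    have "aug r = r" unfolding aug_def z using r by (simp add: SB.L.M.minus_eq)
    then show ?thesis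
      using aug_val[OF r] r \<theta> by (simp add: aug_elem_def z N.M.smult_zero_left N.M.smult_closed)
  qed
  \<comment> \<open>From each basis vector the multiple of \<delta> with the same image in
    \<open>M\<close> is subtracted, which leaves an element of the kernel.\<close>
  define \<rho> where "\<rho> m = basis_vec kS m \<oplus>\<^bsub>E.P0\<^esub> \<ominus>\<^bsub>E.P0\<^esub> ((M.coord m \<odot>\<^bsub>kS\<^esub> \<one>\<^bsub>kS\<^esub>) \<odot>\<^bsub>E.P0\<^esub> \<delta>)" for m
  have sc: "(M.coord m \<odot>\<^bsub>kS\<^esub> \<one>\<^bsub>kS\<^esub>) \<in> carrier kS" if "m \<in> carrier M" for m
    using SB.scalar_closed M.coord(1)[OF that] by blast
  have sd: "(M.coord m \<odot>\<^bsub>kS\<^esub> \<one>\<^bsub>kS\<^esub>) \<odot>\<^bsub>E.P0\<^esub> \<delta> \<in> carrier E.P0" if "m \<in> carrier M" for m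
    using E.P0.smult_closed[OF sc[OF that] \<delta>_closed] .
  note bv = M.M.basis_vec_free_cover
  have \<rho>K: "\<rho> m \<in> carrier E.Kz" if m: "m \<in> carrier M" for m
  proof -
    have minus: "cover_map kS M (\<ominus>\<^bsub>E.P0\<^esub> y) = \<ominus>\<^bsub>M\<^esub> cover_map kS M y" if "y \<in> carrier E.P0" for y
      by (rule additive_minus[OF E.P0.M.abelian_group_axioms M.M.M.abelian_group_axioms
            mhom_closed[OF M.M.cover_map_hom] _ that])
        (rule mhom_add[OF M.M.cover_map_hom])
    have "cover_map kS M (\<rho> m) = m \<oplus>\<^bsub>M\<^esub> \<ominus>\<^bsub>M\<^esub> m"
      unfolding \<rho>_def
      using mhom_add[OF M.M.cover_map_hom bv[OF m], of "\<ominus>\<^bsub>E.P0\<^esub> ((M.coord m \<odot>\<^bsub>kS\<^esub> \<one>\<^bsub>kS\<^esub>) \<odot>\<^bsub>E.P0\<^esub> \<delta>)"]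
        minus[OF sd[OF m]] cover_\<delta>[OF sc[OF m]] M.coord(2)[OF m] M.M.cover_map_basis_vec[OF m] sd[OF m] by simp
    then show ?thesis using m bv sd[OF m] by (simp add: \<rho>_def M.M.M.r_neg)
  qed
  define \<rho>' where "\<rho>' = lin_ext kS E.Kz \<rho>"
  define s' where "s' = lin_ext kS E.P0 (\<lambda>m. (M.coord m \<odot>\<^bsub>kS\<^esub> \<one>\<^bsub>kS\<^esub>) \<odot>\<^bsub>E.P0\<^esub> \<delta>)"
  \<comment> \<open>Extends the map r \<delta> to r \<theta> from kS \<delta> to P0 by zero on the
    other basis vectors.\<close>
  define \<tau> where "\<tau> = lin_ext kS N (\<lambda>m. if m = gM then \<theta> else \<zero>\<^bsub>N\<^esub>)"
  have \<rho>'h: "\<rho>' \<in> mhom kS E.P0 E.Kz"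
    unfolding \<rho>'_def free_cover_def using \<rho>K by (intro E.Kz.lin_ext_hom[unfolded free_cover_def]) (auto simp: free_cover_def)
  have s'h: "s' \<in> mhom kS E.P0 E.P0"
    using E.P0.lin_ext_hom[of "\<lambda>m. (M.coord m \<odot>\<^bsub>kS\<^esub> \<one>\<^bsub>kS\<^esub>) \<odot>\<^bsub>E.P0\<^esub> \<delta>" "carrier M"] sd
    by (simp add: s'_def free_cover_def)
  have \<tau>h: "\<tau> \<in> mhom kS E.P0 N"
    using N.M.lin_ext_hom[of "\<lambda>m. if m = gM then \<theta> else \<zero>\<^bsub>N\<^esub>" "carrier M"] \<theta>
    by (simp add: \<tau>_def free_cover_def)
  have \<rho>'P: "\<rho>' \<in> mhom kS E.P0 E.P0"
    using \<rho>'h unfolding mhom_def by (auto simp: Pi_iff)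
  have id: "(\<lambda>F. F) \<in> mhom kS E.P0 E.P0"
    unfolding mhom_def by auto
  have split: "F = \<rho>' F \<oplus>\<^bsub>E.P0\<^esub> s' F" if F: "F \<in> carrier E.P0" for F
  proof (rule M.M.free_cover_hom_eqI[OF P0 id _ _ F])
    show "(\<lambda>F. \<rho>' F \<oplus>\<^bsub>E.P0\<^esub> s' F) \<in> mhom kS E.P0 E.P0"
      by (rule module_hom_sum[OF E.P0.M.abelian_group_axioms E.P0.smult_r_distr \<rho>'P s'h])
    fix m assume m: "m \<in> carrier M"
    have "\<rho>' (basis_vec kS m) = \<rho> m" unfolding \<rho>'_def by (rule E.Kz.lin_ext_basis_vec[of \<rho> m, OF \<rho>K[OF m]])
    moreover have "s' (basis_vec kS m) = (M.coord m \<odot>\<^bsub>kS\<^esub> \<one>\<^bsub>kS\<^esub>) \<odot>\<^bsub>E.P0\<^esub> \<delta>"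
      unfolding s'_def by (rule E.P0.lin_ext_basis_vec) (rule sd[OF m])
    ultimately show "basis_vec kS m = \<rho>' (basis_vec kS m) \<oplus>\<^bsub>E.P0\<^esub> s' (basis_vec kS m)"
      using bv[OF m] sd[OF m] by (simp add: \<rho>_def E.P0.M.a_assoc E.P0.M.l_neg)
  qed
  have eval: "(\<lambda>F. F gM \<odot>\<^bsub>E.P0\<^esub> \<delta>) \<in> mhom kS E.P0 E.P0"
  proof -
    have 1: "F gM \<in> carrier kS" if "F \<in> carrier E.P0" for F
      using that by (simp add: free_cover_def free_module_carrier_iff)
    have 2: "(F \<oplus>\<^bsub>E.P0\<^esub> G) gM = F gM \<oplus>\<^bsub>kS\<^esub> G gM" "(r \<odot>\<^bsub>E.P0\<^esub> F) gM = r \<otimes>\<^bsub>kS\<^esub> F gM" for F G r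
      by (simp_all add: free_cover_def)
    show ?thesis
      unfolding mhom_def
      by (intro CollectI conjI allI impI funcsetI)
        (simp_all add: 1 2 E.P0.smult_closed \<delta>_closed E.P0.smult_l_distr E.P0.smult_assoc)
  qed
  \<comment> \<open>The image of s' lies in kS \<delta>, so the coordinate at \<open>gM\<close>
    recovers the algebra element.\<close>
  have s'\<delta>: "s' F = s' F gM \<odot>\<^bsub>E.P0\<^esub> \<delta>" if F: "F \<in> carrier E.P0" for F
  proof (rule M.M.free_cover_hom_eqI[OF P0 s'h _ _ F])
    show "(\<lambda>F. s' F gM \<odot>\<^bsub>E.P0\<^esub> \<delta>) \<in> mhom kS E.P0 E.P0"
      by (rule module_hom_comp[OF s'h eval])
    fix m assume m: "m \<in> carrier M"
    have b: "s' (basis_vec kS m) = (M.coord m \<odot>\<^bsub>kS\<^esub> \<one>\<^bsub>kS\<^esub>) \<odot>\<^bsub>E.P0\<^esub> \<delta>"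
      unfolding s'_def by (rule E.P0.lin_ext_basis_vec) (rule sd[OF m])
    have "((M.coord m \<odot>\<^bsub>kS\<^esub> \<one>\<^bsub>kS\<^esub>) \<odot>\<^bsub>E.P0\<^esub> \<delta>) gM = M.coord m \<odot>\<^bsub>kS\<^esub> \<one>\<^bsub>kS\<^esub>"
      using sc[OF m] by (simp add: free_cover_def basis_vec_def)
    then show "s' (basis_vec kS m) = s' (basis_vec kS m) gM \<odot>\<^bsub>E.P0\<^esub> \<delta>" unfolding b by simp
  qed
  have \<tau>\<delta>: "\<tau> (r \<odot>\<^bsub>E.P0\<^esub> \<delta>) = r \<odot>\<^bsub>N\<^esub> \<theta>" if "r \<in> carrier kS" for r
  proof -
    have "\<tau> \<delta> = \<theta>"
      unfolding \<tau>_def using N.M.lin_ext_basis_vec[of "\<lambda>m. if m = gM then \<theta> else \<zero>\<^bsub>N\<^esub>" gM] \<theta> by simp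
    then show ?thesis using mhom_smult[OF \<tau>h that \<delta>_closed] by simp
  qed
  have s'c: "s' F \<in> carrier E.P0" if "F \<in> carrier E.P0" for F
    using mhom_closed[OF s'h] that by auto
  have \<rho>'c: "\<rho>' F \<in> carrier E.Kz" if "F \<in> carrier E.P0" for F
    using mhom_closed[OF \<rho>'h] that by auto
  have g: "(\<lambda>F. h (\<rho>' F) \<oplus>\<^bsub>N\<^esub> \<tau> (s' F)) \<in> mhom kS E.P0 N"
    by (rule module_hom_sum[OF N.M.M.abelian_group_axioms N.M.smult_r_distr module_hom_comp[OF \<rho>'h h]
          module_hom_comp[OF s'h \<tau>h]])
  have hg: "h F = h (\<rho>' F) \<oplus>\<^bsub>N\<^esub> \<tau> (s' F)" if FK: "F \<in> carrier E.Kz" for F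
  proof -
    have F: "F \<in> carrier E.P0" using FK by simp
    have c: "cover_map kS M (s' F) = \<zero>\<^bsub>M\<^esub>"
    proof -
      have "\<zero>\<^bsub>M\<^esub> = cover_map kS M F" using FK by simp
      also have "\<dots> = cover_map kS M (\<rho>' F \<oplus>\<^bsub>E.P0\<^esub> s' F)" by (rule arg_cong[OF split[OF F]])
      also have "\<dots> = cover_map kS M (\<rho>' F) \<oplus>\<^bsub>M\<^esub> cover_map kS M (s' F)"
        using \<rho>'c[OF F] s'c[OF F] by (intro mhom_add[OF M.M.cover_map_hom]) simp_all
      also have "\<dots> = cover_map kS M (s' F)"
        using \<rho>'c[OF F] funcset_mem[OF mhom_closed[OF M.M.cover_map_hom] s'c[OF F]]
        by simp
      finally show ?thesis by simp
    qed
    then have sK: "s' F \<in> carrier E.Kz" using s'c[OF F] by simp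
    have rc: "s' F gM \<in> carrier kS" using s'c[OF F] by (simp add: free_cover_def free_module_carrier_iff)
    have sK': "s' F gM \<odot>\<^bsub>E.P0\<^esub> \<delta> \<in> carrier E.Kz" using sK s'\<delta>[OF F] by argo
    have "h (s' F) = h (s' F gM \<odot>\<^bsub>E.P0\<^esub> \<delta>)" by (rule arg_cong[OF s'\<delta>[OF F]])
    also have "\<dots> = \<tau> (s' F gM \<odot>\<^bsub>E.P0\<^esub> \<delta>)"
      using on_\<delta>[OF rc sK'] \<tau>\<delta>[OF rc] by (simp only:)
    also have "\<dots> = \<tau> (s' F)" by (rule arg_cong[OF s'\<delta>[OF F, symmetric]])
    finally have "h (s' F) = \<tau> (s' F)" .
    moreover have "h F = h (\<rho>' F \<oplus>\<^bsub>E.Kz\<^esub> s' F)"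
      unfolding syzygy_simps by (rule arg_cong[OF split[OF F]])
    moreover have "\<dots> = h (\<rho>' F) \<oplus>\<^bsub>N\<^esub> h (s' F)"
      by (rule mhom_add[OF h \<rho>'c[OF F] sK])
    ultimately show ?thesis by simp
  qed
  show ?thesis by (rule bexI[OF ballI g]) (rule hg)
qed

end

section \<open>Realising derivations by extensions\<close>

context char_pair
begin

definition Ek :: "('k, 'n \<times> 'm) module" where
  "Ek = \<lparr>carrier = carrier N \<times> carrier M, monoid.mult = undefined, one = undefined,
     zero = (\<zero>\<^bsub>N\<^esub>, \<zero>\<^bsub>M\<^esub>),
     add = (\<lambda>x y. (fst x \<oplus>\<^bsub>N\<^esub> fst y, snd x \<oplus>\<^bsub>M\<^esub> snd y)),
     smult = (\<lambda>c x. (c \<odot>\<^bsub>N.Mk\<^esub> fst x, c \<odot>\<^bsub>M.Mk\<^esub> snd x))\<rparr>"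

lemma Ek_simps [simp]:
  "carrier Ek = carrier N \<times> carrier M" "\<zero>\<^bsub>Ek\<^esub> = (\<zero>\<^bsub>N\<^esub>, \<zero>\<^bsub>M\<^esub>)"
  "x \<oplus>\<^bsub>Ek\<^esub> y = (fst x \<oplus>\<^bsub>N\<^esub> fst y, snd x \<oplus>\<^bsub>M\<^esub> snd y)"
  "c \<odot>\<^bsub>Ek\<^esub> x = (c \<odot>\<^bsub>N.Mk\<^esub> fst x, c \<odot>\<^bsub>M.Mk\<^esub> snd x)"
  by (simp_all add: Ek_def)

lemma Ek_left_module: "left_module k Ek"
proof -
  have grp: "abelian_group Ek"
  proof (rule abelian_groupI, goal_cases)
    case (6 x)
    then show ?case
      by (intro bexI[of _ "(\<ominus>\<^bsub>N\<^esub> fst x, \<ominus>\<^bsub>M\<^esub> snd x)"]) (auto simp: N.M.M.l_neg M.M.M.l_neg)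
  qed (auto simp: N.M.M.a_ac M.M.M.a_ac)
  note NN = N.Mk.smult_closed N.Mk.smult_l_distr N.Mk.smult_r_distr N.Mk.smult_assoc N.Mk.smult_one
    and MM = M.Mk.smult_closed M.Mk.smult_l_distr M.Mk.smult_r_distr M.Mk.smult_assoc M.Mk.smult_one
  show ?thesis
    by (intro left_module.intro left_module_axioms.intro K.ring_axioms grp)
      (use NN MM in \<open>auto simp del: res_scalars_simps(4)\<close>)
qed

text \<open>The extension of \<open>M\<close> by \<open>N\<close> that corresponds to the derivation \<open>d\<close>.\<close>

definition ext_act :: "('a list \<Rightarrow> 'n) \<Rightarrow> 'a list \<Rightarrow> 'n \<times> 'm \<Rightarrow> 'n \<times> 'm" where
  "ext_act d w x = ((if set w \<subseteq> Y then fst x else \<zero>\<^bsub>N\<^esub>) \<oplus>\<^bsub>N\<^esub> M.coord (snd x) \<odot>\<^bsub>N.Mk\<^esub> d w,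
     if set w \<subseteq> X then snd x else \<zero>\<^bsub>M\<^esub>)"

lemma coord_smult_closed: "\<lbrakk>m \<in> carrier M; n \<in> carrier N\<rbrakk> \<Longrightarrow> M.coord m \<odot>\<^bsub>N.Mk\<^esub> n \<in> carrier N"
  using N.Mk.smult_closed[OF M.coord(1), of m n] by simp

lemma ext_act_hom:
  assumes d: "is_der d" and w: "w \<in> carrier S"
  shows "ext_act d w \<in> mhom k Ek Ek"
proof -
  note dw = der_closed[OF d w]
  show ?thesis
    unfolding mhom_def
  proof (intro CollectI conjI allI impI funcsetI)
    fix x assume "x \<in> carrier Ek"
    then show "ext_act d w x \<in> carrier Ek"
      using coord_smult_closed[OF _ dw, of "snd x"] by (auto simp: ext_act_def simp del: res_scalars_simps(4))
  next
    fix x y assume "x \<in> carrier Ek \<and> y \<in> carrier Ek"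
    then obtain n m n' m' where xy: "x = (n, m)" "y = (n', m')" "n \<in> carrier N" "m \<in> carrier M"
      "n' \<in> carrier N" "m' \<in> carrier M" by auto
    have "M.coord (m \<oplus>\<^bsub>M\<^esub> m') \<odot>\<^bsub>N.Mk\<^esub> d w = M.coord m \<odot>\<^bsub>N.Mk\<^esub> d w \<oplus>\<^bsub>N\<^esub> M.coord m' \<odot>\<^bsub>N.Mk\<^esub> d w"
      using N.Mk.smult_l_distr[OF M.coord(1)[OF xy(4)] M.coord(1)[OF xy(6)], of "d w"] dw
      by (simp add: M.coord_add[OF xy(4,6)] del: res_scalars_simps(4))
    then show "ext_act d w (x \<oplus>\<^bsub>Ek\<^esub> y) = ext_act d w x \<oplus>\<^bsub>Ek\<^esub> ext_act d w y"
      using xy coord_smult_closed[OF xy(4) dw] coord_smult_closed[OF xy(6) dw]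
      by (simp add: ext_act_def N.M.M.a_ac del: res_scalars_simps(4))
  next
    fix c x assume cx: "c \<in> carrier k \<and> x \<in> carrier Ek"
    then obtain n m where x: "x = (n, m)" "n \<in> carrier N" "m \<in> carrier M" and c: "c \<in> carrier k" by auto
    have "M.coord (c \<odot>\<^bsub>M.Mk\<^esub> m) \<odot>\<^bsub>N.Mk\<^esub> d w = c \<odot>\<^bsub>N.Mk\<^esub> (M.coord m \<odot>\<^bsub>N.Mk\<^esub> d w)"
      using N.Mk.smult_assoc[OF c M.coord(1)[OF x(3)], of "d w"] dw
      by (simp add: M.coord_smult[OF c x(3)] del: res_scalars_simps(4))
    then show "ext_act d w (c \<odot>\<^bsub>Ek\<^esub> x) = c \<odot>\<^bsub>Ek\<^esub> ext_act d w x"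
      using x c coord_smult_closed[OF x(3) dw] N.Mk.smult_r_distr[OF c, of n "M.coord m \<odot>\<^bsub>N.Mk\<^esub> d w"]
        N.Mk.smult_r_distr[OF c, of "\<zero>\<^bsub>N\<^esub>" "M.coord m \<odot>\<^bsub>N.Mk\<^esub> d w"]
        N.Mk.smult_zero_right[OF c] M.Mk.smult_zero_right[OF c]
        N.Mk.smult_closed[OF c, of "M.coord m \<odot>\<^bsub>N.Mk\<^esub> d w"]
      by (simp add: ext_act_def del: res_scalars_simps(4))
  qed
qed

text \<open>The action is triangular, and the Leibniz rule is exactly the multiplicativity of its
  off-diagonal entry.\<close>

lemma ext_act_mult:
  assumes d: "is_der d" and v: "v \<in> carrier S" and w: "w \<in> carrier S" and x: "x \<in> carrier Ek"
  shows "ext_act d (keep_first (v @ w)) x = ext_act d v (ext_act d w x)"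
proof -
  obtain n m where nm: "x = (n, m)" "n \<in> carrier N" "m \<in> carrier M" using x by auto
  note dv = der_closed[OF d v] and dw = der_closed[OF d w]
  note cv = coord_smult_closed[OF nm(3) dv] and cw = coord_smult_closed[OF nm(3) dw]
  have z: "M.coord \<zero>\<^bsub>M\<^esub> \<odot>\<^bsub>N.Mk\<^esub> d v = \<zero>\<^bsub>N\<^esub>"
    unfolding M.coord_zero using N.Mk.smult_zero_left[of "d v"] dv by simp
  have "M.coord m \<odot>\<^bsub>N.Mk\<^esub> d (keep_first (v @ w)) =
      (if set v \<subseteq> Y then M.coord m \<odot>\<^bsub>N.Mk\<^esub> d w else \<zero>\<^bsub>N\<^esub>) \<oplus>\<^bsub>N\<^esub>
      (if set w \<subseteq> X then M.coord m \<odot>\<^bsub>N.Mk\<^esub> d v else \<zero>\<^bsub>N\<^esub>)"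
    unfolding der_mult[OF d v w]
    using N.Mk.smult_r_distr[OF M.coord(1)[OF nm(3)], of "d w" "d v"]
      N.Mk.smult_zero_right[OF M.coord(1)[OF nm(3)]] dv dw cv cw
    by (simp del: res_scalars_simps(4))
  then show ?thesis
    using nm cv cw z by (simp add: ext_act_def N.M.M.a_assoc del: res_scalars_simps(4))
qed

text \<open>Sending each basis vector m to (0, m) lifts the cover of \<open>M\<close> to the
  extension. On the syzygy the second component vanishes, so the first one is a homomorphism into
  \<open>N\<close>. At \<open>kap w\<close> its value is the first component of w (0, gM) -
  \<chi>(w) (0, gM), that is \<open>d w\<close>.\<close>

lemma der_hom_exists:
  assumes d: "is_der d"
  shows "\<exists>h\<in>mhom kS E.Kz N. \<forall>w\<in>carrier S. h (kap w) = d w"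
proof -
  have one: "ext_act d [] x = x" if x: "x \<in> carrier Ek" for x
  proof -
    obtain n m where nm: "x = (n, m)" "n \<in> carrier N" "m \<in> carrier M" using x by auto
    have "M.coord m \<odot>\<^bsub>N.Mk\<^esub> d [] = \<zero>\<^bsub>N\<^esub>"
      using N.Mk.smult_zero_right[OF M.coord(1)[OF nm(3)]] by (simp add: der_Nil[OF d])
    then show ?thesis using nm by (simp add: ext_act_def del: res_scalars_simps(4))
  qed
  define E' where "E' = rep_module k Ek (ext_act d)"
  note rep = rep_module_left_module[OF Ek_left_module ext_act_hom[OF d] ext_act_mult[OF d] one]
  interpret E': left_module kS E' unfolding E'_def by (rule rep(1))
  have E'w: "lt w \<odot>\<^bsub>E'\<^esub> x = ext_act d w x" if "w \<in> carrier S" "x \<in> carrier N \<times> carrier M" for w x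
    unfolding E'_def using rep(2)[of w x] that by simp
  have [simp]: "carrier E' = carrier N \<times> carrier M" "\<zero>\<^bsub>E'\<^esub> = (\<zero>\<^bsub>N\<^esub>, \<zero>\<^bsub>M\<^esub>)"
    "\<And>x y. x \<oplus>\<^bsub>E'\<^esub> y = (fst x \<oplus>\<^bsub>N\<^esub> fst y, snd x \<oplus>\<^bsub>M\<^esub> snd y)"
    unfolding E'_def by simp_all
  define l where "l = lin_ext kS E' (\<lambda>m. (\<zero>\<^bsub>N\<^esub>, m))"
  have lh: "l \<in> mhom kS E.P0 E'"
    using E'.lin_ext_hom[of "\<lambda>m. (\<zero>\<^bsub>N\<^esub>, m)" "carrier M"] by (simp add: l_def free_cover_def)
  have lc: "l F \<in> carrier N \<times> carrier M" if "F \<in> carrier E.P0" for F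
    using funcset_mem[OF mhom_closed[OF lh] that] by simp
  have lb: "l (basis_vec kS m) = (\<zero>\<^bsub>N\<^esub>, m)" if "m \<in> carrier M" for m
    unfolding l_def by (rule E'.lin_ext_basis_vec) (simp add: that)
  \<comment> \<open>The second projection of the extension onto \<open>M\<close> is linear, which
    identifies the second component of the lift with the cover map.\<close>
  have snd_smult: "snd (r \<odot>\<^bsub>E'\<^esub> x) = r \<odot>\<^bsub>M\<^esub> snd x"
    if r: "r \<in> carrier kS" and x: "x \<in> carrier N \<times> carrier M" for r x
  proof (rule kS_hom_eqI[OF M.Mk.left_module_axioms _ _ _ r])
    have "(\<lambda>x. snd x) \<in> mhom k (res_scalars kS E') M.Mk"
      unfolding mhom_def
      using rep(3) by (auto simp: E'_def simp del: rep_module_simps(4))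
    then show "(\<lambda>r. snd (r \<odot>\<^bsub>E'\<^esub> x)) \<in> mhom k kS M.Mk"
      using x by (intro module_hom_comp[OF SB.act_hom[OF E'.left_module_axioms]]) auto
    show "(\<lambda>r. r \<odot>\<^bsub>M\<^esub> snd x) \<in> mhom k kS M.Mk"
      using x by (intro SB.act_hom[OF M.left_module_M]) auto
    fix w assume w: "w \<in> carrier S"
    have "snd x \<in> carrier M" using x by auto
    then show "snd (lt w \<odot>\<^bsub>E'\<^esub> x) = lt w \<odot>\<^bsub>M\<^esub> snd x"
      unfolding E'w[OF w x] using M.word_smult[OF w, of "snd x"] by (simp add: ext_act_def)
  qed
  have snd_l: "snd (l F) = cover_map kS M F" if F: "F \<in> carrier E.P0" for F
  proof (rule M.M.free_cover_hom_eqI[OF M.left_module_M _ M.M.cover_map_hom _ F])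
    have "(\<lambda>x. snd x) \<in> mhom kS E' M"
      unfolding mhom_def using snd_smult by auto
    then show "(\<lambda>F. snd (l F)) \<in> mhom kS E.P0 M"
      by (rule module_hom_comp[OF lh])
    show "snd (l (basis_vec kS m)) = cover_map kS M (basis_vec kS m)" if "m \<in> carrier M" for m
      using lb[OF that] M.M.cover_map_basis_vec[OF that] by simp
  qed
  \<comment> \<open>\<open>N\<close> sits in the extension as a submodule, since the off-diagonal
    entry is multiplied by the coordinate of the second component.\<close>
  have fst_smult: "r \<odot>\<^bsub>E'\<^esub> (n, \<zero>\<^bsub>M\<^esub>) = (r \<odot>\<^bsub>N\<^esub> n, \<zero>\<^bsub>M\<^esub>)"
    if r: "r \<in> carrier kS" and n: "n \<in> carrier N" for r n
  proof (rule kS_hom_eqI[OF SB.res_scalars_left_module[OF E'.left_module_axioms] _ _ _ r])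
    show "(\<lambda>r. r \<odot>\<^bsub>E'\<^esub> (n, \<zero>\<^bsub>M\<^esub>)) \<in> mhom k kS (res_scalars kS E')"
      using n by (intro SB.act_hom[OF E'.left_module_axioms]) simp
    have "(\<lambda>n. (n, \<zero>\<^bsub>M\<^esub>)) \<in> mhom k N.Mk (res_scalars kS E')"
      unfolding mhom_def
      using rep(3) M.Mk.smult_zero_right by (auto simp: E'_def simp del: rep_module_simps(4))
    then show "(\<lambda>r. (r \<odot>\<^bsub>N\<^esub> n, \<zero>\<^bsub>M\<^esub>)) \<in> mhom k kS (res_scalars kS E')"
      by (rule module_hom_comp[OF SB.act_hom[OF N.left_module_M n]])
    fix w assume w: "w \<in> carrier S"
    have z: "M.coord \<zero>\<^bsub>M\<^esub> \<odot>\<^bsub>N.Mk\<^esub> d w = \<zero>\<^bsub>N\<^esub>"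
      unfolding M.coord_zero using N.Mk.smult_zero_left[of "d w"] der_closed[OF d w] by simp
    have "lt w \<odot>\<^bsub>E'\<^esub> (n, \<zero>\<^bsub>M\<^esub>) = ext_act d w (n, \<zero>\<^bsub>M\<^esub>)" using n by (intro E'w[OF w]) simp
    then show "lt w \<odot>\<^bsub>E'\<^esub> (n, \<zero>\<^bsub>M\<^esub>) = (lt w \<odot>\<^bsub>N\<^esub> n, \<zero>\<^bsub>M\<^esub>)"
      using N.word_smult[OF w n] z n by (simp add: ext_act_def del: res_scalars_simps(4))
  qed
  have lK: "l F = (fst (l F), \<zero>\<^bsub>M\<^esub>)" if "F \<in> carrier E.Kz" for F
    using snd_l[of F] that by (simp add: prod_eq_iff)
  have fc: "fst (l F) \<in> carrier N" if "F \<in> carrier E.Kz" for F using lc[of F] that by auto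
  have "(\<lambda>F. fst (l F)) \<in> mhom kS E.Kz N"
    unfolding mhom_def
  proof (intro CollectI conjI allI impI funcsetI)
    fix F assume "F \<in> carrier E.Kz" then show "fst (l F) \<in> carrier N" by (rule fc)
  next
    fix F G assume "F \<in> carrier E.Kz \<and> G \<in> carrier E.Kz"
    then show "fst (l (F \<oplus>\<^bsub>E.Kz\<^esub> G)) = fst (l F) \<oplus>\<^bsub>N\<^esub> fst (l G)"
      using mhom_add[OF lh, of F G] by simp
  next
    fix r F assume rF: "r \<in> carrier kS \<and> F \<in> carrier E.Kz"
    then have "l (r \<odot>\<^bsub>E.Kz\<^esub> F) = r \<odot>\<^bsub>E'\<^esub> l F"
      using mhom_smult[OF lh, of r F] by simp
    also have "\<dots> = r \<odot>\<^bsub>E'\<^esub> (fst (l F), \<zero>\<^bsub>M\<^esub>)" by (rule arg_cong[OF lK]) (use rF in blast)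
    also have "\<dots> = (r \<odot>\<^bsub>N\<^esub> fst (l F), \<zero>\<^bsub>M\<^esub>)" using rF fc by (intro fst_smult) auto
    finally show "fst (l (r \<odot>\<^bsub>E.Kz\<^esub> F)) = r \<odot>\<^bsub>N\<^esub> fst (l F)" by simp
  qed
  moreover have "fst (l (kap w)) = d w" if w: "w \<in> carrier S" for w
  proof -
    let ?e = "if set w \<subseteq> X then \<one>\<^bsub>kS\<^esub> else \<zero>\<^bsub>kS\<^esub>"
    have ec: "?e \<in> carrier kS" by simp
    have x: "(\<zero>\<^bsub>N\<^esub>, gM) \<in> carrier E'" using M.gen_closed by simp
    have "l (kap w) = aug (lt w) \<odot>\<^bsub>E'\<^esub> (\<zero>\<^bsub>N\<^esub>, gM)"
      unfolding aug_elem_def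
      using mhom_smult[OF lh aug_closed[OF word_closed[OF w]] \<delta>_closed]
        lb[OF M.gen_closed] by simp
    also have "\<dots> = lt w \<odot>\<^bsub>E'\<^esub> (\<zero>\<^bsub>N\<^esub>, gM) \<oplus>\<^bsub>E'\<^esub> (\<ominus>\<^bsub>kS\<^esub> ?e) \<odot>\<^bsub>E'\<^esub> (\<zero>\<^bsub>N\<^esub>, gM)"
      unfolding aug_word[OF w] SB.L.M.minus_eq
      by (rule E'.smult_l_distr[OF word_closed[OF w] _ x]) simp
    also have "(\<ominus>\<^bsub>kS\<^esub> ?e) \<odot>\<^bsub>E'\<^esub> (\<zero>\<^bsub>N\<^esub>, gM) = \<ominus>\<^bsub>E'\<^esub> (?e \<odot>\<^bsub>E'\<^esub> (\<zero>\<^bsub>N\<^esub>, gM))"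
      by (rule E'.smult_minus_left[OF ec x])
    also have "?e \<odot>\<^bsub>E'\<^esub> (\<zero>\<^bsub>N\<^esub>, gM) = (\<zero>\<^bsub>N\<^esub>, if set w \<subseteq> X then gM else \<zero>\<^bsub>M\<^esub>)"
      using E'.smult_one[OF x] E'.smult_zero_left[OF x] by simp
    also have "\<ominus>\<^bsub>E'\<^esub> (\<zero>\<^bsub>N\<^esub>, if set w \<subseteq> X then gM else \<zero>\<^bsub>M\<^esub>) =
        (\<zero>\<^bsub>N\<^esub>, \<ominus>\<^bsub>M\<^esub> (if set w \<subseteq> X then gM else \<zero>\<^bsub>M\<^esub>))"
      by (rule E'.M.minus_equality) (use M.gen_closed in \<open>simp_all add: M.M.M.l_neg\<close>)
    also have "lt w \<odot>\<^bsub>E'\<^esub> (\<zero>\<^bsub>N\<^esub>, gM) = ext_act d w (\<zero>\<^bsub>N\<^esub>, gM)" using M.gen_closed by (intro E'w[OF w]) simp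
    finally have "fst (l (kap w)) = M.coord gM \<odot>\<^bsub>N.Mk\<^esub> d w"
      using coord_smult_closed[OF M.gen_closed der_closed[OF d w]]
      by (simp add: ext_act_def del: res_scalars_simps(4))
    then show ?thesis
      using N.Mk.smult_one[of "d w"] der_closed[OF d w] by (simp add: M.coord_gen)
  qed
  ultimately show ?thesis by (intro bexI[of _ "\<lambda>F. fst (l F)"] ballI)
qed

text \<open>Supplies derivations with arbitrary values on the letters of X - Y. The first letter of
  v w outside \<open>Y\<close> is that of \<open>v\<close>, unless \<open>v\<close> stays inside
  \<open>Y\<close>, in which case it is that of \<open>w\<close>.\<close>

lemma first_letter_is_der:
  assumes YX: "Y \<subseteq> X" and \<tau>: "\<And>a. a \<in> A \<Longrightarrow> \<tau> a \<in> carrier N"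
  shows "is_der (\<lambda>w. if set w \<subseteq> X \<and> \<not> set w \<subseteq> Y then \<tau> (hd (filter (\<lambda>a. a \<notin> Y) w)) else \<zero>\<^bsub>N\<^esub>)"
    (is "is_der ?d")
proof -
  have hdA: "hd (filter (\<lambda>a. a \<notin> Y) w) \<in> A" if "w \<in> carrier S" "\<not> set w \<subseteq> Y" for w
  proof -
    have "filter (\<lambda>a. a \<notin> Y) w \<noteq> []" using that(2) by (auto simp: filter_empty_conv)
    then have "hd (filter (\<lambda>a. a \<notin> Y) w) \<in> set (filter (\<lambda>a. a \<notin> Y) w)" by (rule hd_in_set)
    then show ?thesis using that(1) by auto
  qed
  have dc: "?d w \<in> carrier N" if "w \<in> carrier S" for w
    using hdA[OF that] \<tau> by simp
  have dm: "?d (keep_first (v @ w)) = (if set v \<subseteq> Y then ?d w else \<zero>\<^bsub>N\<^esub>) \<oplus>\<^bsub>N\<^esub> (if set w \<subseteq> X then ?d v else \<zero>\<^bsub>N\<^esub>)"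
    if v: "v \<in> carrier S" and w: "w \<in> carrier S" for v w
  proof -
    have kf: "keep_first (v @ w) = v @ filter (\<lambda>y. y \<notin> set v) w"
      using v w by (simp add: keep_first_append keep_first_distinct)
    show ?thesis
    proof (cases "set v \<subseteq> Y")
      case True
      have "filter (\<lambda>a. a \<notin> Y) v = []" using True by (auto simp: filter_empty_conv)
      \<comment> \<open>The product deletes only letters of \<open>v\<close>, all of which are in
        \<open>Y\<close> here, so the letters outside \<open>Y\<close> are unaffected.\<close>
      moreover have "filter (\<lambda>a. a \<notin> Y) (filter (\<lambda>y. y \<notin> set v) w) = filter (\<lambda>a. a \<notin> Y) w"
        using True by (auto intro!: filter_cong)
      ultimately have f: "filter (\<lambda>a. a \<notin> Y) (keep_first (v @ w)) = filter (\<lambda>a. a \<notin> Y) w" by (simp add: kf)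
      have "?d (keep_first (v @ w)) = ?d w" unfolding f using True YX by auto
      moreover have "?d v = \<zero>\<^bsub>N\<^esub>" using True by simp
      ultimately show ?thesis using True dc[OF w] by simp
    next
      case False
      then have "filter (\<lambda>a. a \<notin> Y) v \<noteq> []" by (auto simp: filter_empty_conv)
      then have "hd (filter (\<lambda>a. a \<notin> Y) (keep_first (v @ w))) = hd (filter (\<lambda>a. a \<notin> Y) v)" by (simp add: kf)
      then have "?d (keep_first (v @ w)) = (if set w \<subseteq> X then ?d v else \<zero>\<^bsub>N\<^esub>)"
        using False by auto
      then show ?thesis using False dc[OF v] by simp
    qed
  qed
  show ?thesis unfolding is_der_def by (intro conjI ballI dc dm)
qed

text \<open>A cocycle is mapped to the differences between its values at the letters of X - Y and
  its value at one reference letter. The differences vanish exactly when the value is the same at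
  all these letters, which characterises the coboundaries.\<close>

lemma dim_ext1:
  assumes fin: "finite A" and XY: "X \<subseteq> A" "Y \<subseteq> A"
  shows "vectorspace.dim k (ext1 kS M N) = (if Y \<subseteq> X then card (X - Y) - 1 else 0)"
proof -
  \<comment> \<open>The reference letter; an arbitrary choice, independent of the order that defines
    leaders.\<close>
  define a0 where "a0 = (SOME a. a \<in> X - Y)"
  have a0: "a0 \<in> X - Y" if "X - Y \<noteq> {}" unfolding a0_def by (rule someI_ex) (use that in auto)
  \<comment> \<open>For X = Y this set is empty as well, in agreement with the truncated subtraction
    0 - 1 = 0.\<close>
  define I where "I = (if Y \<subseteq> X then X - Y - {a0} else {})"
  have finXY: "finite (X - Y)" using finite_subset[OF XY(1) fin] by simp
  have finI: "finite I" using finXY by (simp add: I_def)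
  have cardI: "card I = (if Y \<subseteq> X then card (X - Y) - 1 else 0)"
    using a0 finXY by (cases "X - Y = {}") (auto simp: I_def)
  have a0I: "a0 \<in> X - Y \<and> Y \<subseteq> X" if "i \<in> I" for i using that a0 by (auto simp: I_def split: if_splits)
  have IS: "[i] \<in> carrier S" "[a0] \<in> carrier S" if "i \<in> I" for i
    using that a0I[OF that] XY by (auto simp: I_def split: if_splits)
  define ev where "ev f w = N.coord (f (basis_vec kS (kap w)))" for f w
  define \<Phi> where "\<Phi> f i = (if i \<in> I then ev f [i] \<ominus>\<^bsub>k\<^esub> ev f [a0] else \<zero>\<^bsub>k\<^esub>)" for f i
  let ?F = "free_module k I"
  have FI: "\<phi> \<in> carrier ?F \<longleftrightarrow> (\<forall>i. \<phi> i \<in> carrier k) \<and> (\<forall>i. i \<notin> I \<longrightarrow> \<phi> i = \<zero>\<^bsub>k\<^esub>)" for \<phi>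
    using finite_subset[of "{i. \<phi> i \<noteq> \<zero>\<^bsub>k\<^esub>}" I] finI by (auto simp: free_module_carrier_iff)
  have hc: "f (basis_vec kS (kap w)) \<in> carrier N" if "f \<in> carrier E.V" "w \<in> carrier S" for f w
    using E.hom_K_closed[OF E.V_cob(1)[OF that(1)] kap_closed[OF that(2)]] .
  have evc: "ev f w \<in> carrier k" if "f \<in> carrier E.V" "w \<in> carrier S" for f w
    unfolding ev_def using N.coord(1)[OF hc[OF that]] .
  have bvP1: "basis_vec kS (kap w) \<in> carrier E.P1" if "w \<in> carrier S" for w
    by (rule E.Kz.basis_vec_free_cover[OF kap_closed[OF that]])
  have ev_add: "ev (f \<oplus>\<^bsub>E.V\<^esub> g) w = ev f w \<oplus>\<^bsub>k\<^esub> ev g w"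
    if "f \<in> carrier E.V" "g \<in> carrier E.V" "w \<in> carrier S" for f g w
    unfolding ev_def E.V_ops using bvP1[OF that(3)] hc that by (simp add: N.coord_add)
  have ev_smult: "ev (c \<odot>\<^bsub>E.V\<^esub> f) w = c \<otimes>\<^bsub>k\<^esub> ev f w"
    if "c \<in> carrier k" "f \<in> carrier E.V" "w \<in> carrier S" for c f w
    unfolding ev_def E.V_ops using bvP1[OF that(3)] N.coord_smult[OF that(1) hc[OF that(2,3)]] by simp
  have ev_cob: "ev (E.cob h) w = N.coord (h (kap w))" if "w \<in> carrier S" for h w
    unfolding ev_def E.cob_basis_vec[OF kap_closed[OF that]] ..
  have \<Phi>hom: "\<Phi> \<in> mhom k E.V ?F"
    unfolding mhom_def
  proof (intro CollectI conjI allI impI funcsetI)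
    fix f assume "f \<in> carrier E.V"
    then show "\<Phi> f \<in> carrier ?F" using evc IS by (auto simp: FI \<Phi>_def)
  next
    fix f g assume "f \<in> carrier E.V \<and> g \<in> carrier E.V"
    then have f: "f \<in> carrier E.V" and g: "g \<in> carrier E.V" by auto
    have "\<Phi> (f \<oplus>\<^bsub>E.V\<^esub> g) i = \<Phi> f i \<oplus>\<^bsub>k\<^esub> \<Phi> g i" for i
    proof (cases "i \<in> I")
      case True
      note s = IS[OF True]
      show ?thesis
        using True ev_add[OF f g s(1)] ev_add[OF f g s(2)] evc[OF f s(1)] evc[OF f s(2)] evc[OF g s(1)] evc[OF g s(2)]
        by (simp add: \<Phi>_def K.minus_eq K.minus_add K.a_ac)
    qed (simp add: \<Phi>_def)
    then show "\<Phi> (f \<oplus>\<^bsub>E.V\<^esub> g) = \<Phi> f \<oplus>\<^bsub>?F\<^esub> \<Phi> g" by (simp add: fun_eq_iff)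
  next
    fix c f assume "c \<in> carrier k \<and> f \<in> carrier E.V"
    then have c: "c \<in> carrier k" and f: "f \<in> carrier E.V" by auto
    have "\<Phi> (c \<odot>\<^bsub>E.V\<^esub> f) i = c \<otimes>\<^bsub>k\<^esub> \<Phi> f i" for i
    proof (cases "i \<in> I")
      case True
      note s = IS[OF True]
      show ?thesis
        using True c ev_smult[OF c f s(1)] ev_smult[OF c f s(2)] evc[OF f s(1)] evc[OF f s(2)]
        by (simp add: \<Phi>_def K.minus_eq K.r_distr K.r_minus)
    qed (use c in \<open>simp add: \<Phi>_def\<close>)
    then show "\<Phi> (c \<odot>\<^bsub>E.V\<^esub> f) = c \<odot>\<^bsub>?F\<^esub> \<Phi> f" by (simp add: fun_eq_iff)
  qed
  have surj: "\<exists>f\<in>carrier E.V. \<Phi> f = \<phi>" if \<phi>: "\<phi> \<in> carrier ?F" for \<phi>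
  proof (cases "I = {}")
    case True
    have "\<Phi> f = \<phi>" for f using \<phi>[unfolded FI] True by (auto simp: \<Phi>_def fun_eq_iff)
    then show ?thesis
      using abelian_monoid.zero_closed[OF abelian_group.axioms(1)[OF E.V_abelian_group]]
      by (intro bexI[of _ "\<zero>\<^bsub>E.V\<^esub>"])
  next
    case False
    then obtain i0 where "i0 \<in> I" by auto
    then have a: "a0 \<in> X - Y" "Y \<subseteq> X" "[a0] \<in> carrier S" using a0I IS by auto
    have \<phi>c: "\<phi> i \<in> carrier k" for i using \<phi> by (simp add: FI)
    \<comment> \<open>The prescribed scalars as elements of \<open>N\<close>. At \<open>a0\<close>
      the value is zero because \<open>a0\<close> is outside \<open>I\<close>, so the differences
      reproduce \<phi>.\<close>
    define \<tau> where "\<tau> a = \<phi> a \<odot>\<^bsub>N.Mk\<^esub> gN" for a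
    have \<tau>c: "\<tau> a \<in> carrier N" for a
      unfolding \<tau>_def using N.Mk.smult_closed[OF \<phi>c, of gN] N.gen_closed by simp
    let ?d = "\<lambda>w. if set w \<subseteq> X \<and> \<not> set w \<subseteq> Y then \<tau> (hd (filter (\<lambda>a. a \<notin> Y) w)) else \<zero>\<^bsub>N\<^esub>"
    obtain h where h: "h \<in> mhom kS E.Kz N" and hk: "\<forall>w\<in>carrier S. h (kap w) = ?d w"
      using der_hom_exists[OF first_letter_is_der[of \<tau>, OF a(2) \<tau>c]] by (elim bexE)
    have val: "ev (E.cob h) [b] = \<phi> b" if b: "b \<in> X - Y" for b
    proof -
      have bS: "[b] \<in> carrier S" using b XY by auto
      have "h (kap [b]) = \<tau> b" using hk bS b by simp
      then show ?thesis unfolding ev_cob[OF bS] \<tau>_def using N.coord_scalar[OF \<phi>c] by simp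
    qed
    have out: "\<phi> i = \<zero>\<^bsub>k\<^esub>" if "i \<notin> I" for i using \<phi>[unfolded FI] that by blast
    have "a0 \<notin> I" by (simp add: I_def)
    have "\<Phi> (E.cob h) i = \<phi> i" for i
    proof (cases "i \<in> I")
      case True
      then have "i \<in> X - Y" by (auto simp: I_def split: if_splits)
      then show ?thesis
        using True val[OF a(1)] val[of i] out[OF \<open>a0 \<notin> I\<close>] \<phi>c[of i] by (simp add: \<Phi>_def K.minus_eq)
    qed (simp add: \<Phi>_def out)
    then show ?thesis using E.cob_in_V[OF h] by (intro bexI[of _ "E.cob h"]) auto
  qed
  have ker: "ext1_coboundaries kS M N = {f \<in> carrier E.V. \<Phi> f = \<zero>\<^bsub>?F\<^esub>}"
  proof
    show "ext1_coboundaries kS M N \<subseteq> {f \<in> carrier E.V. \<Phi> f = \<zero>\<^bsub>?F\<^esub>}"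
    proof
      fix f assume "f \<in> ext1_coboundaries kS M N"
      then obtain g where g: "g \<in> mhom kS E.P0 N" "f = E.cob g"
        unfolding E.coboundaries_eq by auto
      have gK: "g \<in> mhom kS E.Kz N" by (rule E.hom_P0_K[OF g(1)])
      define \<theta> where "\<theta> = g \<delta>"
      have \<theta>: "\<theta> \<in> carrier N" unfolding \<theta>_def
        using funcset_mem[OF mhom_closed[OF g(1)] \<delta>_closed] .
      \<comment> \<open>Such a letter acts as zero on \<open>N\<close> and as one on
        \<open>M\<close>, so the value does not depend on the letter.\<close>
      have kv: "g (kap [b]) = \<ominus>\<^bsub>N\<^esub> \<theta>" if b: "b \<in> X - Y" for b
      proof -
        have bS: "[b] \<in> carrier S" using b XY by auto
        have "g (kap [b]) = aug (lt [b]) \<odot>\<^bsub>N\<^esub> \<theta>"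
          unfolding aug_elem_def \<theta>_def
          by (rule mhom_smult[OF g(1) aug_closed[OF word_closed[OF bS]] \<delta>_closed])
        also have "\<dots> = lt [b] \<odot>\<^bsub>N\<^esub> \<theta> \<oplus>\<^bsub>N\<^esub> \<ominus>\<^bsub>N\<^esub> \<theta>"
          unfolding aug_word[OF bS] using b \<theta> word_closed[OF bS]
          by (simp add: SB.L.M.minus_eq N.M.smult_l_distr N.M.smult_minus_left N.M.smult_one)
        also have "\<dots> = \<ominus>\<^bsub>N\<^esub> \<theta>" using N.word_smult[OF bS \<theta>] b \<theta> by simp
        finally show ?thesis .
      qed
      have "\<Phi> f i = \<zero>\<^bsub>k\<^esub>" for i
      proof (cases "i \<in> I")
        case True
        note s = IS[OF True]
        have "i \<in> X - Y" using True by (auto simp: I_def split: if_splits)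
        then have "ev f [i] = ev f [a0]"
          unfolding g(2) ev_cob[OF s(1)] ev_cob[OF s(2)] using kv a0I[OF True] by simp
        then show ?thesis using True evc[OF E.cob_in_V[OF gK] s(2)] g(2) by (simp add: \<Phi>_def K.minus_eq K.r_neg)
      qed (simp add: \<Phi>_def)
      then have "\<Phi> f = \<zero>\<^bsub>?F\<^esub>" by (simp add: fun_eq_iff)
      then show "f \<in> {f \<in> carrier E.V. \<Phi> f = \<zero>\<^bsub>?F\<^esub>}"
        using E.cob_in_V[OF gK] g(2) by simp
    qed
    show "{f \<in> carrier E.V. \<Phi> f = \<zero>\<^bsub>?F\<^esub>} \<subseteq> ext1_coboundaries kS M N"
    proof
      fix f assume "f \<in> {f \<in> carrier E.V. \<Phi> f = \<zero>\<^bsub>?F\<^esub>}"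
      then have f: "f \<in> carrier E.V" and \<Phi>0: "\<And>i. \<Phi> f i = \<zero>\<^bsub>k\<^esub>" by auto
      let ?h = "\<lambda>\<kappa>. f (basis_vec kS \<kappa>)"
      note h = E.V_cob(1)[OF f]
      \<comment> \<open>The common value on X - Y; if that set is empty there is no letter to
        constrain it, and zero is taken.\<close>
      define c where "c = (if X - Y = {} then \<zero>\<^bsub>N\<^esub> else ?h (kap [a0]))"
      have c: "c \<in> carrier N" unfolding c_def using hc[OF f, of "[a0]"] a0 XY by auto
      have const: "?h (kap [a]) = c" if YX: "Y \<subseteq> X" and a: "a \<in> X - Y" for a
      proof -
        have cc: "c = ?h (kap [a0])" using a by (auto simp: c_def)
        have aS: "[a] \<in> carrier S" "[a0] \<in> carrier S" using a a0 XY by auto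
        show ?thesis
        proof (cases "a = a0")
          case False
          then have aI: "a \<in> I" using YX a by (simp add: I_def)
          then have "ev f [a] \<ominus>\<^bsub>k\<^esub> ev f [a0] = \<zero>\<^bsub>k\<^esub>" using \<Phi>0[of a] by (simp add: \<Phi>_def)
          then have "ev f [a] = ev f [a0]" using evc[OF f aS(1)] evc[OF f aS(2)] by simp
          then show ?thesis
            unfolding cc ev_def using N.coord(2)[OF hc[OF f aS(1)]] N.coord(2)[OF hc[OF f aS(2)]] by argo
        qed (simp add: cc)
      qed
      have "\<exists>\<theta>\<in>carrier N. \<forall>w\<in>carrier S. ?h (kap w) = inner_der \<theta> w"
        by (rule der_is_inner[OF hom_is_der[OF h] XY c const])
      then obtain \<theta> where \<theta>: "\<theta> \<in> carrier N" "\<forall>w\<in>carrier S. ?h (kap w) = inner_der \<theta> w"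
        by (elim bexE)
      have "\<exists>g\<in>mhom kS E.P0 N. \<forall>\<kappa>\<in>carrier E.Kz. ?h \<kappa> = g \<kappa>"
        by (rule inner_hom_extends[OF h \<theta>(1)]) (rule \<theta>(2)[rule_format])
      then obtain g where g: "g \<in> mhom kS E.P0 N" "\<forall>\<kappa>\<in>carrier E.Kz. ?h \<kappa> = g \<kappa>"
        by (elim bexE)
      have "E.cob ?h = E.cob g" by (rule E.cob_cong) (use g(2) in blast)
      then have "f = E.cob g" using E.V_cob(2)[OF f] by (rule trans[rotated])
      then show "f \<in> ext1_coboundaries kS M N" unfolding E.coboundaries_eq using g(1) by blast
    qed
  qed
  show ?thesis
    unfolding ext1_def
    using dim_quotient_module[OF K.field_axioms E.V_abelian_group finI E.V_smult_closed \<Phi>hom surj ker] cardI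
    by simp
qed

end

section \<open>The quiver of the monoid algebra\<close>

lemma (in free_lrb_algebra) dim_ext1_char_class:
  assumes "finite A" "U \<subseteq> A" "V \<subseteq> A"
  shows "vectorspace.dim k (ext1 kS (SOME M. M \<in> char_class U) (SOME N. N \<in> char_class V)) =
    (if V \<subseteq> U then card (U - V) - 1 else 0)"
proof -
  have "char_module W (SOME M. M \<in> char_class W)" for W
    using char_class_nonempty[of W] some_in_eq[of "char_class W"] by (simp add: char_class_def)
  then obtain g g' where "char_mod k A U (SOME M. M \<in> char_class U) g"
    "char_mod k A V (SOME M. M \<in> char_class V) g'"
    using char_moduleE by metis
  then have "char_pair k A U (SOME M. M \<in> char_class U) g V (SOME M. M \<in> char_class V) g'"
    by (intro char_pair.intro free_lrb_algebra_axioms)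
  then show ?thesis using assms by (rule char_pair.dim_ext1)
qed

text \<open>Position 0 of the filtered list holds the leader; \<open>Suc\<close> skips it and
  enumerates the remaining elements.\<close>

lemma filter_nth_Suc_bij:
  assumes "distinct L" "D \<subseteq> set L"
  shows "bij_betw (\<lambda>i. filter (\<lambda>a. a \<in> D) L ! Suc i) {..<card D - 1} {a \<in> D. a \<noteq> first_in L D}"
proof (cases "filter (\<lambda>a. a \<in> D) L")
  case Nil
  then have "D = {}" using assms(2) by (auto simp: filter_empty_conv)
  then show ?thesis by (simp add: bij_betw_def)
next
  case (Cons b bs)
  have d: "distinct (b # bs)" using assms(1) Cons by (metis distinct_filter)
  have "set (b # bs) = D" using assms(2) unfolding Cons[symmetric] by auto
  then have D: "D = insert b (set bs)" by simp
  then have card: "card D - 1 = length bs" using d by (simp add: distinct_card)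
  have "first_in L D = b" using Cons by (simp add: first_in_def)
  then have "{a \<in> D. a \<noteq> first_in L D} = set bs" using D d by auto
  then show ?thesis
    unfolding card using Cons d by (simp add: bij_betw_nth)
qed

theorem theorem13p1:
  fixes k :: "('k, 'c) ring_scheme" and A :: "'a set"
  assumes "field k" and "finite A"
  shows "algebra_isomorphic k
    (monoid_algebra k (free_lrb A))
    (path_algebra k (algebra_quiver k (monoid_algebra k (free_lrb A))))"
proof -
  obtain L where L: "set L = A" "distinct L" using finite_distinct_list[OF assms(2)] by auto
  interpret free_lrb_algebra k A using assms(1) by (rule free_lrb_algebra.intro)
  let ?Q = "algebra_quiver k kS"
  define supp where "supp = the_inv_into (Pow A) char_class"
  \<comment> \<open>The complement turns the descending arrows given by Ext^1 into the ascending
    ones that match the left-to-right product in the idempotent decomposition.\<close>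
  define \<sigma> where "\<sigma> C = A - supp C" for C
  \<comment> \<open>The i-th arrow receives the i-th letter after the leader of the
    difference.\<close>
  define lab where "lab = (\<lambda>(C, C', i). filter (\<lambda>a. a \<in> \<sigma> C' - \<sigma> C) L ! Suc i)"
  have inj: "inj_on char_class (Pow A)" using char_class_inj by (auto simp: inj_on_def)
  have V: "verts ?Q = char_class ` Pow A"
    by (simp add: algebra_quiver_def simple_classes_eq[OF assms(2)])
  have supp: "supp (char_class U) = U" if "U \<subseteq> A" for U
    unfolding supp_def using that by (intro the_inv_into_f_f[OF inj]) simp
  have \<sigma>: "\<sigma> (char_class U) = A - U" if "U \<subseteq> A" for U by (simp add: \<sigma>_def supp[OF that])
  have compl: "A - (A - U) = U" if "U \<subseteq> A" for U using that by (rule double_diff) simp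
  have vert: "\<exists>Y. Y \<subseteq> A \<and> C = char_class (A - Y)" if C: "C \<in> verts ?Q" for C
  proof -
    obtain U where U: "U \<in> Pow A" "C = char_class U" using C unfolding V by (rule imageE)
    then have "A - U \<subseteq> A \<and> C = char_class (A - (A - U))" using compl[of U] by simp
    then show ?thesis by (rule exI)
  qed
  have bij: "bij_betw \<sigma> (verts ?Q) (Pow (set L))"
    unfolding V L(1)
  proof (rule bij_betwI[of _ _ _ "\<lambda>Y. char_class (A - Y)"])
    show "\<sigma> \<in> char_class ` Pow A \<rightarrow> Pow A" by (auto simp: \<sigma>_def)
    show "(\<lambda>Y. char_class (A - Y)) \<in> Pow A \<rightarrow> char_class ` Pow A" by auto
    show "char_class (A - \<sigma> C) = C" if "C \<in> char_class ` Pow A" for C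
      using that by (auto simp: \<sigma> compl)
    show "\<sigma> (char_class (A - Y)) = Y" if "Y \<in> Pow A" for Y
      using that by (simp add: \<sigma> compl)
  qed
  have vin: "char_class (A - Y) \<in> verts ?Q" for Y using V by auto
  have \<sigma>c: "\<sigma> (char_class (A - Y)) = Y" if "Y \<subseteq> A" for Y using that by (simp add: \<sigma> compl)
  have dim: "vectorspace.dim k (ext1 kS (SOME M. M \<in> char_class (A - Y)) (SOME N. N \<in> char_class (A - X))) =
      (if Y \<subseteq> X then card (X - Y) - 1 else 0)" if "X \<subseteq> A" "Y \<subseteq> A" for X Y
  proof -
    \<comment> \<open>Complementing both sets reverses the inclusion and leaves the difference
      unchanged, so the dimension formula keeps its form.\<close>
    have "A - X \<subseteq> A - Y \<longleftrightarrow> Y \<subseteq> X" "(A - Y) - (A - X) = X - Y" using that by auto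
    then show ?thesis using dim_ext1_char_class[OF assms(2), of "A - Y" "A - X"] by simp
  qed
  have arcs: "arcs ?Q = {(char_class (A - Y), char_class (A - X), i) | Y X i.
      Y \<subseteq> X \<and> X \<subseteq> A \<and> i < card (X - Y) - 1}" (is "_ = ?R")
  proof
    show "arcs ?Q \<subseteq> ?R"
    proof
      fix e assume e: "e \<in> arcs ?Q"
      obtain C C' i where CC: "e = (C, C', i)" by (cases e)
      have e': "C \<in> verts ?Q" "C' \<in> verts ?Q"
        "i < vectorspace.dim k (ext1 kS (SOME M. M \<in> C) (SOME N. N \<in> C'))"
        using e by (auto simp: CC algebra_quiver_def)
      obtain Y X where YX: "Y \<subseteq> A" "C = char_class (A - Y)" "X \<subseteq> A" "C' = char_class (A - X)"
        using vert[OF e'(1)] vert[OF e'(2)] by blast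
      have "Y \<subseteq> X \<and> i < card (X - Y) - 1"
        using e'(3) dim[OF YX(3,1)] unfolding YX(2,4) by (auto split: if_splits)
      then show "e \<in> ?R" using YX CC by blast
    qed
    show "?R \<subseteq> arcs ?Q"
    proof
      fix e assume "e \<in> ?R"
      then obtain Y X i where e: "e = (char_class (A - Y), char_class (A - X), i)"
        "Y \<subseteq> X" "X \<subseteq> A" "i < card (X - Y) - 1" by blast
      have "i < vectorspace.dim k (ext1 kS (SOME M. M \<in> char_class (A - Y)) (SOME N. N \<in> char_class (A - X)))"
        using dim[of X Y] e by simp
      moreover have "char_class (A - Y) \<in> simple_classes kS" "char_class (A - X) \<in> simple_classes kS"
        using vin by (simp_all add: algebra_quiver_def)
      ultimately show "e \<in> arcs ?Q" by (simp add: algebra_quiver_def e(1))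
    qed
  qed
  have th: "tail ?Q (C, C', i) = C" "head ?Q (C, C', i) = C'" for C C' i
    by (simp_all add: algebra_quiver_def)
  have wf: "wf_digraph ?Q"
  proof
    fix e assume "e \<in> arcs ?Q"
    then show "tail ?Q e \<in> verts ?Q" "head ?Q e \<in> verts ?Q" unfolding arcs using th vin by auto
  qed
  let ?T = "{(Y, X, a). Y \<subseteq> X \<and> X \<subseteq> set L \<and> a \<in> X - Y \<and> a \<noteq> first_in L (X - Y)}"
  let ?f = "\<lambda>e. (\<sigma> (tail ?Q e), \<sigma> (head ?Q e), lab e)"
  have fe: "?f (char_class (A - Y), char_class (A - X), i) = (Y, X, filter (\<lambda>a. a \<in> X - Y) L ! Suc i)"
    if "Y \<subseteq> X" "X \<subseteq> A" for Y X i
    using that \<sigma>c[of X] \<sigma>c[of Y] by (simp add: th lab_def)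
  have nth: "bij_betw (\<lambda>i. filter (\<lambda>a. a \<in> X - Y) L ! Suc i) {..<card (X - Y) - 1}
      {a \<in> X - Y. a \<noteq> first_in L (X - Y)}" if "X \<subseteq> A" for X Y
    using that L by (intro filter_nth_Suc_bij) auto
  have abij: "bij_betw ?f (arcs ?Q) ?T"
    unfolding bij_betw_def
  proof
    show "inj_on ?f (arcs ?Q)"
    proof (rule inj_onI)
      fix e e' assume ee: "e \<in> arcs ?Q" "e' \<in> arcs ?Q" "?f e = ?f e'"
      obtain Y X i where e: "e = (char_class (A - Y), char_class (A - X), i)"
        "Y \<subseteq> X" "X \<subseteq> A" "i < card (X - Y) - 1" using ee(1) unfolding arcs by blast
      obtain Y' X' i' where e': "e' = (char_class (A - Y'), char_class (A - X'), i')"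
        "Y' \<subseteq> X'" "X' \<subseteq> A" "i' < card (X' - Y') - 1" using ee(2) unfolding arcs by blast
      have "(Y, X, filter (\<lambda>a. a \<in> X - Y) L ! Suc i) = (Y', X', filter (\<lambda>a. a \<in> X' - Y') L ! Suc i')"
        using ee(3) unfolding e(1) e'(1) fe[OF e(2,3)] fe[OF e'(2,3)] .
      then have eq: "Y = Y'" "X = X'" "filter (\<lambda>a. a \<in> X - Y) L ! Suc i = filter (\<lambda>a. a \<in> X - Y) L ! Suc i'"
        by auto
      then have "i = i'" using nth[OF e(3), of Y] e(4) e'(4) by (auto simp: bij_betw_def inj_on_def)
      then show "e = e'" using e(1) e'(1) eq by simp
    qed
    show "?f ` arcs ?Q = ?T"
    proof
      show "?f ` arcs ?Q \<subseteq> ?T"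
      proof
        fix t assume "t \<in> ?f ` arcs ?Q"
        then obtain e where te: "t = ?f e" "e \<in> arcs ?Q" by blast
        obtain Y X i where e: "e = (char_class (A - Y), char_class (A - X), i)"
          "Y \<subseteq> X" "X \<subseteq> A" "i < card (X - Y) - 1" using te(2) unfolding arcs by blast
        have "t = (Y, X, filter (\<lambda>a. a \<in> X - Y) L ! Suc i)"
          unfolding te(1) e(1) by (rule fe[OF e(2,3)])
        moreover have "filter (\<lambda>a. a \<in> X - Y) L ! Suc i \<in> {a \<in> X - Y. a \<noteq> first_in L (X - Y)}"
          using nth[OF e(3), of Y] e(4) by (auto simp: bij_betw_def)
        ultimately show "t \<in> ?T" using e L by auto
      qed
      show "?T \<subseteq> ?f ` arcs ?Q"
      proof
        fix t assume "t \<in> ?T"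
        then obtain Y X a where t: "t = (Y, X, a)" "Y \<subseteq> X" "X \<subseteq> A" "a \<in> {a \<in> X - Y. a \<noteq> first_in L (X - Y)}"
          using L by auto
        have "a \<in> (\<lambda>i. filter (\<lambda>a. a \<in> X - Y) L ! Suc i) ` {..<card (X - Y) - 1}"
          unfolding bij_betw_imp_surj_on[OF nth[OF t(3), of Y]] by (rule t(4))
        then obtain i where i: "i < card (X - Y) - 1" "a = filter (\<lambda>a. a \<in> X - Y) L ! Suc i"
          by (elim imageE) (simp only: lessThan_iff)
        then have "(char_class (A - Y), char_class (A - X), i) \<in> arcs ?Q" unfolding arcs using t by blast
        moreover have "t = ?f (char_class (A - Y), char_class (A - X), i)"
          unfolding fe[OF t(2,3)] t(1) i(2) ..
        ultimately show "t \<in> ?f ` arcs ?Q" by (rule rev_image_eqI)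
      qed
    qed
  qed
  have "lrb_quiver k L ?Q \<sigma> lab"
    by (intro lrb_quiver.intro lrb_quiver_axioms.intro free_lrb_algebra_axioms L(2) bij wf abij)
  then show ?thesis using lrb_quiver.algebra_isomorphic_path_algebra[of k L ?Q] by (simp add: L(1))
qed

end
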